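(* Let $\mathcal H$ be a complex Hilbert space, $\mathcal B(\mathcal H)$ the bounded operators and $\mathcal K(\mathcal H)$ the compact operators on $\mathcal H$. Suppose $Y_0\subset\mathcal Z_0$ is connected and let $f:Y\to\mathcal K(\mathcal H)$ be either Hahn holomorphic, or Hahn meromorphic such that all coefficients of $e_\gamma$ with $\gamma<0$ in the Hahn series of $f$ and all Laurent coefficients in the principal parts of $f$ at its poles away from the point $z=0$ have range in a common finite dimensional subspace $\mathcal H_0\subset\mathcal H$. Then either $\mathrm{Id}-f(z)\in\mathcal B(\mathcal H)$ is invertible nowhere in $Y_0$, or its inverse $(\mathrm{Id}-f(z))^{-1}$ exists everywhere except at a discrete set of points in $Y_0$ and defines a Hahn meromorphic function (with values in $\mathcal B(\mathcal H)$). Moreover, in the latter case, in the Hahn series of $(\mathrm{Id}-f(z))^{-1}$ the coefficients of $e_\gamma$ with $\gamma<0$ are finite rank operators, and the coefficients in the principal part of its Laurent expansion at points away from $z=0$ are finite rank operators, too.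
   Context: Logarithmic cover. $\mathcal Z$ is the logarithmic covering surface of $\mathbb C\setminus\{0\}$ with global polar coordinates $(r,\varphi)\in(0,\infty)\times\mathbb R$; for $z=(r,\varphi)$ write $|z|=r$, $\arg z=\varphi$. $\mathcal Z_0=\mathcal Z\cup\{0\}$ carries the topology generated by the open sets of $\mathcal Z$ and the discs $D_\epsilon=\{0\}\cup\{z\in\mathcal Z: |z|<\epsilon\}$. The positive real axis is identified with $\{z\in\mathcal Z:\arg z=0\}$. $Y\subset\mathcal Z$ is an open set containing an interval $(0,\delta)$ for some $\delta>0$, and $Y_0=Y\cup\{0\}$. Exponents. $(\Gamma,+)$ is a linearly ordered abelian group, $\Gamma^+=\{\gamma\in\Gamma:\gamma>0\}$, $\Gamma^+_0=\Gamma^+\cup\{0\}$. $\gamma\mapsto e_\gamma$ is a group homomorphism from $\Gamma$ to the multiplicative group of nowhere vanishing holomorphic functions on $Y$, such that for every $\gamma>0$ the function $e_\gamma$ is bounded on $Y$ and $\lim_{z\to0}|e_\gamma(z)|=0$. Put $\|e_\gamma\|_{Y,\epsilon}=\sup_{z\in Y\cap D_\epsilon}|e_\gamma(z)|$. Hahn series. A Hahn series with coefficients in a ring $\mathcal R$ is a formal series $\mathfrak h=\sum_{\gamma\in\Gamma}a_\gamma e_\gamma$, $a_\gamma\in\mathcal R$, whose support $\{\gamma: a_\gamma\ne0\}$ is well-ordered; these form a ring $\mathcal R[[e_\Gamma]]$ under termwise addition and the product with coefficients $c_\gamma=\sum_{\alpha+\beta=\gamma}a_\alpha b_\beta$; it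 is a field if $\mathcal R$ is a field. For normed $\mathcal R$, $\mathfrak h$ is normally convergent in $Y\cap D_\epsilon$ if its support is countable and $\sum_\gamma\|a_\gamma\|\,\|e_\gamma\|_{Y,\epsilon}<\infty$. Admissibility. For $S\subset\Gamma_0^+$, a family $\{e_\alpha\}_{\alpha\in S}$ is weakly monotonous if there is $r_S>0$ such that for every $x\in(0,r_S)$ there is $\rho(x)$ with $0<\rho(x)\le x$ and $\|e_\alpha\|_{Y,\rho(x)}\le|e_\alpha(x)|$ for all $\alpha\in S$. A (well-ordered) set $S\subset\Gamma^+_0$ is admissible if $\{e_\alpha\}_{\alpha\in S}$ is weakly monotonous and for every nonempty $B\subset S$ the family $\{e_{\alpha-\min B}\}_{\alpha\in S,\ \alpha>\min B}$ is weakly monotonous. Hahn holomorphic. Let $\mathcal R$ be a Banach algebra. A continuous function $h:Y_0\to\mathcal R$, holomorphic in $Y$, is Hahn holomorphic if there is a Hahn series $\sum_\gamma a_\gamma e_\gamma$ with countable admissible support (contained in $\Gamma_0^+$), converging normally on $Y\cap D_\delta$ for some $\delta>0$, with $h(z)=\sum_\gamma a_\gamma e_\gamma(z)$ for $z\in Y\cap D_\delta$. Hahn meromorphic. A function $h:Y\to\mathcal R$ is Hahn meromorphic if it is meromorphic on $Y$ and there are $\delta>0$ and a non-zero complex-valued Hahn holomorphic function $g$ on $Y_0\cap D_\delta$ such that $gh$ is a Hahn holomorphic function on $Y_0\cap D_\delta$ with values in $\mathcal R$. Its Hahn series is $\mathfrak g^{-1}\cdot\mathfrak k\in\mathcal R[[e_\Gamma]]$,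 where $\mathfrak g,\mathfrak k$ are the Hahn series of $g$ and of $gh$, and $\mathfrak g^{-1}$ is the inverse in the field $\mathbb C[[e_\Gamma]]$. *)

theory Defs
  imports "HOL-Analysis.Analysis"
begin

section \<open>Complex normed spaces, Banach algebras and Hilbert spaces\<close>

class complex_normed_vector = real_normed_vector +
  fixes scaleC :: "complex \<Rightarrow> 'a \<Rightarrow> 'a" (infixr \<open>*\<^sub>C\<close> 75)
  assumes scaleC_add_right: "c *\<^sub>C (x + y) = c *\<^sub>C x + c *\<^sub>C y"
    and scaleC_add_left: "(c + d) *\<^sub>C x = c *\<^sub>C x + d *\<^sub>C x"
    and scaleC_scaleC: "c *\<^sub>C d *\<^sub>C x = (c * d) *\<^sub>C x"
    and scaleC_one: "1 *\<^sub>C x = x"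
    and scaleR_scaleC: "r *\<^sub>R x = complex_of_real r *\<^sub>C x"
    and norm_scaleC: "norm (c *\<^sub>C x) = cmod c * norm x"

text \<open>No unit is required, so that the operators on the zero space form an instance
  as well (in \<^class>\<open>ring_1\<close>, \<open>0 \<noteq> 1\<close> is an axiom).\<close>

class complex_banach_algebra = complex_normed_vector + real_normed_algebra + complete_space +
  assumes mult_scaleC_left: "(c *\<^sub>C x) * y = c *\<^sub>C (x * y)"
    and mult_scaleC_right: "x * (c *\<^sub>C y) = c *\<^sub>C (x * y)"
begin
subclass banach ..
end

text \<open>The inner product is antilinear in its first argument; positive definiteness
  is contained in the last axiom.\<close>

class complex_hilbert_space = complex_normed_vector + complete_space +
  fixes cinner :: "'a \<Rightarrow> 'a \<Rightarrow> complex"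
  assumes cinner_commute: "cinner x y = cnj (cinner y x)"
    and cinner_add_right: "cinner x (y + z) = cinner x y + cinner x z"
    and cinner_scaleC_right: "cinner x (c *\<^sub>C y) = c * cinner x y"
    and cinner_self: "cinner x x = complex_of_real ((norm x)\<^sup>2)"
begin
subclass banach ..
end

global_interpretation complex_vector: vector_space "scaleC :: complex \<Rightarrow> 'a \<Rightarrow> 'a :: complex_normed_vector"
  defines cspan_raw_def: cspan = complex_vector.span
  by unfold_locales (simp_all add: scaleC_add_right scaleC_add_left scaleC_scaleC scaleC_one)

definition fin_dim_csubspace :: "'a::complex_normed_vector set \<Rightarrow> bool" where
  "fin_dim_csubspace V \<longleftrightarrow> (\<exists>B. finite B \<and> V = cspan B)"

instantiation complex :: "{complex_banach_algebra, complex_hilbert_space}"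
begin

definition scaleC_complex :: "complex \<Rightarrow> complex \<Rightarrow> complex" where
  "scaleC_complex c x = c * x"

definition cinner_complex :: "complex \<Rightarrow> complex \<Rightarrow> complex" where
  "cinner_complex x y = cnj x * y"

instance
  by standard
    (simp_all add: scaleC_complex_def cinner_complex_def algebra_simps norm_mult scaleR_conv_of_real
      complex_norm_square[symmetric])

end


section \<open>Bounded operators\<close>

typedef (overloaded) 'a bop =
  "{T :: 'a::complex_normed_vector \<Rightarrow>\<^sub>L 'a. \<forall>c x. blinfun_apply T (c *\<^sub>C x) = c *\<^sub>C blinfun_apply T x}"
  morphisms blinfun_of_bop Bop
  by (rule exI[of _ 0]) (simp add: complex_vector.scale_zero_right)

setup_lifting type_definition_bop

lift_definition bop_apply :: "'a::complex_normed_vector bop \<Rightarrow> 'a \<Rightarrow> 'a" is blinfun_apply .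

lemma bop_eqI: "(\<And>x. bop_apply S x = bop_apply T x) \<Longrightarrow> S = T"
  by transfer (rule blinfun_eqI)

instantiation bop :: (complex_normed_vector) complex_normed_vector
begin

lift_definition norm_bop :: "'a bop \<Rightarrow> real" is norm .

lift_definition zero_bop :: "'a bop" is 0
  by (simp add: complex_vector.scale_zero_right)

lift_definition plus_bop :: "'a bop \<Rightarrow> 'a bop \<Rightarrow> 'a bop" is "(+)"
  by (simp add: blinfun.bilinear_simps scaleC_add_right)

lift_definition uminus_bop :: "'a bop \<Rightarrow> 'a bop" is uminus
  by (simp add: blinfun.bilinear_simps complex_vector.scale_minus_right)

lift_definition minus_bop :: "'a bop \<Rightarrow> 'a bop \<Rightarrow> 'a bop" is "(-)"
  by (simp add: blinfun.bilinear_simps complex_vector.scale_right_diff_distrib)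

lift_definition scaleR_bop :: "real \<Rightarrow> 'a bop \<Rightarrow> 'a bop" is scaleR
  by (simp add: blinfun.bilinear_simps scaleR_scaleC scaleC_scaleC mult.commute)

lemma bounded_linear_scaleC: "bounded_linear (\<lambda>x::'b::complex_normed_vector. c *\<^sub>C x)"
  by (rule bounded_linear_intro[where K = "cmod c"])
    (simp_all add: scaleC_add_right scaleR_scaleC scaleC_scaleC norm_scaleC mult.commute)

lift_definition scaleC_bop :: "complex \<Rightarrow> 'a bop \<Rightarrow> 'a bop"
  is "\<lambda>c T. Blinfun (\<lambda>x. c *\<^sub>C blinfun_apply T x)"
  by (simp add: bounded_linear_Blinfun_apply bounded_linear_compose[OF bounded_linear_scaleC]
      blinfun.bounded_linear_right scaleC_scaleC mult.commute)

definition dist_bop :: "'a bop \<Rightarrow> 'a bop \<Rightarrow> real" where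
  "dist_bop S T = norm (S - T)"

definition sgn_bop :: "'a bop \<Rightarrow> 'a bop" where
  "sgn_bop T = inverse (norm T) *\<^sub>R T"

definition uniformity_bop :: "('a bop \<times> 'a bop) filter" where
  "uniformity_bop = (INF e\<in>{0<..}. principal {(S, T). dist S T < e})"

definition open_bop :: "'a bop set \<Rightarrow> bool" where
  "open_bop U = (\<forall>S\<in>U. \<forall>\<^sub>F (S', T) in uniformity. S' = S \<longrightarrow> T \<in> U)"

lemma blinfun_apply_scaleC:
  "blinfun_apply (Blinfun (\<lambda>x. c *\<^sub>C blinfun_apply (T :: 'b::complex_normed_vector \<Rightarrow>\<^sub>L 'b) x)) x
    = c *\<^sub>C blinfun_apply T x"
  by (simp add: bounded_linear_Blinfun_apply bounded_linear_compose[OF bounded_linear_scaleC]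
      blinfun.bounded_linear_right)

lemma norm_Blinfun_scaleC:
  fixes T :: "'b::complex_normed_vector \<Rightarrow>\<^sub>L 'b"
  shows "norm (Blinfun (\<lambda>x. c *\<^sub>C blinfun_apply T x)) = cmod c * norm T"
proof -
  have le: "norm (Blinfun (\<lambda>x. c *\<^sub>C blinfun_apply T x)) \<le> cmod c * norm T"
    for c and T :: "'b \<Rightarrow>\<^sub>L 'b"
    by (rule norm_blinfun_bound)
      (auto simp: blinfun_apply_scaleC norm_scaleC mult.assoc intro!: mult_left_mono norm_blinfun)
  show ?thesis
  proof (cases "c = 0")
    case True
    then show ?thesis using le[of c T] by simp
  next
    case False
    let ?S = "Blinfun (\<lambda>x. c *\<^sub>C blinfun_apply T x)"
    have "T = Blinfun (\<lambda>x. inverse c *\<^sub>C blinfun_apply ?S x)"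
      by (rule blinfun_eqI) (simp only: blinfun_apply_scaleC scaleC_scaleC, simp add: scaleC_one False)
    then have "norm T \<le> cmod (inverse c) * norm ?S"
      using le[of "inverse c" ?S] by simp
    then have "norm T \<le> norm ?S / cmod c"
      by (simp add: norm_inverse divide_inverse mult.commute)
    then have "cmod c * norm T \<le> norm ?S"
      using False by (simp add: pos_le_divide_eq mult.commute)
    with le[of c T] show ?thesis by simp
  qed
qed

lemma bop_apply_add: "bop_apply (S + T) x = bop_apply S x + bop_apply T (x :: 'a)"
  by transfer (rule blinfun.add_left)

lemma bop_apply_scaleR: "bop_apply (r *\<^sub>R T) x = r *\<^sub>R bop_apply T (x :: 'a)"
  by transfer (rule blinfun.scaleR_left)

lemma bop_apply_scaleC: "bop_apply (c *\<^sub>C T) x = c *\<^sub>C bop_apply T (x :: 'a)"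
  by transfer (rule blinfun_apply_scaleC)

instance
proof
  fix c d :: complex and r s :: real and R S T :: "'a bop"
  show "R + S + T = R + (S + T)" "R + S = S + R" "0 + R = R" "- R + R = 0" "R - S = R + - S"
    by (transfer, simp)+
  show "r *\<^sub>R (S + T) = r *\<^sub>R S + r *\<^sub>R T" "(r + s) *\<^sub>R T = r *\<^sub>R T + s *\<^sub>R T"
    "r *\<^sub>R s *\<^sub>R T = (r * s) *\<^sub>R T" "1 *\<^sub>R T = T"
    by (transfer, simp add: algebra_simps)+
  show "dist S T = norm (S - T)" "sgn T = inverse (norm T) *\<^sub>R T"
    "(uniformity :: ('a bop \<times> 'a bop) filter) = (INF e\<in>{0<..}. principal {(S, T). dist S T < e})"
    by (simp_all add: dist_bop_def sgn_bop_def uniformity_bop_def)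
  show "open U = (\<forall>S\<in>U. \<forall>\<^sub>F (S', T) in uniformity. S' = S \<longrightarrow> T \<in> U)" for U :: "'a bop set"
    by (rule open_bop_def)
  show "norm T = 0 \<longleftrightarrow> T = 0" "norm (S + T) \<le> norm S + norm T"
    "norm (r *\<^sub>R T) = \<bar>r\<bar> * norm T"
    by (transfer, simp add: norm_triangle_ineq)+
  show "c *\<^sub>C (S + T) = c *\<^sub>C S + c *\<^sub>C T" "(c + d) *\<^sub>C T = c *\<^sub>C T + d *\<^sub>C T"
    "c *\<^sub>C d *\<^sub>C T = (c * d) *\<^sub>C T" "1 *\<^sub>C T = T" "r *\<^sub>R T = complex_of_real r *\<^sub>C T"
    by (rule bop_eqI, simp only: bop_apply_add bop_apply_scaleR bop_apply_scaleC scaleC_add_right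
        scaleC_add_left scaleC_scaleC scaleC_one scaleR_scaleC)+
  show "norm (c *\<^sub>C T) = cmod c * norm T"
    by transfer (rule norm_Blinfun_scaleC)
qed

end

text \<open>Multiplication of operators is composition.\<close>

instantiation bop :: (complex_normed_vector) monoid_mult
begin

lift_definition one_bop :: "'a bop" is id_blinfun
  by simp

lift_definition times_bop :: "'a bop \<Rightarrow> 'a bop \<Rightarrow> 'a bop" is blinfun_compose
  by simp

instance
  by standard (transfer, rule blinfun_eqI, simp)+

end

lemma bop_apply_times: "bop_apply (S * T) x = bop_apply S (bop_apply T x)"
  by transfer simp

lemma bop_apply_add_right: "bop_apply T (x + y) = bop_apply T x + bop_apply T y"
  by transfer (rule blinfun.add_right)

lemma bop_apply_scaleR_right: "bop_apply T (r *\<^sub>R x) = r *\<^sub>R bop_apply T x"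
  by transfer (rule blinfun.scaleR_right)

lemma bop_apply_scaleC_right: "bop_apply T (c *\<^sub>C x) = c *\<^sub>C bop_apply T x"
  by transfer simp

instance bop :: (complex_hilbert_space) complex_banach_algebra
proof
  fix c :: complex and r :: real and R S T :: "'a bop"
  show "(R + S) * T = R * T + S * T" "R * (S + T) = R * S + R * T"
    "r *\<^sub>R S * T = r *\<^sub>R (S * T)" "S * r *\<^sub>R T = r *\<^sub>R (S * T)"
    by (rule bop_eqI, simp only: bop_apply_add bop_apply_scaleR bop_apply_scaleC bop_apply_times
        bop_apply_add_right bop_apply_scaleR_right)+
  show "norm (S * T) \<le> norm S * norm T"
    by transfer (rule norm_blinfun_compose)
  show "c *\<^sub>C S * T = c *\<^sub>C (S * T)" "S * c *\<^sub>C T = c *\<^sub>C (S * T)"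
    by (rule bop_eqI, simp only: bop_apply_scaleC bop_apply_times bop_apply_scaleC_right)+
next
  fix X :: "nat \<Rightarrow> 'a bop"
  have dist: "dist S T = dist (blinfun_of_bop S) (blinfun_of_bop T)" for S T :: "'a bop"
    by (simp add: dist_bop_def dist_blinfun_def norm_bop.rep_eq minus_bop.rep_eq)
  assume "Cauchy X"
  then have "Cauchy (\<lambda>n. blinfun_of_bop (X n))"
    by (simp add: Cauchy_def dist)
  then obtain L where L: "(\<lambda>n. blinfun_of_bop (X n)) \<longlonglongrightarrow> L"
    by (auto simp: Cauchy_convergent_iff convergent_def)
  have "blinfun_apply L (c *\<^sub>C x) = c *\<^sub>C blinfun_apply L x" for c x
  proof (rule LIMSEQ_unique)
    show "(\<lambda>n. blinfun_apply (blinfun_of_bop (X n)) (c *\<^sub>C x)) \<longlonglongrightarrow> blinfun_apply L (c *\<^sub>C x)"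
      by (intro tendsto_intros L)
    have "(\<lambda>n. c *\<^sub>C blinfun_apply (blinfun_of_bop (X n)) x) \<longlonglongrightarrow> c *\<^sub>C blinfun_apply L x"
      by (intro bounded_linear.tendsto[OF bounded_linear_scaleC] tendsto_intros L)
    moreover have "c *\<^sub>C blinfun_apply (blinfun_of_bop (X n)) x
        = blinfun_apply (blinfun_of_bop (X n)) (c *\<^sub>C x)" for n
      using blinfun_of_bop[of "X n"] by simp
    ultimately show "(\<lambda>n. blinfun_apply (blinfun_of_bop (X n)) (c *\<^sub>C x)) \<longlonglongrightarrow> c *\<^sub>C blinfun_apply L x"
      by simp
  qed
  then have "blinfun_of_bop (Bop L) = L"
    by (simp add: Bop_inverse)
  with L have "X \<longlonglongrightarrow> Bop L"
    by (simp add: lim_sequentially dist)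
  then show "convergent X"
    by (auto simp: convergent_def)
qed

definition compact_ops :: "'a::complex_normed_vector bop set" where
  "compact_ops = {T. compact (closure (bop_apply T ` cball 0 1))}"

definition finite_rank :: "'a::complex_normed_vector bop \<Rightarrow> bool" where
  "finite_rank T \<longleftrightarrow> fin_dim_csubspace (range (bop_apply T))"

definition bop_invertible :: "'a::complex_normed_vector bop \<Rightarrow> bool" where
  "bop_invertible T \<longleftrightarrow> (\<exists>S. S * T = 1 \<and> T * S = 1)"


section \<open>The logarithmic cover with the point 0 added\<close>

text \<open>A point of the cover is given by its polar coordinates; the added point \<open>0\<close> is
  represented by the pair \<open>(0, 0)\<close>.\<close>

typedef logcover0 = "{p :: real \<times> real. 0 < fst p \<or> p = (0, 0)}"
  morphisms polar_coords of_polar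
  by auto

definition zmod :: "logcover0 \<Rightarrow> real" where
  "zmod z = fst (polar_coords z)"

definition zarg :: "logcover0 \<Rightarrow> real" where
  "zarg z = snd (polar_coords z)"

definition zreal :: "real \<Rightarrow> logcover0" where
  "zreal x = of_polar (x, 0)"

instantiation logcover0 :: zero
begin
definition zero_logcover0 :: logcover0 where
  "zero_logcover0 = of_polar (0, 0)"
instance ..
end

definition zdisc :: "real \<Rightarrow> logcover0 set" where
  "zdisc \<epsilon> = {z. zmod z < \<epsilon>}"

instantiation logcover0 :: topological_space
begin
definition open_logcover0 :: "logcover0 set \<Rightarrow> bool" where
  "open_logcover0 = generate_topology
     ({of_polar ` U | U. open U \<and> U \<subseteq> {0<..} \<times> UNIV} \<union> {zdisc \<epsilon> | \<epsilon>. 0 < \<epsilon>})"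
instance
  by standard
    (simp_all add: open_logcover0_def generate_topology.UNIV generate_topology.Int generate_topology.UN)
end

text \<open>The covering map \<open>(r, \<phi>) \<mapsto> r e\<^bsup>i\<phi>\<^esup>\<close> onto the punctured plane. It is a local
  coordinate at every point other than \<open>0\<close> and defines the complex structure.\<close>

definition zproj :: "logcover0 \<Rightarrow> complex" where
  "zproj z = rcis (zmod z) (zarg z)"

definition has_zderiv :: "(logcover0 \<Rightarrow> 'a::complex_normed_vector) \<Rightarrow> 'a \<Rightarrow> logcover0 \<Rightarrow> bool" where
  "has_zderiv h D z \<longleftrightarrow> ((\<lambda>w. inverse (zproj w - zproj z) *\<^sub>C (h w - h z)) \<longlongrightarrow> D) (at z)"

text \<open>Only meant for \<open>U\<close> open and not containing \<open>0\<close>.\<close>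

definition zholomorphic_on :: "(logcover0 \<Rightarrow> 'a::complex_normed_vector) \<Rightarrow> logcover0 set \<Rightarrow> bool" where
  "zholomorphic_on h U \<longleftrightarrow> (\<forall>z\<in>U. \<exists>D. has_zderiv h D z)"

definition has_laurent_expansion_at ::
  "(logcover0 \<Rightarrow> 'a::complex_normed_vector) \<Rightarrow> logcover0 \<Rightarrow> (int \<Rightarrow> 'a) \<Rightarrow> bool" where
  "has_laurent_expansion_at h z A \<longleftrightarrow>
     (\<exists>m. \<forall>k<m. A k = 0) \<and>
     (\<forall>\<^sub>F w in at z. ((\<lambda>k. ((zproj w - zproj z) powi k) *\<^sub>C A k) has_sum h w) UNIV)"

definition zpoles :: "logcover0 set \<Rightarrow> (logcover0 \<Rightarrow> 'a::complex_normed_vector) \<Rightarrow> logcover0 set" where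
  "zpoles Y h = {z\<in>Y. \<exists>A. has_laurent_expansion_at h z A \<and> (\<exists>k<0. A k \<noteq> 0)}"

text \<open>A meromorphic function is rendered as a total function whose values at its poles are
  irrelevant.\<close>

definition zmeromorphic_on :: "(logcover0 \<Rightarrow> 'a::complex_normed_vector) \<Rightarrow> logcover0 set \<Rightarrow> bool" where
  "zmeromorphic_on h Y \<longleftrightarrow> (\<forall>z\<in>Y. \<not> z islimpt zpoles Y h) \<and> zholomorphic_on h (Y - zpoles Y h)"


section \<open>Hahn series\<close>

definition well_ordered :: "'g::linorder set \<Rightarrow> bool" where
  "well_ordered S \<longleftrightarrow> (\<forall>B\<subseteq>S. B \<noteq> {} \<longrightarrow> (\<exists>m\<in>B. \<forall>b\<in>B. m \<le> b))"

definition hsupp :: "('g \<Rightarrow> 'a::zero) \<Rightarrow> 'g set" where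
  "hsupp a = {\<gamma>. a \<gamma> \<noteq> 0}"

definition hahn_series :: "('g::linorder \<Rightarrow> 'a::zero) \<Rightarrow> bool" where
  "hahn_series a \<longleftrightarrow> well_ordered (hsupp a)"

definition hahn_one :: "'g::zero \<Rightarrow> complex" where
  "hahn_one \<gamma> = (if \<gamma> = 0 then 1 else 0)"

text \<open>The product of a complex Hahn series with one whose coefficients lie in a complex
  space; the index set of the sum is finite when both are Hahn series. For complex \<open>b\<close>
  this is the product of the field of complex Hahn series.\<close>

definition hahn_mult ::
  "('g::linordered_ab_group_add \<Rightarrow> complex) \<Rightarrow> ('g \<Rightarrow> 'a::complex_normed_vector) \<Rightarrow> 'g \<Rightarrow> 'a" where
  "hahn_mult a b \<gamma> = (\<Sum>(\<alpha>, \<beta>)\<in>{(\<alpha>, \<beta>). \<alpha> \<in> hsupp a \<and> \<beta> \<in> hsupp b \<and> \<alpha> + \<beta> = \<gamma>}. a \<alpha> *\<^sub>C b \<beta>)"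

definition is_hahn_inverse ::
  "('g::linordered_ab_group_add \<Rightarrow> complex) \<Rightarrow> ('g \<Rightarrow> complex) \<Rightarrow> bool" where
  "is_hahn_inverse a b \<longleftrightarrow> hahn_series b \<and> hahn_mult a b = hahn_one"


section \<open>Exponents, convergence, admissibility\<close>

locale hahn_exponents =
  fixes Y :: "logcover0 set"
    and e :: "'g::linordered_ab_group_add \<Rightarrow> logcover0 \<Rightarrow> complex"
  assumes open_Y: "open Y"
    and zero_notin_Y: "0 \<notin> Y"
    and interval_in_Y: "\<exists>\<delta>>0. zreal ` {0<..<\<delta>} \<subseteq> Y"
    and e_holomorphic: "zholomorphic_on (e \<gamma>) Y"
    and e_nonzero: "z \<in> Y \<Longrightarrow> e \<gamma> z \<noteq> 0"
    and e_add: "z \<in> Y \<Longrightarrow> e (\<alpha> + \<beta>) z = e \<alpha> z * e \<beta> z"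
    and e_bounded: "0 < \<gamma> \<Longrightarrow> bounded (e \<gamma> ` Y)"
    and e_tendsto_0: "0 < \<gamma> \<Longrightarrow> ((\<lambda>z. cmod (e \<gamma> z)) \<longlongrightarrow> 0) (at 0 within Y)"

text \<open>As a real supremum this is meaningful for \<open>\<gamma> \<ge> 0\<close>, the only exponents for which
  it is used below.\<close>

definition exp_norm ::
  "logcover0 set \<Rightarrow> ('g \<Rightarrow> logcover0 \<Rightarrow> complex) \<Rightarrow> real \<Rightarrow> 'g \<Rightarrow> real" where
  "exp_norm Y e \<epsilon> \<gamma> = (SUP z\<in>Y \<inter> zdisc \<epsilon>. cmod (e \<gamma> z))"

definition normally_convergent ::
  "logcover0 set \<Rightarrow> ('g \<Rightarrow> logcover0 \<Rightarrow> complex) \<Rightarrow> real \<Rightarrow> ('g \<Rightarrow> 'a::real_normed_vector) \<Rightarrow> bool" where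
  "normally_convergent Y e \<epsilon> a \<longleftrightarrow>
     countable (hsupp a) \<and> (\<lambda>\<gamma>. norm (a \<gamma>) * exp_norm Y e \<epsilon> \<gamma>) summable_on hsupp a"

text \<open>Shrinking \<open>r\<close> is always possible, so requiring \<open>(0, r) \<subseteq> Y\<close> only ensures that
  \<open>e \<alpha> x\<close> is defined.\<close>

definition weakly_monotonous ::
  "logcover0 set \<Rightarrow> ('g \<Rightarrow> logcover0 \<Rightarrow> complex) \<Rightarrow> 'g set \<Rightarrow> bool" where
  "weakly_monotonous Y e S \<longleftrightarrow>
     (\<exists>r>0. zreal ` {0<..<r} \<subseteq> Y \<and>
        (\<forall>x\<in>{0<..<r}. \<exists>\<rho>. 0 < \<rho> \<and> \<rho> \<le> x \<and> (\<forall>\<alpha>\<in>S. exp_norm Y e \<rho> \<alpha> \<le> cmod (e \<alpha> (zreal x)))))"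

definition admissible ::
  "logcover0 set \<Rightarrow> ('g::linordered_ab_group_add \<Rightarrow> logcover0 \<Rightarrow> complex) \<Rightarrow> 'g set \<Rightarrow> bool" where
  "admissible Y e S \<longleftrightarrow>
     S \<subseteq> {0..} \<and> well_ordered S \<and> weakly_monotonous Y e S \<and>
     (\<forall>B\<subseteq>S. B \<noteq> {} \<longrightarrow>
        weakly_monotonous Y e {\<alpha> - (LEAST \<beta>. \<beta> \<in> B) | \<alpha>. \<alpha> \<in> S \<and> (LEAST \<beta>. \<beta> \<in> B) < \<alpha>})"


section \<open>Hahn holomorphic and Hahn meromorphic functions\<close>

text \<open>The set \<open>R\<close> is the Banach algebra in which functions and coefficients take their
  values: a closed subalgebra of the ambient type, below either everything or the compact
  operators. The point \<open>0\<close> is adjoined to the domain \<open>Y\<close>.\<close>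

definition hahn_holomorphic_with ::
  "logcover0 set \<Rightarrow> ('g::linordered_ab_group_add \<Rightarrow> logcover0 \<Rightarrow> complex) \<Rightarrow>
    'a::complex_banach_algebra set \<Rightarrow> (logcover0 \<Rightarrow> 'a) \<Rightarrow> ('g \<Rightarrow> 'a) \<Rightarrow> bool" where
  "hahn_holomorphic_with Y e R h a \<longleftrightarrow>
     h ` insert 0 Y \<subseteq> R \<and> continuous_on (insert 0 Y) h \<and> zholomorphic_on h Y \<and>
     range a \<subseteq> R \<and> countable (hsupp a) \<and> admissible Y e (hsupp a) \<and>
     (\<exists>\<delta>>0. normally_convergent Y e \<delta> a \<and>
        (\<forall>z\<in>Y \<inter> zdisc \<delta>. ((\<lambda>\<gamma>. e \<gamma> z *\<^sub>C a \<gamma>) has_sum h z) (hsupp a)))"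

definition hahn_holomorphic ::
  "logcover0 set \<Rightarrow> ('g::linordered_ab_group_add \<Rightarrow> logcover0 \<Rightarrow> complex) \<Rightarrow>
    'a::complex_banach_algebra set \<Rightarrow> (logcover0 \<Rightarrow> 'a) \<Rightarrow> bool" where
  "hahn_holomorphic Y e R h \<longleftrightarrow> (\<exists>a. hahn_holomorphic_with Y e R h a)"

text \<open>\<open>h\<close> is Hahn meromorphic with Hahn series \<open>a\<close>. The value of \<open>h\<close> at \<open>0\<close> plays no role,
  and \<open>k\<close> is the product \<open>g h\<close>, extended continuously to \<open>0\<close> and to poles of \<open>h\<close> that are
  cancelled by \<open>g\<close>. The non-vanishing of \<open>g\<close> is required for its Hahn series \<open>b\<close>, which is
  what the inverse needs; it could otherwise be met by a function that is non-zero only on a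
  component of the domain away from \<open>0\<close>.\<close>

definition hahn_meromorphic_with ::
  "logcover0 set \<Rightarrow> ('g::linordered_ab_group_add \<Rightarrow> logcover0 \<Rightarrow> complex) \<Rightarrow>
    'a::complex_banach_algebra set \<Rightarrow> (logcover0 \<Rightarrow> 'a) \<Rightarrow> ('g \<Rightarrow> 'a) \<Rightarrow> bool" where
  "hahn_meromorphic_with Y e R h a \<longleftrightarrow>
     zmeromorphic_on h Y \<and> h ` (Y - zpoles Y h) \<subseteq> R \<and>
     (\<exists>\<delta>>0. \<exists>g b k c b'.
        hahn_holomorphic_with (Y \<inter> zdisc \<delta>) e UNIV g b \<and> hsupp b \<noteq> {} \<and>
        hahn_holomorphic_with (Y \<inter> zdisc \<delta>) e R k c \<and>
        (\<forall>z\<in>Y \<inter> zdisc \<delta> - zpoles Y h. k z = g z *\<^sub>C h z) \<and>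
        is_hahn_inverse b b' \<and> a = hahn_mult b' c)"

end

theory Submission
  imports Defs "HOL-Library.Sublist" "Jordan_Normal_Form.Determinant"
    "HOL-Complex_Analysis.Complex_Analysis"
begin

text \<open>Near a point of \<open>Y\<close> a meromorphic function is a Laurent series in the powers
  \<open>(zproj w - zproj z)\<^sup>k\<close>, near \<open>0\<close> it is a Hahn series in the \<open>e \<gamma>\<close>. Both are germs of
  absolutely convergent series along a filter, with exponents in a linearly ordered group, and both
  allow the same calculus: supports that are admissible up to a shift are closed under sums and under
  passing to the generated semigroup (Higman's lemma), so germs can be multiplied and inverted by a
  Neumann series, and a germ with non-zero series is eventually non-zero.

  Along such a filter choose a finite rank orthogonal projection \<open>P\<close> whose range contains \<open>H\<^sub>0\<close>, with
  \<open>(1 - P) f\<close> eventually of norm less than \<open>1\<close>. Then \<open>1 - f = (1 - P M) (1 - (1 - P) f)\<close> with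
  \<open>M = f (1 - (1 - P) f)\<^sup>-\<^sup>1\<close>, and \<open>1 - P M\<close> is invertible iff the determinant of its corner
  \<open>P - P M P\<close> does not vanish. That determinant is a scalar germ, so \<open>1 - f\<close> is either eventually
  invertible or eventually not invertible, and connectedness makes the alternative global.\<close>

section \<open>Well-ordered sets of exponents\<close>

text \<open>Admissibility compares exponentials only with their values at positive reals. Estimates
  therefore start from one base point: absolute convergence there, combined with weak monotonicity,
  bounds a series near the centre, its size relative to the leading term, and its sup norms on a
  disc.

  The obstacle at \<open>0\<close> is that admissibility has to survive products and inverses, so
  differences of sums of exponents must again be dominated. Higman's lemma supplies finitely many
  minimal words; every other word exceeds one of them by a sum of elements and gaps of the original
  set, where domination is known.

  The determinant enters because non-zero means invertible only for scalar germs. The projection is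
  chosen in two rounds. The first removes the negative exponents, so that a limit exists. The second
  makes the remainder small; since compactness is assumed of the values near the centre and not of
  the limit, it is fitted to one value close to that limit.\<close>

lemma well_ordered_subset: "well_ordered S \<Longrightarrow> T \<subseteq> S \<Longrightarrow> well_ordered T"
  unfolding well_ordered_def by (meson order_trans)

lemma well_orderedD:
  "well_ordered S \<Longrightarrow> B \<subseteq> S \<Longrightarrow> B \<noteq> {} \<Longrightarrow> \<exists>m\<in>B. \<forall>b\<in>B. m \<le> b"
  unfolding well_ordered_def by blast

lemma well_ordered_Un:
  assumes "well_ordered S" "well_ordered T"
  shows "well_ordered (S \<union> T)"
  unfolding well_ordered_def
proof (intro allI impI)
  fix B assume B: "B \<subseteq> S \<union> T" "B \<noteq> {}"
  show "\<exists>m\<in>B. \<forall>b\<in>B. m \<le> b"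
  proof (cases "B \<inter> S = {} \<or> B \<inter> T = {}")
    case True
    then have "B \<subseteq> S \<or> B \<subseteq> T" using B by auto
    then show ?thesis using well_orderedD[OF assms(1) _ B(2)] well_orderedD[OF assms(2) _ B(2)] by blast
  next
    case False
    then obtain m1 m2 where m1: "m1 \<in> B \<inter> S" "\<And>b. b \<in> B \<inter> S \<Longrightarrow> m1 \<le> b"
      and m2: "m2 \<in> B \<inter> T" "\<And>b. b \<in> B \<inter> T \<Longrightarrow> m2 \<le> b"
      using well_orderedD[OF assms(1), of "B \<inter> S"] well_orderedD[OF assms(2), of "B \<inter> T"] by auto
    have "min m1 m2 \<in> B" using m1 m2 by (auto simp: min_def)
    moreover have "min m1 m2 \<le> b" if "b \<in> B" for b
      using that B m1(2)[of b] m2(2)[of b] by (auto simp: min_le_iff_disj)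
    ultimately show ?thesis by blast
  qed
qed

lemma well_ordered_finite: "finite S \<Longrightarrow> well_ordered S"
  unfolding well_ordered_def by (metis Min_in Min_le finite_subset)

lemma well_ordered_shift:
  fixes S :: "'g::linordered_ab_group_add set"
  assumes "well_ordered S"
  shows "well_ordered ((+) c ` S)"
  unfolding well_ordered_def
proof (intro allI impI)
  fix B assume B: "B \<subseteq> (+) c ` S" "B \<noteq> {}"
  let ?C = "{s \<in> S. c + s \<in> B}"
  have "?C \<noteq> {}" using B by blast
  then obtain m where "m \<in> ?C" "\<And>b. b \<in> ?C \<Longrightarrow> m \<le> b"
    using well_orderedD[OF assms, of ?C] by auto
  then show "\<exists>m\<in>B. \<forall>b\<in>B. m \<le> b" using B by (intro bexI[of _ "c + m"]) auto
qed

text \<open>Any sequence has a monotone subsequence. If that one is decreasing, well-ordering gives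
  its range a least element, and from there on it is constant; a non-decreasing subsequence results
  either way.\<close>

lemma well_ordered_mono_subseq:
  fixes f :: "nat \<Rightarrow> 'g::linorder"
  assumes S: "well_ordered S" and f: "\<And>n. f n \<in> S"
  shows "\<exists>\<phi> :: nat \<Rightarrow> nat. strict_mono \<phi> \<and> (\<forall>i j. i \<le> j \<longrightarrow> f (\<phi> i) \<le> f (\<phi> j))"
proof -
  obtain \<psi> where \<psi>: "strict_mono \<psi>" "monoseq (\<lambda>n. f (\<psi> n))"
    using seq_monosub[of f] by blast
  show ?thesis
  proof (cases "\<forall>m n. m \<le> n \<longrightarrow> f (\<psi> m) \<le> f (\<psi> n)")
    case True
    show ?thesis by (rule exI[of _ \<psi>]) (use True \<psi>(1) in auto)
  next
    case False
    then have dec: "f (\<psi> n) \<le> f (\<psi> m)" if "m \<le> n" for m n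
      using \<psi>(2) that unfolding monoseq_def by blast
    have "range (\<lambda>n. f (\<psi> n)) \<subseteq> S" using f by auto
    then obtain v where v: "v \<in> range (\<lambda>n. f (\<psi> n))" "\<And>b. b \<in> range (\<lambda>n. f (\<psi> n)) \<Longrightarrow> v \<le> b"
      using well_orderedD[OF S, of "range (\<lambda>n. f (\<psi> n))"] by blast
    then obtain N where N: "v = f (\<psi> N)" by blast
    have eq: "f (\<psi> (n + N)) = v" for n
      using dec[of N "n + N"] v(2)[of "f (\<psi> (n + N))"] N by auto
    show ?thesis
      by (rule exI[of _ "\<lambda>n. \<psi> (n + N)"]) (use \<psi>(1) eq in \<open>auto simp: strict_mono_def\<close>)
  qed
qed

text \<open>Higman's lemma, by Nash-Williams' minimal bad sequence argument.\<close>

definition bad_seq :: "'g::linorder set \<Rightarrow> (nat \<Rightarrow> 'g list) \<Rightarrow> bool" where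
  "bad_seq S f \<longleftrightarrow> (\<forall>i. set (f i) \<subseteq> S) \<and> (\<forall>i j. i < j \<longrightarrow> \<not> list_emb (\<le>) (f i) (f j))"

lemma bad_seqI:
  "(\<And>i. set (f i) \<subseteq> S) \<Longrightarrow> (\<And>i j. i < j \<Longrightarrow> \<not> list_emb (\<le>) (f i) (f j)) \<Longrightarrow> bad_seq S f"
  unfolding bad_seq_def by blast

lemma bad_seq_set: "bad_seq S f \<Longrightarrow> set (f i) \<subseteq> S"
  unfolding bad_seq_def by blast

lemma bad_seq_emb: "bad_seq S f \<Longrightarrow> i < j \<Longrightarrow> \<not> list_emb (\<le>) (f i) (f j)"
  unfolding bad_seq_def by blast

text \<open>Stage \<open>n\<close> keeps the first \<open>n\<close> words and minimises the length
  of the next one. Later stages leave the words up to index \<open>n\<close> alone, so the diagonal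
  is again bad and inherits the minimality of every stage.\<close>

lemma minimal_bad_seq:
  assumes "bad_seq S f0"
  obtains m where "bad_seq S m"
    "\<And>n h. bad_seq S h \<Longrightarrow> (\<And>i. i < n \<Longrightarrow> h i = m i) \<Longrightarrow> length (m n) \<le> length (h n)"
proof -
  define P where "P n g \<longleftrightarrow> bad_seq S g \<and>
    (\<forall>h. bad_seq S h \<longrightarrow> (\<forall>i<n. h i = g i) \<longrightarrow> length (g n) \<le> length (h n))" for n g
  define Q where "Q n g g' \<longleftrightarrow> (\<forall>i\<le>n. g' i = g i)" for n :: nat and g g' :: "nat \<Rightarrow> 'a list"
  have min: "\<exists>g'. P n g' \<and> (\<forall>i<n. g' i = g i)" if "bad_seq S g" for n g
  proof -
    let ?R = "\<lambda>h. bad_seq S h \<and> (\<forall>i<n. h i = g i)"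
    have "\<exists>g'. ?R g' \<and> (\<forall>h. ?R h \<longrightarrow> length (g' n) \<le> length (h n))"
      by (rule ex_has_least_nat[of _ g]) (use that in auto)
    then obtain g' where g': "?R g'" "\<And>h. ?R h \<Longrightarrow> length (g' n) \<le> length (h n)" by blast
    then have "P n g'" unfolding P_def by auto
    then show ?thesis using g' by blast
  qed
  have "\<exists>G. \<forall>n. P n (G n) \<and> Q n (G n) (G (Suc n))"
  proof (rule dependent_nat_choice)
    show "\<exists>g. P 0 g" using min[OF assms, of 0] by blast
    show "\<exists>g'. P (Suc n) g' \<and> Q n g g'" if "P n g" for n g
      using that min[of g "Suc n"] unfolding P_def Q_def less_Suc_eq_le by blast
  qed
  then obtain G where G: "\<And>n. P n (G n)" "\<And>n. Q n (G n) (G (Suc n))" by blast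
  have agree: "G k i = G i i" if "i \<le> k" for i k
    using that
  proof (induction k)
    case (Suc k)
    then show ?case using G(2)[of k] unfolding Q_def by (cases "i = Suc k") auto
  qed simp
  have badG: "bad_seq S (G n)" for n using G(1)[of n] unfolding P_def by (rule conjunct1)
  have minG: "length (G n n) \<le> length (h n)" if "bad_seq S h" "\<forall>i<n. h i = G n i" for n h
    using G(1)[of n] that unfolding P_def by blast
  show thesis
  proof (rule that[of "\<lambda>i. G i i"])
    show "bad_seq S (\<lambda>i. G i i)"
    proof (rule bad_seqI)
      show "set (G i i) \<subseteq> S" for i using badG by (rule bad_seq_set)
      fix i j :: nat assume "i < j"
      with badG have "\<not> list_emb (\<le>) (G j i) (G j j)" by (rule bad_seq_emb)
      moreover have "G j i = G i i" by (rule agree) (use \<open>i < j\<close> in simp)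
      ultimately show "\<not> list_emb (\<le>) (G i i) (G j j)" by simp
    qed
    fix n h assume h: "bad_seq S h" "\<And>i. i < n \<Longrightarrow> h i = G i i"
    have "h i = G n i" if "i < n" for i
      unfolding h(2)[OF that] by (rule agree[symmetric]) (use that in simp)
    with h(1) show "length (G n n) \<le> length (h n)" by (intro minG) auto
  qed
qed

text \<open>Choose positions \<open>\<phi>\<close> along which the heads do not decrease, keep the
  first \<open>N = \<phi> 0\<close> words of the minimal sequence and continue with the tails at
  these positions. An embedding in the new sequence lifts to the old one, so the new one is bad, but
  its word at index \<open>N\<close> is shorter.\<close>

lemma higman:
  assumes S: "well_ordered S"
  shows "\<not> bad_seq S f"
proof
  assume "bad_seq S f"
  then obtain m where m: "bad_seq S m"
    and least: "\<And>n h. bad_seq S h \<Longrightarrow> (\<And>i. i < n \<Longrightarrow> h i = m i) \<Longrightarrow> length (m n) \<le> length (h n)"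
    by (rule minimal_bad_seq) blast
  have ne: "m i \<noteq> []" for i
  proof
    assume "m i = []"
    then have "list_emb (\<le>) (m i) (m (Suc i))" by simp
    then show False using bad_seq_emb[OF m, of i "Suc i"] by simp
  qed
  have in_S: "set (m i) \<subseteq> S" for i using m by (rule bad_seq_set)
  have hdS: "hd (m i) \<in> S" for i using in_S[of i] ne[of i] by (meson hd_in_set subsetD)
  obtain \<phi> :: "nat \<Rightarrow> nat" where *: "strict_mono \<phi> \<and> (\<forall>i j. i \<le> j \<longrightarrow> hd (m (\<phi> i)) \<le> hd (m (\<phi> j)))"
    using well_ordered_mono_subseq[where f = "\<lambda>i. hd (m i)", OF S hdS] ..
  have \<phi>: "strict_mono \<phi>" "\<And>i j. i \<le> j \<Longrightarrow> hd (m (\<phi> i)) \<le> hd (m (\<phi> j))"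
    using * by simp_all
  define N where "N = \<phi> 0"
  define h where "h i = (if i < N then m i else tl (m (\<phi> (i - N))))" for i
  have "bad_seq S h"
  proof (rule bad_seqI)
    show "set (h i) \<subseteq> S" for i
      using in_S[of i] in_S[of "\<phi> (i - N)"] ne[of "\<phi> (i - N)"]
      by (auto simp: h_def dest: list.set_sel(2))
    fix i j :: nat assume ij: "i < j"
    show "\<not> list_emb (\<le>) (h i) (h j)"
    proof
      assume emb: "list_emb (\<le>) (h i) (h j)"
      have "\<exists>k l. k < l \<and> list_emb (\<le>) (m k) (m l)"
      proof (cases "i < N")
        case True
        show ?thesis
        proof (cases "j < N")
          case True
          then show ?thesis using ij emb \<open>i < N\<close> by (auto simp: h_def)
        next
          case False
          then have "list_emb (\<le>) (m i) (tl (m (\<phi> (j - N))))" using emb True by (simp add: h_def)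
          then have "list_emb (\<le>) (m i) (hd (m (\<phi> (j - N))) # tl (m (\<phi> (j - N))))"
            by (rule list_emb_Cons)
          then have "list_emb (\<le>) (m i) (m (\<phi> (j - N)))"
            by (simp only: list.collapse[OF ne])
          moreover have "i < \<phi> (j - N)"
            using True \<phi>(1) unfolding N_def
            by (meson le0 order_less_le_trans strict_mono_less_eq)
          ultimately show ?thesis by blast
        qed
      next
        case False
        then have "list_emb (\<le>) (tl (m (\<phi> (i - N)))) (tl (m (\<phi> (j - N))))"
          using emb ij by (simp add: h_def)
        moreover have "hd (m (\<phi> (i - N))) \<le> hd (m (\<phi> (j - N)))" using ij by (intro \<phi>(2)) simp
        ultimately have "list_emb (\<le>) (hd (m (\<phi> (i - N))) # tl (m (\<phi> (i - N))))
            (hd (m (\<phi> (j - N))) # tl (m (\<phi> (j - N))))"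
          by (intro list_emb_Cons2)
        then have "list_emb (\<le>) (m (\<phi> (i - N))) (m (\<phi> (j - N)))"
          by (simp only: list.collapse[OF ne])
        moreover have "\<phi> (i - N) < \<phi> (j - N)"
          by (rule strict_monoD[OF \<phi>(1)]) (use ij False in auto)
        ultimately show ?thesis by blast
      qed
      then show False using bad_seq_emb[OF m] by blast
    qed
  qed
  from least[OF this, of N] have "length (m N) \<le> length (h N)" by (simp add: h_def)
  then show False using ne[of N] by (cases "m N") (simp_all add: h_def N_def)
qed

text \<open>If no finite subset sufficed, one could go on choosing words of \<open>W\<close> into
  which no earlier choice embeds, and the choices would form a bad sequence.\<close>

lemma list_finite_basis:
  assumes S: "well_ordered S" and W: "\<And>w. w \<in> W \<Longrightarrow> set w \<subseteq> S"
  shows "\<exists>V. finite V \<and> V \<subseteq> W \<and> (\<forall>w\<in>W. \<exists>v\<in>V. list_emb (\<le>) v w)"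
proof (rule ccontr)
  assume *: "\<not> ?thesis"
  have ex: "\<exists>w. w \<in> W \<and> (\<forall>v\<in>V. \<not> list_emb (\<le>) v w)" if V: "finite V" "V \<subseteq> W" for V
  proof (rule ccontr)
    assume "\<not> ?thesis"
    then have "\<forall>w\<in>W. \<exists>v\<in>V. list_emb (\<le>) v w" by simp
    with V have "\<exists>V. finite V \<and> V \<subseteq> W \<and> (\<forall>w\<in>W. \<exists>v\<in>V. list_emb (\<le>) v w)"
      by (intro exI[of _ V] conjI)
    with * show False by (rule notE)
  qed
  define c where "c V = (SOME w. w \<in> W \<and> (\<forall>v\<in>V. \<not> list_emb (\<le>) v w))" for V
  have c: "c V \<in> W \<and> (\<forall>v\<in>V. \<not> list_emb (\<le>) v (c V))" if "finite V" "V \<subseteq> W" for V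
    unfolding c_def using ex[OF that] by (rule someI_ex)
  define F where "F = rec_nat {} (\<lambda>_ V. insert (c V) V)"
  have F0: "F 0 = {}" and FS: "F (Suc n) = insert (c (F n)) (F n)" for n
    by (simp_all add: F_def)
  have F: "finite (F n) \<and> F n \<subseteq> W" for n
    by (induction n) (use c in \<open>auto simp: F0 FS\<close>)
  have mem: "c (F i) \<in> F j" if "i < j" for i j
    using that by (induction j) (auto simp: FS less_Suc_eq)
  have "bad_seq S (\<lambda>n. c (F n))"
  proof (rule bad_seqI)
    show "set (c (F i)) \<subseteq> S" for i using c[of "F i"] F[of i] W by blast
    show "\<not> list_emb (\<le>) (c (F i)) (c (F j))" if "i < j" for i j
      using c[of "F j"] F[of j] mem[OF that] by blast
  qed
  then show False using higman[OF S] by blast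
qed

section \<open>The monoid generated by a set of exponents\<close>

definition all_sums :: "'g::monoid_add set \<Rightarrow> 'g set" where
  "all_sums S = sum_list ` {w. set w \<subseteq> S}"

lemma all_sums_zero: "0 \<in> all_sums S"
  unfolding all_sums_def by (rule image_eqI[of _ _ "[]"]) auto

lemma all_sums_incl: "S \<subseteq> all_sums S"
proof
  fix s assume "s \<in> S"
  then show "s \<in> all_sums S" unfolding all_sums_def by (intro image_eqI[of _ _ "[s]"]) auto
qed

lemma all_sumsI: "set w \<subseteq> S \<Longrightarrow> s = sum_list w \<Longrightarrow> s \<in> all_sums S"
  unfolding all_sums_def by simp

lemma all_sumsE:
  assumes "s \<in> all_sums S"
  obtains w where "set w \<subseteq> S" "s = sum_list w"
  using assms unfolding all_sums_def by blast

lemma all_sums_add: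
  assumes "x \<in> all_sums S" "y \<in> all_sums S"
  shows "x + y \<in> all_sums S"
proof -
  obtain v where v: "set v \<subseteq> S" "x = sum_list v" using assms(1) by (rule all_sumsE)
  obtain w where w: "set w \<subseteq> S" "y = sum_list w" using assms(2) by (rule all_sumsE)
  show ?thesis by (rule all_sumsI[of "v @ w"]) (simp_all add: v w)
qed

lemma all_sums_nonneg:
  fixes S :: "'g::linordered_ab_group_add set"
  shows "S \<subseteq> {0..} \<Longrightarrow> all_sums S \<subseteq> {0..}"
  unfolding all_sums_def by (auto intro!: sum_list_nonneg)

text \<open>The gaps between the letters of \<open>w\<close> and those of an embedded word \<open>v\<close> range over
  finitely many shifts of \<open>S\<close>.\<close>

lemma list_emb_sum_diff:
  fixes S :: "'g::linordered_ab_group_add set"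
  assumes "list_emb (\<le>) v w" "set w \<subseteq> S" "set v \<subseteq> C"
  shows "sum_list w - sum_list v \<in> all_sums (S \<union> (\<Union>c\<in>C. {s - c |s. s \<in> S \<and> c \<le> s}))"
    (is "_ \<in> all_sums ?T")
  using assms
proof (induction rule: list_emb.induct)
  case (list_emb_Nil ys)
  then have "set ys \<subseteq> ?T" by auto
  then show ?case unfolding all_sums_def by (intro image_eqI[of _ _ ys]) auto
next
  case (list_emb_Cons xs ys y)
  then have "y \<in> all_sums ?T" using all_sums_incl[of ?T] by auto
  then have "y + (sum_list ys - sum_list xs) \<in> all_sums ?T"
    using list_emb_Cons by (intro all_sums_add) auto
  then show ?case by (simp add: algebra_simps)
next
  case (list_emb_Cons2 x y xs ys)
  then have "y - x \<in> ?T" by auto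
  then have "y - x \<in> all_sums ?T" using all_sums_incl[of ?T] by blast
  then have "(y - x) + (sum_list ys - sum_list xs) \<in> all_sums ?T"
    using list_emb_Cons2 by (intro all_sums_add) auto
  then show ?case by (simp add: algebra_simps)
qed

lemma list_emb_sum_le:
  fixes v w :: "'g::linordered_ab_group_add list"
  assumes "list_emb (\<le>) v w" "set w \<subseteq> {0..}"
  shows "sum_list v \<le> sum_list w"
  using assms
proof (induction rule: list_emb.induct)
  case (list_emb_Nil ys)
  then show ?case by (auto intro: sum_list_nonneg)
next
  case (list_emb_Cons xs ys y)
  then show ?case by (simp add: add_increasing)
next
  case (list_emb_Cons2 x y xs ys)
  then show ?case by (simp add: add_mono)
qed

text \<open>Represent the elements of \<open>B\<close> by words over \<open>S\<close>. Embedding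
  never decreases the sum of non-negative letters, so the minimum over a finite basis of these words
  is the minimum of \<open>B\<close>.\<close>

lemma well_ordered_all_sums:
  fixes S :: "'g::linordered_ab_group_add set"
  assumes S: "well_ordered S" "S \<subseteq> {0..}"
  shows "well_ordered (all_sums S)"
  unfolding well_ordered_def
proof (intro allI impI)
  fix B assume B: "B \<subseteq> all_sums S" "B \<noteq> {}"
  define W where "W = {w. set w \<subseteq> S \<and> sum_list w \<in> B}"
  have "\<exists>V. finite V \<and> V \<subseteq> W \<and> (\<forall>w\<in>W. \<exists>v\<in>V. list_emb (\<le>) v w)"
    by (rule list_finite_basis[OF S(1)]) (simp add: W_def)
  then obtain V where "finite V \<and> V \<subseteq> W \<and> (\<forall>w\<in>W. \<exists>v\<in>V. list_emb (\<le>) v w)" ..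
  then have V: "finite V" "V \<subseteq> W" "\<And>w. w \<in> W \<Longrightarrow> \<exists>v\<in>V. list_emb (\<le>) v w"
    by simp_all
  have BW: "\<exists>w\<in>W. b = sum_list w" if "b \<in> B" for b
    using B(1) that unfolding W_def all_sums_def by blast
  then have "W \<noteq> {}" using B(2) by auto
  then have "V \<noteq> {}" using V(3) by blast
  then have M: "Min (sum_list ` V) \<in> sum_list ` V" using V(1) by auto
  show "\<exists>m\<in>B. \<forall>b\<in>B. m \<le> b"
  proof (intro bexI[of _ "Min (sum_list ` V)"] ballI)
    show "Min (sum_list ` V) \<in> B" using M V(2) unfolding W_def by auto
    fix b assume "b \<in> B"
    then obtain w where w: "w \<in> W" "b = sum_list w" using BW by auto
    obtain v where v: "v \<in> V" "list_emb (\<le>) v w" using V(3)[OF w(1)] by auto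
    have "set w \<subseteq> {0..}" using w(1) S(2) by (auto simp: W_def)
    then have "sum_list v \<le> b" unfolding w(2) by (rule list_emb_sum_le[OF v(2)])
    moreover have "Min (sum_list ` V) \<le> sum_list v" using v(1) V(1) by simp
    ultimately show "Min (sum_list ` V) \<le> b" by simp
  qed
qed

section \<open>Sumsets and their fibres\<close>

lemma sumset_subset_all_sums:
  fixes S T :: "'g::linordered_ab_group_add set"
  shows "{\<alpha> + \<beta> |\<alpha> \<beta>. \<alpha> \<in> S \<and> \<beta> \<in> T} \<subseteq> (+) (s + t) ` all_sums ((+) (- s) ` S \<union> (+) (- t) ` T)"
    (is "_ \<subseteq> _ ` all_sums ?U")
proof
  fix x assume "x \<in> {\<alpha> + \<beta> |\<alpha> \<beta>. \<alpha> \<in> S \<and> \<beta> \<in> T}"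
  then obtain \<alpha> \<beta> where ab: "\<alpha> \<in> S" "\<beta> \<in> T" "x = \<alpha> + \<beta>" by blast
  have "- s + \<alpha> \<in> all_sums ?U" by (rule subsetD[OF all_sums_incl]) (simp add: ab)
  moreover have "- t + \<beta> \<in> all_sums ?U" by (rule subsetD[OF all_sums_incl]) (simp add: ab)
  ultimately have "(- s + \<alpha>) + (- t + \<beta>) \<in> all_sums ?U" by (rule all_sums_add)
  moreover have "x = (s + t) + ((- s + \<alpha>) + (- t + \<beta>))" using ab by (simp add: algebra_simps)
  ultimately show "x \<in> (+) (s + t) ` all_sums ?U" by (rule rev_image_eqI)
qed

text \<open>Subtracting the minima \<open>s\<close> and \<open>t\<close> makes both sets
  non-negative, and the sumset then lies in a translate of a generated monoid.\<close>

lemma well_ordered_sumset: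
  fixes S T :: "'g::linordered_ab_group_add set"
  assumes S: "well_ordered S" and T: "well_ordered T"
  shows "well_ordered {\<alpha> + \<beta> |\<alpha> \<beta>. \<alpha> \<in> S \<and> \<beta> \<in> T}"
proof (cases "S = {} \<or> T = {}")
  case True
  then have eq: "{\<alpha> + \<beta> |\<alpha> \<beta>. \<alpha> \<in> S \<and> \<beta> \<in> T} = {}" by auto
  show ?thesis unfolding eq by (rule well_ordered_finite) simp
next
  case False
  obtain s where s: "s \<in> S" "\<And>\<alpha>. \<alpha> \<in> S \<Longrightarrow> s \<le> \<alpha>" using well_orderedD[OF S, of S] False by blast
  obtain t where t: "t \<in> T" "\<And>\<alpha>. \<alpha> \<in> T \<Longrightarrow> t \<le> \<alpha>" using well_orderedD[OF T, of T] False by blast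
  let ?U = "(+) (- s) ` S \<union> (+) (- t) ` T"
  have "well_ordered ((+) (s + t) ` all_sums ?U)"
    using s t by (intro well_ordered_shift well_ordered_all_sums well_ordered_Un S T) auto
  then show ?thesis by (rule well_ordered_subset[OF _ sumset_subset_all_sums])
qed

text \<open>Infinitely many decompositions of \<open>\<gamma>\<close> would contain a sequence of
  distinct ones in which both summands are non-decreasing, which is impossible as their sum is
  fixed. This is why the coefficients of a product of Hahn series are finite sums.\<close>

lemma sumset_fibre_finite:
  fixes S T :: "'g::linordered_ab_group_add set"
  assumes S: "well_ordered S" and T: "well_ordered T"
  shows "finite {\<alpha>\<in>S. \<gamma> - \<alpha> \<in> T}"
proof (rule ccontr)
  assume "infinite {\<alpha>\<in>S. \<gamma> - \<alpha> \<in> T}"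
  then obtain f :: "nat \<Rightarrow> 'g" where f: "inj f" "range f \<subseteq> {\<alpha>\<in>S. \<gamma> - \<alpha> \<in> T}"
    by (meson infinite_countable_subset)
  then have fS: "f n \<in> S" and fT: "\<gamma> - f n \<in> T" for n by auto
  obtain \<phi> :: "nat \<Rightarrow> nat" where *: "strict_mono \<phi> \<and> (\<forall>i j. i \<le> j \<longrightarrow> f (\<phi> i) \<le> f (\<phi> j))"
    using well_ordered_mono_subseq[where f = f, OF S fS] ..
  have \<phi>: "strict_mono \<phi>" "\<And>i j. i \<le> j \<Longrightarrow> f (\<phi> i) \<le> f (\<phi> j)"
    using * by simp_all
  obtain \<psi> :: "nat \<Rightarrow> nat" where *: "strict_mono \<psi> \<and> (\<forall>i j. i \<le> j \<longrightarrow> \<gamma> - f (\<phi> (\<psi> i)) \<le> \<gamma> - f (\<phi> (\<psi> j)))"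
    using well_ordered_mono_subseq[where f = "\<lambda>n. \<gamma> - f (\<phi> n)", OF T fT] ..
  have \<psi>: "strict_mono \<psi>" "\<And>i j. i \<le> j \<Longrightarrow> \<gamma> - f (\<phi> (\<psi> i)) \<le> \<gamma> - f (\<phi> (\<psi> j))"
    using * by simp_all
  have "f (\<phi> (\<psi> 0)) = f (\<phi> (\<psi> 1))"
    using \<phi>(2)[of "\<psi> 0" "\<psi> 1"] \<psi>(2)[of 0 1] \<psi>(1) by (force simp: strict_mono_less_eq)
  then have "\<psi> 0 = \<psi> 1" using f(1) \<phi>(1) by (metis injD strict_mono_eq)
  then show False using \<psi>(1) by (simp add: strict_mono_eq)
qed

section \<open>Germs of generalised power series\<close>

text \<open>The product \<open>p\<close> is left general so that one construction covers the
  multiplication of scalars, that of operators, and the action of scalars on operators. For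
  well-ordered supports the index set is finite by \<open>sumset_fibre_finite\<close>.\<close>

definition conv :: "('a::zero \<Rightarrow> 'b::zero \<Rightarrow> 'c::comm_monoid_add) \<Rightarrow> ('g::group_add \<Rightarrow> 'a) \<Rightarrow> ('g \<Rightarrow> 'b) \<Rightarrow> 'g \<Rightarrow> 'c"
  where "conv p a b \<gamma> = (\<Sum>\<alpha>\<in>{\<alpha>\<in>hsupp a. \<gamma> - \<alpha> \<in> hsupp b}. p (a \<alpha>) (b (\<gamma> - \<alpha>)))"

lemma not_in_hsupp [simp]: "\<alpha> \<notin> hsupp a \<longleftrightarrow> a \<alpha> = 0"
  by (simp add: hsupp_def)

lemma in_hsupp: "\<alpha> \<in> hsupp a \<longleftrightarrow> a \<alpha> \<noteq> 0"
  by (simp add: hsupp_def)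

lemma hsupp_conv: "hsupp (conv p a b) \<subseteq> {\<alpha> + \<beta> |\<alpha> \<beta>. \<alpha> \<in> hsupp a \<and> \<beta> \<in> hsupp b}"
  for a :: "'g::ab_group_add \<Rightarrow> _"
proof
  fix \<gamma> assume "\<gamma> \<in> hsupp (conv p a b)"
  then have "{\<alpha>\<in>hsupp a. \<gamma> - \<alpha> \<in> hsupp b} \<noteq> {}"
    unfolding conv_def in_hsupp by (metis (no_types, lifting) sum.empty)
  then obtain \<alpha> where "\<alpha> \<in> hsupp a" "\<gamma> - \<alpha> \<in> hsupp b" by blast
  moreover have "\<gamma> = \<alpha> + (\<gamma> - \<alpha>)" by simp
  ultimately show "\<gamma> \<in> {\<alpha> + \<beta> |\<alpha> \<beta>. \<alpha> \<in> hsupp a \<and> \<beta> \<in> hsupp b}" by blast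
qed

section \<open>Complex scalar multiplication as a bilinear map\<close>

lemma scaleC_zero_left [simp]: "0 *\<^sub>C x = 0" and scaleC_zero_right [simp]: "c *\<^sub>C 0 = 0"
  by (rule complex_vector.scale_zero_left complex_vector.scale_zero_right)+

lemma scaleC_eq_complex: "c *\<^sub>C (x::complex) = c * x"
  by (simp add: scaleC_complex_def)

lemma bounded_bilinear_scaleC:
  "bounded_bilinear (\<lambda>(c::complex) (x::'a::complex_normed_vector). c *\<^sub>C x)"
proof
  fix r :: real and c d :: complex and x y :: 'a
  show "(c + d) *\<^sub>C x = c *\<^sub>C x + d *\<^sub>C x" "c *\<^sub>C (x + y) = c *\<^sub>C x + c *\<^sub>C y"
    by (simp_all add: scaleC_add_left scaleC_add_right)
  show "(r *\<^sub>R c) *\<^sub>C x = r *\<^sub>R (c *\<^sub>C x)" "c *\<^sub>C (r *\<^sub>R x) = r *\<^sub>R (c *\<^sub>C x)"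
    by (simp_all add: scaleR_scaleC scaleC_scaleC scaleC_complex_def mult.commute)
  show "\<exists>K. \<forall>c x. norm (c *\<^sub>C (x::'a)) \<le> norm c * norm x * K"
    by (rule exI[of _ 1]) (simp add: norm_scaleC)
qed

lemmas tendsto_scaleC = bounded_bilinear.tendsto[OF bounded_bilinear_scaleC]

text \<open>\<open>F\<close> is the filter of punctured neighbourhoods along which functions are
  compared with series, \<open>FB\<close> the finer filter of base points that dominate them. At
  \<open>0\<close> the base points are the positive reals, the only points at which weak
  monotonicity gives domination; at other centres the two filters agree.\<close>

locale germs =
  fixes F FB :: "'z filter" and e :: "'g::linordered_ab_group_add \<Rightarrow> 'z \<Rightarrow> complex"
  assumes FB_le: "FB \<le> F" and FB_nontriv: "FB \<noteq> bot"
    and eventually_exp: "\<forall>\<^sub>F z in F. \<forall>\<alpha> \<beta>. e (\<alpha> + \<beta>) z = e \<alpha> z * e \<beta> z \<and> e \<alpha> z \<noteq> 0"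
    and exp_tendsto_0: "0 < \<gamma> \<Longrightarrow> (e \<gamma> \<longlongrightarrow> 0) F"
begin

definition isexp :: "'z \<Rightarrow> bool" where
  "isexp z \<longleftrightarrow> (\<forall>\<alpha> \<beta>. e (\<alpha> + \<beta>) z = e \<alpha> z * e \<beta> z \<and> e \<alpha> z \<noteq> 0)"

lemma eventually_isexp: "\<forall>\<^sub>F z in F. isexp z"
  unfolding isexp_def by (rule eventually_exp)

lemma eventually_FB: "eventually P F \<Longrightarrow> eventually P FB"
  using FB_le by (simp add: le_filter_def)

lemma F_nontriv: "F \<noteq> bot"
  using FB_le FB_nontriv bot.extremum_uniqueI by blast

lemma exp_add: "isexp z \<Longrightarrow> e (\<alpha> + \<beta>) z = e \<alpha> z * e \<beta> z"
  by (simp add: isexp_def)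

lemma exp_nonzero: "isexp z \<Longrightarrow> e \<alpha> z \<noteq> 0"
  by (simp add: isexp_def)

lemma exp_zero: "isexp z \<Longrightarrow> e 0 z = 1"
  using exp_add[of z 0 0] exp_nonzero[of z 0] by simp

lemma exp_diff: "isexp z \<Longrightarrow> e (\<alpha> - \<beta>) z = e \<alpha> z / e \<beta> z"
  using exp_add[of z "\<alpha> - \<beta>" \<beta>] exp_nonzero[of z \<beta>] by simp

subsection \<open>Admissible supports\<close>

text \<open>Weak monotonicity and admissibility, freed from the restriction to exponents \<open>\<ge> 0\<close>: \<open>adm\<close> is
  invariant under shifts, and for \<open>S \<subseteq> {0..}\<close> it agrees with \<open>admissible\<close>.\<close>

definition wm :: "'g set \<Rightarrow> bool" where
  "wm S \<longleftrightarrow> (\<forall>\<^sub>F x in FB. \<forall>\<^sub>F z in F. \<forall>\<alpha>\<in>S. cmod (e \<alpha> z) \<le> cmod (e \<alpha> x))"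

text \<open>The inequality is weak, so \<open>0\<close> is a gap at every \<open>m\<close> in
  \<open>S\<close>; as \<open>e 0\<close> is eventually \<open>1\<close>, domination at
  \<open>0\<close> is an equality.\<close>

definition gaps :: "'g set \<Rightarrow> 'g \<Rightarrow> 'g set" where
  "gaps S m = {\<alpha> - m |\<alpha>. \<alpha> \<in> S \<and> m \<le> \<alpha>}"

definition adm :: "'g set \<Rightarrow> bool" where
  "adm S \<longleftrightarrow> well_ordered S \<and> (\<forall>m\<in>S. wm (gaps S m))"

lemma wm_subset: "wm S \<Longrightarrow> T \<subseteq> S \<Longrightarrow> wm T"
  unfolding wm_def by (elim eventually_mono) blast

lemma wm_empty [simp]: "wm {}"
  by (simp add: wm_def)

lemma wm_Un:
  assumes "wm S" "wm T"
  shows "wm (S \<union> T)"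
  using assms unfolding wm_def
proof eventually_elim
  case (elim x)
  from elim(1) elim(2) show ?case by eventually_elim blast
qed

lemma wm_UN: "finite I \<Longrightarrow> (\<And>i. i \<in> I \<Longrightarrow> wm (S i)) \<Longrightarrow> wm (\<Union>i\<in>I. S i)"
  by (induction I rule: finite_induct) (auto intro: wm_Un)

lemma wm_single:
  assumes "0 \<le> \<gamma>"
  shows "wm {\<gamma>}"
  unfolding wm_def using eventually_FB[OF eventually_isexp]
proof eventually_elim
  case (elim x)
  show ?case
  proof (cases "\<gamma> = 0")
    case True
    show ?thesis using eventually_isexp by eventually_elim (simp add: True exp_zero elim)
  next
    case False
    then have "0 < \<gamma>" using assms by simp
    then have "(e \<gamma> \<longlongrightarrow> 0) F" by (rule exp_tendsto_0)
    moreover have "0 < cmod (e \<gamma> x)" using exp_nonzero[OF elim] by simp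
    ultimately have "\<forall>\<^sub>F z in F. dist (e \<gamma> z) 0 < cmod (e \<gamma> x)" by (rule tendstoD)
    then show ?thesis by eventually_elim simp
  qed
qed

text \<open>The moduli of the exponentials are multiplicative, so a comparison letter by letter
  multiplies up to words. The same pair of points serves for words of every length.\<close>

lemma wm_all_sums:
  assumes "wm S"
  shows "wm (all_sums S)"
  using assms eventually_FB[OF eventually_isexp] unfolding wm_def
proof eventually_elim
  case (elim x)
  from elim(1) eventually_isexp show ?case
  proof eventually_elim
    case (elim z)
    have "cmod (e (sum_list w) z) \<le> cmod (e (sum_list w) x)" if "set w \<subseteq> S" for w
      using that
    proof (induction w)
      case Nil
      then show ?case using \<open>isexp x\<close> \<open>isexp z\<close> by (simp add: exp_zero)
    next
      case (Cons a w)
      then show ?case using elim \<open>isexp x\<close>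
        by (simp add: exp_add norm_mult mult_mono)
    qed
    then show ?case by (auto elim: all_sumsE)
  qed
qed

lemma wm_sum:
  assumes "wm S" "wm T"
  shows "wm {\<alpha> + \<beta> |\<alpha> \<beta>. \<alpha> \<in> S \<and> \<beta> \<in> T}"
proof (rule wm_subset[OF wm_all_sums[OF wm_Un[OF assms]]])
  show "{\<alpha> + \<beta> |\<alpha> \<beta>. \<alpha> \<in> S \<and> \<beta> \<in> T} \<subseteq> all_sums (S \<union> T)"
    using all_sums_incl[of "S \<union> T"] by (auto intro!: all_sums_add)
qed

text \<open>\<open>adm\<close> speaks only of \<open>m\<close> in \<open>S\<close>. For other
  \<open>m\<close> let \<open>\<mu>\<close> be the next element of \<open>S\<close>: a gap at
  \<open>m\<close> is a gap at \<open>\<mu>\<close> plus the fixed non-negative exponent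
  \<open>\<mu> - m\<close>.\<close>

lemma wm_gaps:
  assumes S: "adm S"
  shows "wm (gaps S m)"
proof (cases "{\<alpha>\<in>S. m \<le> \<alpha>} = {}")
  case True
  then have "gaps S m = {}" by (auto simp: gaps_def)
  then show ?thesis by simp
next
  case False
  then obtain \<mu> where \<mu>: "\<mu> \<in> S" "m \<le> \<mu>" "\<And>\<alpha>. \<alpha> \<in> S \<Longrightarrow> m \<le> \<alpha> \<Longrightarrow> \<mu> \<le> \<alpha>"
    using S well_orderedD[of S "{\<alpha>\<in>S. m \<le> \<alpha>}"] by (auto simp: adm_def)
  have "wm (gaps S \<mu>)" using S \<mu>(1) by (simp add: adm_def)
  moreover have "wm {\<mu> - m}" using \<mu>(2) by (intro wm_single) simp
  ultimately have "wm {\<alpha> + \<beta> |\<alpha> \<beta>. \<alpha> \<in> gaps S \<mu> \<and> \<beta> \<in> {\<mu> - m}}" by (rule wm_sum)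
  then show ?thesis
  proof (rule wm_subset)
    show "gaps S m \<subseteq> {\<alpha> + \<beta> |\<alpha> \<beta>. \<alpha> \<in> gaps S \<mu> \<and> \<beta> \<in> {\<mu> - m}}"
    proof
      fix x assume "x \<in> gaps S m"
      then obtain \<alpha> where a: "x = \<alpha> - m" "\<alpha> \<in> S" "m \<le> \<alpha>" by (auto simp: gaps_def)
      then have "\<alpha> - \<mu> \<in> gaps S \<mu>" using \<mu>(3) by (auto simp: gaps_def)
      moreover have "x = (\<alpha> - \<mu>) + (\<mu> - m)" using a by simp
      ultimately show "x \<in> {\<alpha> + \<beta> |\<alpha> \<beta>. \<alpha> \<in> gaps S \<mu> \<and> \<beta> \<in> {\<mu> - m}}" by blast
    qed
  qed
qed

lemma admD: "adm S \<Longrightarrow> well_ordered S"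
  by (simp add: adm_def)

lemma adm_subset: "adm S \<Longrightarrow> T \<subseteq> S \<Longrightarrow> adm T"
  unfolding adm_def
  by (intro conjI ballI well_ordered_subset[of S T] wm_subset[of "gaps S _" "gaps T _"])
    (auto simp: gaps_def)

lemma adm_finite:
  assumes "finite S"
  shows "adm S"
  unfolding adm_def
proof (intro conjI ballI well_ordered_finite assms)
  fix m
  have "gaps S m = (\<Union>\<alpha>\<in>{\<alpha>\<in>S. m \<le> \<alpha>}. {\<alpha> - m})" by (auto simp: gaps_def)
  also have "wm \<dots>" using assms by (intro wm_UN wm_single) auto
  finally show "wm (gaps S m)" .
qed

lemma adm_Un:
  assumes "adm S" "adm T"
  shows "adm (S \<union> T)"
  unfolding adm_def
proof (intro conjI ballI)
  show "well_ordered (S \<union> T)" using assms by (intro well_ordered_Un) (auto simp: adm_def)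
  fix m
  have "gaps (S \<union> T) m = gaps S m \<union> gaps T m" by (auto simp: gaps_def)
  also have "wm \<dots>" using assms by (intro wm_Un wm_gaps)
  finally show "wm (gaps (S \<union> T) m)" .
qed

lemma adm_shift:
  assumes "adm S"
  shows "adm ((+) c ` S)"
  unfolding adm_def
proof (intro conjI ballI)
  show "well_ordered ((+) c ` S)" using assms by (intro well_ordered_shift admD)
  fix m
  have "gaps ((+) c ` S) m = gaps S (m - c)"
  proof (intro subset_antisym subsetI)
    fix x assume "x \<in> gaps ((+) c ` S) m"
    then obtain \<alpha> where "\<alpha> \<in> S" "m \<le> c + \<alpha>" "x = c + \<alpha> - m" by (auto simp: gaps_def)
    then have "\<alpha> \<in> S \<and> m - c \<le> \<alpha> \<and> x = \<alpha> - (m - c)" by (simp add: algebra_simps)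
    then show "x \<in> gaps S (m - c)" unfolding gaps_def by blast
  next
    fix x assume "x \<in> gaps S (m - c)"
    then obtain \<alpha> where "\<alpha> \<in> S" "m - c \<le> \<alpha>" "x = \<alpha> - (m - c)" by (auto simp: gaps_def)
    then have "c + \<alpha> \<in> (+) c ` S \<and> m \<le> c + \<alpha> \<and> x = (c + \<alpha>) - m" by (simp add: algebra_simps)
    then show "x \<in> gaps ((+) c ` S) m" unfolding gaps_def by blast
  qed
  then show "wm (gaps ((+) c ` S) m)" using wm_gaps[OF assms] by simp
qed

text \<open>The words with sum at least \<open>m\<close> have a finite basis \<open>V\<close>. If
  \<open>v\<close> in \<open>V\<close> embeds into \<open>w\<close>, then
  \<open>sum_list w - m\<close> splits into \<open>sum_list w - sum_list v\<close>, a sum of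
  elements and gaps of \<open>S\<close>, and the single exponent \<open>sum_list v - m\<close>.
  Finiteness of \<open>V\<close> allows the union over \<open>v\<close>.\<close>

lemma adm_all_sums:
  assumes S: "adm S" "S \<subseteq> {0..}"
  shows "adm (all_sums S)"
  unfolding adm_def
proof (intro conjI ballI)
  show "well_ordered (all_sums S)" using S by (intro well_ordered_all_sums admD)
  fix m
  define W where "W = {w. set w \<subseteq> S \<and> m \<le> sum_list w}"
  have "\<exists>V. finite V \<and> V \<subseteq> W \<and> (\<forall>w\<in>W. \<exists>v\<in>V. list_emb (\<le>) v w)"
    by (rule list_finite_basis[OF admD[OF S(1)]]) (simp add: W_def)
  then obtain V where "finite V \<and> V \<subseteq> W \<and> (\<forall>w\<in>W. \<exists>v\<in>V. list_emb (\<le>) v w)" ..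
  then have V: "finite V" "V \<subseteq> W" "\<And>w. w \<in> W \<Longrightarrow> \<exists>v\<in>V. list_emb (\<le>) v w"
    by simp_all
  \<comment> \<open>The exponents by which a word can exceed \<open>v\<close>: whole letters that
    are inserted, and the excess of a letter over the letter of \<open>v\<close> matched with
    it.\<close>
  define T where "T v = S \<union> (\<Union>c\<in>set v. {s - c |s. s \<in> S \<and> c \<le> s})" for v
  have wm_S: "wm S"
  proof -
    have "gaps S 0 = S" using S(2) by (auto simp: gaps_def)
    then show ?thesis using wm_gaps[OF S(1), of 0] by simp
  qed
  have "wm (T v)" for v
    unfolding T_def using wm_gaps[OF S(1)] by (intro wm_Un wm_S wm_UN) (auto simp: gaps_def)
  then have "wm (\<Union>v\<in>V. {\<alpha> + \<beta> |\<alpha> \<beta>. \<alpha> \<in> all_sums (T v) \<and> \<beta> \<in> {sum_list v - m}})"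
    using V by (intro wm_UN wm_sum wm_all_sums wm_single) (auto simp: W_def)
  then show "wm (gaps (all_sums S) m)"
  proof (rule wm_subset)
    show "gaps (all_sums S) m \<subseteq> (\<Union>v\<in>V. {\<alpha> + \<beta> |\<alpha> \<beta>. \<alpha> \<in> all_sums (T v) \<and> \<beta> \<in> {sum_list v - m}})"
    proof
      fix x assume "x \<in> gaps (all_sums S) m"
      then obtain s where s: "s \<in> all_sums S" "m \<le> s" "x = s - m" unfolding gaps_def by blast
      obtain w where w: "set w \<subseteq> S" "s = sum_list w" using s(1) by (rule all_sumsE)
      then have "w \<in> W" using s by (simp add: W_def)
      then obtain v where v: "v \<in> V" "list_emb (\<le>) v w" using V(3) by auto
      have "sum_list w - sum_list v \<in> all_sums (T v)"
        unfolding T_def by (rule list_emb_sum_diff[OF v(2) w(1)]) simp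
      moreover have "x = (sum_list w - sum_list v) + (sum_list v - m)" using s w by simp
      ultimately show "x \<in> (\<Union>v\<in>V. {\<alpha> + \<beta> |\<alpha> \<beta>. \<alpha> \<in> all_sums (T v) \<and> \<beta> \<in> {sum_list v - m}})"
        using v(1) by blast
    qed
  qed
qed

lemma adm_sumset:
  assumes S: "adm S" and T: "adm T"
  shows "adm {\<alpha> + \<beta> |\<alpha> \<beta>. \<alpha> \<in> S \<and> \<beta> \<in> T}"
proof (cases "S = {} \<or> T = {}")
  case True
  then have eq: "{\<alpha> + \<beta> |\<alpha> \<beta>. \<alpha> \<in> S \<and> \<beta> \<in> T} = {}" by auto
  show ?thesis unfolding eq by (rule adm_finite[OF finite.emptyI])
next
  case False
  obtain s where s: "s \<in> S" "\<And>\<alpha>. \<alpha> \<in> S \<Longrightarrow> s \<le> \<alpha>"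
    using well_orderedD[OF admD[OF S], of S] False by blast
  obtain t where t: "t \<in> T" "\<And>\<alpha>. \<alpha> \<in> T \<Longrightarrow> t \<le> \<alpha>"
    using well_orderedD[OF admD[OF T], of T] False by blast
  let ?U = "(+) (- s) ` S \<union> (+) (- t) ` T"
  have "adm ((+) (s + t) ` all_sums ?U)"
    using s t by (intro adm_shift adm_all_sums adm_Un S T) auto
  then show ?thesis by (rule adm_subset[OF _ sumset_subset_all_sums])
qed

subsection \<open>Absolutely convergent series\<close>

text \<open>Absolute convergence at a single point takes the place of normal convergence; together
  with \<open>wm\<close> it yields the uniform estimates when they are needed, see
  \<open>nsum_bound\<close> and \<open>hahn_holomorphic_withI\<close>.\<close>

definition abs_conv :: "('g \<Rightarrow> 'a::complex_normed_vector) \<Rightarrow> 'z \<Rightarrow> bool" where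
  "abs_conv a z \<longleftrightarrow> (\<lambda>\<gamma>. cmod (e \<gamma> z) * norm (a \<gamma>)) summable_on UNIV"

definition nsum :: "('g \<Rightarrow> 'a::complex_normed_vector) \<Rightarrow> 'z \<Rightarrow> real" where
  "nsum a z = (\<Sum>\<^sub>\<infinity>\<gamma>. cmod (e \<gamma> z) * norm (a \<gamma>))"

lemma nsum_nonneg: "0 \<le> nsum a z"
  unfolding nsum_def by (rule infsum_nonneg) simp

lemma abs_conv_has_sum: "abs_conv a z \<Longrightarrow> ((\<lambda>\<gamma>. cmod (e \<gamma> z) * norm (a \<gamma>)) has_sum nsum a z) UNIV"
  unfolding abs_conv_def nsum_def by (rule has_sum_infsum)

lemma has_sum_norm_le_nsum:
  assumes "abs_conv a z" "((\<lambda>\<gamma>. e \<gamma> z *\<^sub>C a \<gamma>) has_sum s) UNIV"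
  shows "norm s \<le> nsum a z"
  by (rule norm_has_sum_bound[OF _ assms(2)]) (use abs_conv_has_sum[OF assms(1)] in \<open>simp add: norm_scaleC\<close>)

lemma abs_convI:
  assumes "f summable_on UNIV" "\<And>\<gamma>. cmod (e \<gamma> z) * norm (a \<gamma>) \<le> f \<gamma>"
  shows "abs_conv a z"
  unfolding abs_conv_def using assms by (rule summable_on_comparison_test) auto

text \<open>The Cauchy product theorem. The double family over pairs of exponents is dominated by
  the product of the two norm series, so it may be summed iteratively for the value, and regrouped
  by total exponent for the coefficients. The norm estimate in the last conclusion is what drives
  the Neumann series.\<close>

lemma conv_pointwise:
  fixes a :: "'g \<Rightarrow> 'a::complex_normed_vector" and b :: "'g \<Rightarrow> 'b::complex_normed_vector"
    and p :: "'a \<Rightarrow> 'b \<Rightarrow> 'c::{complex_normed_vector, banach}"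
  assumes bb: "bounded_bilinear p"
    and pC: "\<And>c d x y. p (c *\<^sub>C x) (d *\<^sub>C y) = (c * d) *\<^sub>C p x y"
    and K: "\<And>x y. norm (p x y) \<le> K * (norm x * norm y)" "0 \<le> K"
    and z: "isexp z"
    and wo: "well_ordered (hsupp a)" "well_ordered (hsupp b)"
    and ac: "abs_conv a z" "abs_conv b z"
    and hs: "((\<lambda>\<gamma>. e \<gamma> z *\<^sub>C a \<gamma>) has_sum s) UNIV" "((\<lambda>\<gamma>. e \<gamma> z *\<^sub>C b \<gamma>) has_sum t) UNIV"
  shows "abs_conv (conv p a b) z"
    and "((\<lambda>\<gamma>. e \<gamma> z *\<^sub>C conv p a b \<gamma>) has_sum p s t) UNIV"
    and "nsum (conv p a b) z \<le> K * (nsum a z * nsum b z)"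
proof -
  interpret bounded_bilinear p by (rule bb)
  define f where "f = (\<lambda>(\<alpha>, \<beta>). e (\<alpha> + \<beta>) z *\<^sub>C p (a \<alpha>) (b \<beta>))"
  define u where "u \<alpha> = cmod (e \<alpha> z) * norm (a \<alpha>)" for \<alpha>
  define v where "v \<beta> = cmod (e \<beta> z) * norm (b \<beta>)" for \<beta>
  have f_eq: "f (\<alpha>, \<beta>) = p (e \<alpha> z *\<^sub>C a \<alpha>) (e \<beta> z *\<^sub>C b \<beta>)" for \<alpha> \<beta>
    by (simp add: f_def pC exp_add[OF z])
  have g_has_sum: "((\<lambda>(\<alpha>, \<beta>). K * (u \<alpha> * v \<beta>)) has_sum (K * (nsum a z * nsum b z))) (UNIV \<times> UNIV)"
  proof (rule has_sum_SigmaI)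
    show inner: "((\<lambda>\<beta>. case (\<alpha>, \<beta>) of (\<alpha>, \<beta>) \<Rightarrow> K * (u \<alpha> * v \<beta>)) has_sum K * (u \<alpha> * nsum b z)) UNIV" for \<alpha>
      unfolding prod.case v_def
      by (intro has_sum_cmult_right abs_conv_has_sum ac)
    show outer: "((\<lambda>\<alpha>. K * (u \<alpha> * nsum b z)) has_sum K * (nsum a z * nsum b z)) UNIV"
      unfolding u_def
      by (intro has_sum_cmult_right has_sum_cmult_left abs_conv_has_sum ac)
    show "(\<lambda>(\<alpha>, \<beta>). K * (u \<alpha> * v \<beta>)) summable_on UNIV \<times> UNIV"
    proof (rule summable_on_SigmaI)
      show "((\<lambda>\<beta>. case (\<alpha>, \<beta>) of (\<alpha>, \<beta>) \<Rightarrow> K * (u \<alpha> * v \<beta>)) has_sum K * (u \<alpha> * nsum b z)) UNIV" for \<alpha>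
        by (rule inner)
      show "(\<lambda>\<alpha>. K * (u \<alpha> * nsum b z)) summable_on UNIV"
        using outer by (rule has_sum_imp_summable)
      show "0 \<le> (case (\<alpha>, \<beta>) of (\<alpha>, \<beta>) \<Rightarrow> K * (u \<alpha> * v \<beta>))" for \<alpha> \<beta>
        using K(2) by (simp add: u_def v_def)
    qed
  qed
  have nf_le: "norm (f x) \<le> (case x of (\<alpha>, \<beta>) \<Rightarrow> K * (u \<alpha> * v \<beta>))" for x
    using K(1)[of "e (fst x) z *\<^sub>C a (fst x)" "e (snd x) z *\<^sub>C b (snd x)"]
    by (cases x) (simp add: f_eq norm_scaleC u_def v_def)
  have nf_summable: "(\<lambda>x. norm (f x)) summable_on UNIV \<times> UNIV"
    by (rule summable_on_comparison_test[OF has_sum_imp_summable[OF g_has_sum]]) (use nf_le in auto)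
  have nf_sum_le: "(\<Sum>\<^sub>\<infinity>x. norm (f x)) \<le> K * (nsum a z * nsum b z)"
    by (rule has_sum_mono[OF _ g_has_sum[unfolded UNIV_Times_UNIV]])
      (use nf_summable nf_le in \<open>auto intro: has_sum_infsum\<close>)
  have f_has_sum: "(f has_sum p s t) (UNIV \<times> UNIV)"
  proof (rule has_sum_SigmaI)
    show "((\<lambda>\<beta>. f (\<alpha>, \<beta>)) has_sum p (e \<alpha> z *\<^sub>C a \<alpha>) t) UNIV" for \<alpha>
      unfolding f_eq by (rule has_sum_bounded_linear[OF bounded_linear_right hs(2)])
    show "((\<lambda>\<alpha>. p (e \<alpha> z *\<^sub>C a \<alpha>) t) has_sum p s t) UNIV"
      by (rule has_sum_bounded_linear[OF bounded_linear_left hs(1)])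
    show "f summable_on UNIV \<times> UNIV" using nf_summable by (rule abs_summable_summable)
  qed
  \<comment> \<open>Takes a total exponent and a first summand to the pair of summands, so the
    double sum is regrouped by total exponent.\<close>
  define g where "g = (\<lambda>x::'g \<times> 'g. (snd x, fst x - snd x))"
  have g: "bij_betw g (UNIV \<times> UNIV) (UNIV \<times> UNIV)"
    by (rule bij_betw_byWitness[where f' = "\<lambda>x. (fst x + snd x, fst x)"]) (auto simp: g_def)
  have fg: "f (g (\<gamma>, \<alpha>)) = e \<gamma> z *\<^sub>C p (a \<alpha>) (b (\<gamma> - \<alpha>))" for \<gamma> \<alpha>
    by (simp add: f_def g_def)
  let ?I = "\<lambda>\<gamma>. {\<alpha>\<in>hsupp a. \<gamma> - \<alpha> \<in> hsupp b}"
  have finI: "finite (?I \<gamma>)" for \<gamma> by (rule sumset_fibre_finite[OF wo])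
  have zeroI: "f (g (\<gamma>, \<alpha>)) = 0" if "\<alpha> \<in> UNIV - ?I \<gamma>" for \<gamma> \<alpha>
    using that by (auto simp: fg zero_left zero_right in_hsupp)
  have inner: "((\<lambda>\<alpha>. f (g (\<gamma>, \<alpha>))) has_sum e \<gamma> z *\<^sub>C conv p a b \<gamma>) UNIV" for \<gamma>
    by (rule has_sum_finite_neutralI[OF finI]) (auto simp: conv_def fg complex_vector.scale_sum_right in_hsupp zero_left zero_right)
  have innern: "((\<lambda>\<alpha>. norm (f (g (\<gamma>, \<alpha>)))) has_sum (\<Sum>\<alpha>\<in>?I \<gamma>. norm (f (g (\<gamma>, \<alpha>))))) UNIV" for \<gamma>
    by (rule has_sum_finite_neutralI[OF finI]) (simp_all add: zeroI)
  show "((\<lambda>\<gamma>. e \<gamma> z *\<^sub>C conv p a b \<gamma>) has_sum p s t) UNIV"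
  proof (rule has_sum_SigmaD)
    show "((\<lambda>x. f (g x)) has_sum p s t) (UNIV \<times> UNIV)"
      using f_has_sum by (subst has_sum_reindex_bij_betw[OF g])
    show "((\<lambda>\<alpha>. f (g (\<gamma>, \<alpha>))) has_sum e \<gamma> z *\<^sub>C conv p a b \<gamma>) UNIV" for \<gamma> by (rule inner)
  qed
  have N: "((\<lambda>\<gamma>. \<Sum>\<alpha>\<in>?I \<gamma>. norm (f (g (\<gamma>, \<alpha>)))) has_sum (\<Sum>\<^sub>\<infinity>x. norm (f x))) UNIV"
  proof (rule has_sum_SigmaD)
    show "((\<lambda>x. norm (f (g x))) has_sum (\<Sum>\<^sub>\<infinity>x. norm (f x))) (UNIV \<times> UNIV)"
      using nf_summable by (subst has_sum_reindex_bij_betw[OF g]) (auto intro: has_sum_infsum)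
    show "((\<lambda>\<alpha>. norm (f (g (\<gamma>, \<alpha>)))) has_sum (\<Sum>\<alpha>\<in>?I \<gamma>. norm (f (g (\<gamma>, \<alpha>))))) UNIV" for \<gamma>
      by (rule innern)
  qed
  have le: "cmod (e \<gamma> z) * norm (conv p a b \<gamma>) \<le> (\<Sum>\<alpha>\<in>?I \<gamma>. norm (f (g (\<gamma>, \<alpha>))))" for \<gamma>
  proof -
    have "cmod (e \<gamma> z) * norm (conv p a b \<gamma>) = norm (e \<gamma> z *\<^sub>C conv p a b \<gamma>)"
      by (simp add: norm_scaleC)
    also have "\<dots> \<le> (\<Sum>\<alpha>\<in>?I \<gamma>. norm (f (g (\<gamma>, \<alpha>))))"
      by (rule norm_has_sum_bound[OF innern inner])
    finally show ?thesis .
  qed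
  show ac': "abs_conv (conv p a b) z"
    by (rule abs_convI[OF has_sum_imp_summable[OF N] le])
  have "nsum (conv p a b) z \<le> (\<Sum>\<^sub>\<infinity>x. norm (f x))"
    by (rule has_sum_mono[OF abs_conv_has_sum[OF ac'] N]) (rule le)
  then show "nsum (conv p a b) z \<le> K * (nsum a z * nsum b z)"
    using nf_sum_le by linarith
qed

end

section \<open>Powers of a series, and the geometric series in a Banach algebra\<close>

primrec conv_power :: "('g::group_add \<Rightarrow> 'a::{monoid_mult, comm_monoid_add}) \<Rightarrow> nat \<Rightarrow> 'g \<Rightarrow> 'a" where
  "conv_power a 0 = (\<lambda>\<gamma>. if \<gamma> = 0 then 1 else 0)"
| "conv_power a (Suc n) = conv (*) a (conv_power a n)"

lemma hsupp_conv_power: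
  fixes a :: "'g::ab_group_add \<Rightarrow> 'a::{monoid_mult, comm_monoid_add}"
  shows "hsupp (conv_power a n) \<subseteq> all_sums (hsupp a)"
proof (induction n)
  case 0
  then show ?case using all_sums_zero[of "hsupp a"] by (auto simp: hsupp_def split: if_splits)
next
  case (Suc n)
  show ?case
  proof
    fix x assume "x \<in> hsupp (conv_power a (Suc n))"
    then have "x \<in> {\<alpha> + \<beta> |\<alpha> \<beta>. \<alpha> \<in> hsupp a \<and> \<beta> \<in> hsupp (conv_power a n)}"
      using hsupp_conv[of "(*)" a "conv_power a n"] by auto
    then obtain \<alpha> \<beta> where ab: "x = \<alpha> + \<beta>" "\<alpha> \<in> hsupp a" "\<beta> \<in> hsupp (conv_power a n)" by blast
    have "\<alpha> \<in> all_sums (hsupp a)" using ab(2) all_sums_incl by (rule rev_subsetD)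
    moreover have "\<beta> \<in> all_sums (hsupp a)" using ab(3) Suc by (rule rev_subsetD)
    ultimately show "x \<in> all_sums (hsupp a)" unfolding ab(1) by (rule all_sums_add)
  qed
qed

lemma geometric_inverse:
  fixes q :: "'a::{complex_banach_algebra, monoid_mult}"
  assumes "(\<lambda>n. q ^ n) sums r"
  shows "r * (1 - q) = 1 \<and> (1 - q) * r = 1"
proof -
  have S: "(\<lambda>n. q ^ Suc n) sums (r - 1)"
    using assms by (subst sums_Suc_iff) simp
  have "(\<lambda>n. q * q ^ n) sums (q * r)"
    using assms by (rule bounded_linear.sums[OF bounded_linear_mult_right])
  then have 1: "q * r = r - 1" using S by (auto intro: sums_unique2)
  have "(\<lambda>n. q ^ n * q) sums (r * q)"
    using assms by (rule bounded_linear.sums[OF bounded_linear_mult_left])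
  then have "(\<lambda>n. q ^ Suc n) sums (r * q)" by (simp only: power_Suc2)
  then have 2: "r * q = r - 1" using S by (rule sums_unique2)
  show ?thesis by (simp add: left_diff_distrib right_diff_distrib 1 2)
qed

text \<open>The factor \<open>norm 1\<close> is kept because \<open>norm 1 = 1\<close> is not an
  axiom here: on the zero space the identity operator has norm \<open>0\<close>.\<close>

lemma norm_power_le:
  fixes q :: "'a::{complex_banach_algebra, monoid_mult}"
  shows "norm (q ^ n) \<le> norm (1::'a) * norm q ^ n"
proof (induction n)
  case (Suc n)
  have "norm (q ^ Suc n) \<le> norm q * norm (q ^ n)" by (simp add: norm_mult_ineq)
  also have "\<dots> \<le> norm q * (norm (1::'a) * norm q ^ n)" by (intro mult_left_mono Suc) simp
  finally show ?case by (simp add: mult_ac)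
qed simp

lemma banach_geometric_inverse:
  fixes q :: "'a::{complex_banach_algebra, monoid_mult}"
  assumes "norm q < 1"
  shows "\<exists>r. r * (1 - q) = 1 \<and> (1 - q) * r = 1"
proof -
  have "summable (\<lambda>n. norm (1::'a) * norm q ^ n)"
    using assms by (intro summable_mult summable_geometric) simp
  then have "summable (\<lambda>n. q ^ n)"
    by (rule summable_comparison_test'[of _ 0]) (rule norm_power_le)
  then show ?thesis using geometric_inverse summable_sums by blast
qed

section \<open>Functions represented by series, and their closure properties\<close>

context germs
begin

text \<open>Only eventual values along \<open>F\<close> enter, so the function may be arbitrary at
  the centre, and negative exponents are allowed.\<close>

definition germ :: "('z \<Rightarrow> 'a::complex_normed_vector) \<Rightarrow> ('g \<Rightarrow> 'a) \<Rightarrow> bool" where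
  "germ h a \<longleftrightarrow> adm (hsupp a) \<and>
     (\<forall>\<^sub>F z in F. abs_conv a z \<and> ((\<lambda>\<gamma>. e \<gamma> z *\<^sub>C a \<gamma>) has_sum h z) UNIV)"

lemma germ_adm: "germ h a \<Longrightarrow> adm (hsupp a)"
  by (simp add: germ_def)

lemma germ_ev: "germ h a \<Longrightarrow> \<forall>\<^sub>F z in F. abs_conv a z \<and> ((\<lambda>\<gamma>. e \<gamma> z *\<^sub>C a \<gamma>) has_sum h z) UNIV"
  by (simp add: germ_def)

lemma germI:
  assumes "adm (hsupp a)"
    "\<forall>\<^sub>F z in F. isexp z \<longrightarrow> abs_conv a z \<and> ((\<lambda>\<gamma>. e \<gamma> z *\<^sub>C a \<gamma>) has_sum h z) UNIV"
  shows "germ h a"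
  unfolding germ_def using assms(1)
proof
  show "\<forall>\<^sub>F z in F. abs_conv a z \<and> ((\<lambda>\<gamma>. e \<gamma> z *\<^sub>C a \<gamma>) has_sum h z) UNIV"
    using assms(2) eventually_isexp by eventually_elim blast
qed

lemma germ_cong:
  assumes "germ h a" "\<forall>\<^sub>F z in F. h z = h' z"
  shows "germ h' a"
  unfolding germ_def
proof
  show "\<forall>\<^sub>F z in F. abs_conv a z \<and> ((\<lambda>\<gamma>. e \<gamma> z *\<^sub>C a \<gamma>) has_sum h' z) UNIV"
    using germ_ev[OF assms(1)] assms(2) by eventually_elim simp
qed (rule germ_adm[OF assms(1)])

lemma germ_linear:
  assumes h: "germ h a" and L: "bounded_linear L" "\<And>c x. L (c *\<^sub>C x) = c *\<^sub>C L x"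
  shows "germ (\<lambda>z. L (h z)) (\<lambda>\<gamma>. L (a \<gamma>))"
proof (rule germI)
  interpret bounded_linear L by (rule L(1))
  obtain K where K: "\<And>x. norm (L x) \<le> norm x * K" using nonneg_bounded by blast
  show "adm (hsupp (\<lambda>\<gamma>. L (a \<gamma>)))"
    by (rule adm_subset[OF germ_adm[OF h]]) (auto simp: hsupp_def zero)
  show "\<forall>\<^sub>F z in F. isexp z \<longrightarrow> abs_conv (\<lambda>\<gamma>. L (a \<gamma>)) z \<and>
      ((\<lambda>\<gamma>. e \<gamma> z *\<^sub>C L (a \<gamma>)) has_sum L (h z)) UNIV"
    using germ_ev[OF h]
  proof (eventually_elim, intro impI conjI)
    case (elim z)
    show "abs_conv (\<lambda>\<gamma>. L (a \<gamma>)) z"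
    proof (rule abs_convI)
      show "(\<lambda>\<gamma>. (cmod (e \<gamma> z) * norm (a \<gamma>)) * K) summable_on UNIV"
        using elim by (intro summable_on_cmult_left) (simp add: abs_conv_def)
      show "cmod (e \<gamma> z) * norm (L (a \<gamma>)) \<le> (cmod (e \<gamma> z) * norm (a \<gamma>)) * K" for \<gamma>
        using mult_left_mono[OF K[of "a \<gamma>"], of "cmod (e \<gamma> z)"] by (simp add: mult_ac)
    qed
    have "((\<lambda>\<gamma>. L (e \<gamma> z *\<^sub>C a \<gamma>)) has_sum L (h z)) UNIV"
      using elim by (intro has_sum_bounded_linear[OF L(1)]) simp
    then show "((\<lambda>\<gamma>. e \<gamma> z *\<^sub>C L (a \<gamma>)) has_sum L (h z)) UNIV" by (simp add: L(2))
  qed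
qed

lemma germ_single: "germ (\<lambda>z. e m z *\<^sub>C c) (\<lambda>\<gamma>. if \<gamma> = m then c else 0)"
proof (rule germI)
  show "adm (hsupp (\<lambda>\<gamma>. if \<gamma> = m then c else 0))"
    by (rule adm_finite, rule finite_subset[of _ "{m}"]) (auto simp: hsupp_def)
  have "abs_conv (\<lambda>\<gamma>. if \<gamma> = m then c else 0) z" for z
    unfolding abs_conv_def
    by (rule finite_nonzero_values_imp_summable_on, rule finite_subset[of _ "{m}"]) auto
  moreover have "((\<lambda>\<gamma>. e \<gamma> z *\<^sub>C (if \<gamma> = m then c else 0)) has_sum e m z *\<^sub>C c) UNIV" for z
    by (rule has_sum_finite_neutralI[of "{m}"]) auto
  ultimately show "\<forall>\<^sub>F z in F. isexp z \<longrightarrow> abs_conv (\<lambda>\<gamma>. if \<gamma> = m then c else 0) z \<and>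
      ((\<lambda>\<gamma>. e \<gamma> z *\<^sub>C (if \<gamma> = m then c else 0)) has_sum e m z *\<^sub>C c) UNIV"
    by simp
qed

lemma germ_const: "germ (\<lambda>z. c) (\<lambda>\<gamma>. if \<gamma> = 0 then c else 0)"
proof (rule germ_cong[OF germ_single])
  show "\<forall>\<^sub>F z in F. e 0 z *\<^sub>C c = c"
    using eventually_isexp by eventually_elim (simp add: exp_zero scaleC_one)
qed

lemma germ_zero: "germ (\<lambda>z. 0) (\<lambda>\<gamma>. 0)"
  using germ_const[of 0] by simp

lemma germ_add:
  assumes h: "germ h a" and k: "germ k b"
  shows "germ (\<lambda>z. h z + k z) (\<lambda>\<gamma>. a \<gamma> + b \<gamma>)"
proof (rule germI)
  show "adm (hsupp (\<lambda>\<gamma>. a \<gamma> + b \<gamma>))"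
    by (rule adm_subset[OF adm_Un[OF germ_adm[OF h] germ_adm[OF k]]]) (auto simp: hsupp_def)
  show "\<forall>\<^sub>F z in F. isexp z \<longrightarrow> abs_conv (\<lambda>\<gamma>. a \<gamma> + b \<gamma>) z \<and>
      ((\<lambda>\<gamma>. e \<gamma> z *\<^sub>C (a \<gamma> + b \<gamma>)) has_sum h z + k z) UNIV"
    using germ_ev[OF h] germ_ev[OF k]
  proof (eventually_elim, intro impI conjI)
    case (elim z)
    show "abs_conv (\<lambda>\<gamma>. a \<gamma> + b \<gamma>) z"
    proof (rule abs_convI)
      show "(\<lambda>\<gamma>. cmod (e \<gamma> z) * norm (a \<gamma>) + cmod (e \<gamma> z) * norm (b \<gamma>)) summable_on UNIV"
        using elim by (intro summable_on_add) (simp_all add: abs_conv_def)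
      show "cmod (e \<gamma> z) * norm (a \<gamma> + b \<gamma>) \<le>
          cmod (e \<gamma> z) * norm (a \<gamma>) + cmod (e \<gamma> z) * norm (b \<gamma>)" for \<gamma>
        by (simp flip: distrib_left add: mult_left_mono norm_triangle_ineq)
    qed
    show "((\<lambda>\<gamma>. e \<gamma> z *\<^sub>C (a \<gamma> + b \<gamma>)) has_sum h z + k z) UNIV"
      using elim by (simp add: scaleC_add_right has_sum_add)
  qed
qed

lemma germ_minus: "germ h a \<Longrightarrow> germ (\<lambda>z. - h z) (\<lambda>\<gamma>. - a \<gamma>)"
  by (rule germ_linear[of h a uminus])
    (simp_all add: bounded_linear_minus[OF bounded_linear_ident] complex_vector.scale_minus_right)

lemma germ_diff:
  assumes "germ h a" "germ k b"
  shows "germ (\<lambda>z. h z - k z) (\<lambda>\<gamma>. a \<gamma> - b \<gamma>)"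
  using germ_add[OF assms(1) germ_minus[OF assms(2)]] by simp

lemma germ_sum:
  assumes "finite I" "\<And>i. i \<in> I \<Longrightarrow> germ (h i) (a i)"
  shows "germ (\<lambda>z. \<Sum>i\<in>I. h i z) (\<lambda>\<gamma>. \<Sum>i\<in>I. a i \<gamma>)"
  using assms by (induction I rule: finite_induct) (simp_all add: germ_zero germ_add)

lemma germ_shift:
  assumes h: "germ h a"
  shows "germ (\<lambda>z. e m z *\<^sub>C h z) (\<lambda>\<gamma>. a (\<gamma> - m))"
proof (rule germI)
  have "hsupp (\<lambda>\<gamma>. a (\<gamma> - m)) \<subseteq> (+) m ` hsupp a"
  proof
    fix x assume "x \<in> hsupp (\<lambda>\<gamma>. a (\<gamma> - m))"
    then have "x - m \<in> hsupp a" by (simp add: hsupp_def)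
    moreover have "x = m + (x - m)" by simp
    ultimately show "x \<in> (+) m ` hsupp a" by (rule rev_image_eqI)
  qed
  then show "adm (hsupp (\<lambda>\<gamma>. a (\<gamma> - m)))"
    by (rule adm_subset[OF adm_shift[OF germ_adm[OF h]]])
  have bij: "bij_betw (\<lambda>\<gamma>. \<gamma> - m) UNIV UNIV"
    by (rule bij_betw_byWitness[where f' = "\<lambda>\<gamma>. \<gamma> + m"]) auto
  show "\<forall>\<^sub>F z in F. isexp z \<longrightarrow> abs_conv (\<lambda>\<gamma>. a (\<gamma> - m)) z \<and>
      ((\<lambda>\<gamma>. e \<gamma> z *\<^sub>C a (\<gamma> - m)) has_sum e m z *\<^sub>C h z) UNIV"
    using germ_ev[OF h]
  proof (eventually_elim, intro impI conjI)
    case (elim z)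
    assume z: "isexp z"
    have e_eq: "e \<gamma> z = e m z * e (\<gamma> - m) z" for \<gamma> using exp_add[OF z, of m "\<gamma> - m"] by simp
    have "(\<lambda>\<gamma>. cmod (e m z) * (cmod (e \<gamma> z) * norm (a \<gamma>))) summable_on UNIV"
      using elim by (intro summable_on_cmult_right) (simp add: abs_conv_def)
    then have "(\<lambda>\<gamma>. cmod (e m z) * (cmod (e (\<gamma> - m) z) * norm (a (\<gamma> - m)))) summable_on UNIV"
      by (subst summable_on_reindex_bij_betw[OF bij])
    then show "abs_conv (\<lambda>\<gamma>. a (\<gamma> - m)) z"
      unfolding abs_conv_def by (subst e_eq) (simp add: norm_mult mult_ac)
    have "((\<lambda>\<gamma>. e m z *\<^sub>C (e \<gamma> z *\<^sub>C a \<gamma>)) has_sum e m z *\<^sub>C h z) UNIV"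
      using elim by (intro has_sum_bounded_linear[OF bounded_linear_scaleC]) simp
    then have "((\<lambda>\<gamma>. e m z *\<^sub>C (e (\<gamma> - m) z *\<^sub>C a (\<gamma> - m))) has_sum e m z *\<^sub>C h z) UNIV"
      by (subst has_sum_reindex_bij_betw[OF bij])
    then show "((\<lambda>\<gamma>. e \<gamma> z *\<^sub>C a (\<gamma> - m)) has_sum e m z *\<^sub>C h z) UNIV"
      by (subst e_eq) (simp add: scaleC_scaleC)
  qed
qed

lemma germ_mult:
  fixes p :: "'a::complex_normed_vector \<Rightarrow> 'b::complex_normed_vector \<Rightarrow> 'c::{complex_normed_vector, banach}"
  assumes bb: "bounded_bilinear p"
    and pC: "\<And>c d x y. p (c *\<^sub>C x) (d *\<^sub>C y) = (c * d) *\<^sub>C p x y"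
    and h: "germ h a" and k: "germ k b"
  shows "germ (\<lambda>z. p (h z) (k z)) (conv p a b)"
proof (rule germI)
  obtain K where K: "0 \<le> K" "\<And>x y. norm (p x y) \<le> norm x * norm y * K"
    using bounded_bilinear.nonneg_bounded[OF bb] by blast
  then have K': "norm (p x y) \<le> K * (norm x * norm y)" for x y by (simp add: mult_ac)
  show "adm (hsupp (conv p a b))"
    by (rule adm_subset[OF adm_sumset[OF germ_adm[OF h] germ_adm[OF k]] hsupp_conv])
  show "\<forall>\<^sub>F z in F. isexp z \<longrightarrow> abs_conv (conv p a b) z \<and>
      ((\<lambda>\<gamma>. e \<gamma> z *\<^sub>C conv p a b \<gamma>) has_sum p (h z) (k z)) UNIV"
    using germ_ev[OF h] germ_ev[OF k]
  proof (eventually_elim, intro impI)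
    case (elim z)
    assume z: "isexp z"
    have wo: "well_ordered (hsupp a)" "well_ordered (hsupp b)"
      using germ_adm[OF h] germ_adm[OF k] by (auto dest: admD)
    show "abs_conv (conv p a b) z \<and> ((\<lambda>\<gamma>. e \<gamma> z *\<^sub>C conv p a b \<gamma>) has_sum p (h z) (k z)) UNIV"
      using conv_pointwise(1,2)[OF bb pC K' K(1) z wo, of "h z" "k z"] elim by blast
  qed
qed

lemma germ_times:
  fixes h k :: "'z \<Rightarrow> 'a::complex_banach_algebra"
  assumes "germ h a" "germ k b"
  shows "germ (\<lambda>z. h z * k z) (conv (*) a b)"
  by (rule germ_mult[OF bounded_bilinear_mult _ assms])
    (simp add: mult_scaleC_left mult_scaleC_right scaleC_scaleC)

lemma germ_scaleC:
  fixes k :: "'z \<Rightarrow> 'a::{complex_normed_vector, banach}"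
  assumes "germ h a" "germ k b"
  shows "germ (\<lambda>z. h z *\<^sub>C k z) (conv (*\<^sub>C) a b)"
  by (rule germ_mult[OF bounded_bilinear_scaleC _ assms])
    (simp add: scaleC_complex_def scaleC_scaleC mult_ac)

subsection \<open>Leading terms\<close>

text \<open>Fix one base point \<open>x\<close> with absolute convergence and domination of the gaps
  at \<open>m\<close>. Then each quotient \<open>e \<gamma> / e m\<close> is no larger at
  \<open>z\<close> than at \<open>x\<close>, and summing over the support gives the constant
  \<open>nsum a x / cmod (e m x)\<close>.\<close>

lemma nsum_bound:
  assumes a: "adm (hsupp a)" "\<forall>\<^sub>F z in F. abs_conv a z" "hsupp a \<subseteq> {m..}"
  shows "\<exists>C. \<forall>\<^sub>F z in F. nsum a z \<le> C * cmod (e m z)"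
proof -
  have "\<forall>\<^sub>F x in FB. abs_conv a x \<and> isexp x \<and>
      (\<forall>\<^sub>F z in F. \<forall>\<alpha>\<in>gaps (hsupp a) m. cmod (e \<alpha> z) \<le> cmod (e \<alpha> x))"
    using eventually_FB[OF a(2)] eventually_FB[OF eventually_isexp] wm_gaps[OF a(1), of m]
    unfolding wm_def by eventually_elim simp
  then obtain x where x: "abs_conv a x" "isexp x"
    "\<forall>\<^sub>F z in F. \<forall>\<alpha>\<in>gaps (hsupp a) m. cmod (e \<alpha> z) \<le> cmod (e \<alpha> x)"
    using eventually_happens'[OF FB_nontriv] by blast
  have pos: "0 < cmod (e m x)" using exp_nonzero[OF x(2)] by simp
  have "\<forall>\<^sub>F z in F. nsum a z \<le> (nsum a x / cmod (e m x)) * cmod (e m z)"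
    using x(3) a(2) eventually_isexp
  proof eventually_elim
    case (elim z)
    have "nsum a z \<le> (cmod (e m z) / cmod (e m x)) * nsum a x"
    proof (rule has_sum_mono[OF abs_conv_has_sum[OF elim(2)] has_sum_cmult_right[OF abs_conv_has_sum[OF x(1)]]])
      fix \<gamma>
      show "cmod (e \<gamma> z) * norm (a \<gamma>) \<le> cmod (e m z) / cmod (e m x) * (cmod (e \<gamma> x) * norm (a \<gamma>))"
      proof (cases "\<gamma> \<in> hsupp a")
        case True
        then have "\<gamma> - m \<in> gaps (hsupp a) m" using a(3) by (auto simp: gaps_def)
        with elim(1) have "cmod (e (\<gamma> - m) z) \<le> cmod (e (\<gamma> - m) x)" by blast
        then have "cmod (e \<gamma> z) / cmod (e m z) \<le> cmod (e \<gamma> x) / cmod (e m x)"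
          using elim(3) x(2) by (simp add: exp_diff norm_divide)
        moreover have "0 < cmod (e m z)" using exp_nonzero[OF elim(3)] by simp
        ultimately have *: "cmod (e \<gamma> z) \<le> cmod (e m z) / cmod (e m x) * cmod (e \<gamma> x)"
          using pos by (simp add: field_simps)
        show ?thesis using mult_right_mono[OF *, of "norm (a \<gamma>)"] by (simp add: mult.assoc)
      qed simp
    qed
    then show ?case by (simp add: mult_ac)
  qed
  then show ?thesis by blast
qed

text \<open>The least exponent \<open>m\<close> of the support is positive, and
  \<open>nsum a\<close> is bounded by a multiple of \<open>cmod (e m z)\<close>.\<close>

lemma nsum_tendsto_0:
  assumes a: "adm (hsupp a)" "\<forall>\<^sub>F z in F. abs_conv a z" "hsupp a \<subseteq> {0<..}"
  shows "(nsum a \<longlongrightarrow> 0) F"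
proof (cases "hsupp a = {}")
  case True
  then have "nsum a = (\<lambda>z. 0)" by (auto simp: nsum_def hsupp_def)
  then show ?thesis by simp
next
  case False
  then obtain m where m: "m \<in> hsupp a" "\<And>\<gamma>. \<gamma> \<in> hsupp a \<Longrightarrow> m \<le> \<gamma>"
    using well_orderedD[OF admD[OF a(1)], of "hsupp a"] by blast
  obtain C where C: "\<forall>\<^sub>F z in F. nsum a z \<le> C * cmod (e m z)"
    using nsum_bound[OF a(1,2), of m] m(2) by auto
  have "(e m \<longlongrightarrow> 0) F" using m(1) a(3) by (intro exp_tendsto_0) auto
  then have "((\<lambda>z. C * cmod (e m z)) \<longlongrightarrow> C * 0) F"
    by (intro tendsto_mult tendsto_const tendsto_norm_zero)
  then have "((\<lambda>z. C * cmod (e m z)) \<longlongrightarrow> 0) F" by simp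
  moreover have "\<forall>\<^sub>F z in F. norm (nsum a z) \<le> C * cmod (e m z)"
    using C by eventually_elim (simp add: nsum_nonneg)
  ultimately show ?thesis by (rule Lim_null_comparison[rotated])
qed

lemma germ_tendsto:
  assumes h: "germ h a" and supp: "hsupp a \<subseteq> {0..}"
  shows "(h \<longlongrightarrow> a 0) F"
proof -
  let ?b = "\<lambda>\<gamma>. a \<gamma> - (if \<gamma> = 0 then a 0 else 0)"
  have g: "germ (\<lambda>z. h z - a 0) ?b" by (rule germ_diff[OF h germ_const])
  have "\<gamma> > 0" if "?b \<gamma> \<noteq> 0" for \<gamma>
    using that supp by (cases "\<gamma> = 0") (auto simp: hsupp_def order_le_less)
  then have "hsupp ?b \<subseteq> {0<..}" by (auto simp: hsupp_def)
  then have "(nsum ?b \<longlongrightarrow> 0) F"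
    by (intro nsum_tendsto_0 germ_adm[OF g] eventually_mono[OF germ_ev[OF g]]) auto
  moreover have "\<forall>\<^sub>F z in F. norm (h z - a 0) \<le> nsum ?b z"
    using germ_ev[OF g] by eventually_elim (auto intro: has_sum_norm_le_nsum)
  ultimately have "((\<lambda>z. h z - a 0) \<longlongrightarrow> 0) F" by (rule Lim_null_comparison[rotated])
  then show ?thesis by (simp add: LIM_zero_iff)
qed

lemma germ_leading:
  assumes h: "germ h a" and supp: "hsupp a \<subseteq> {m..}"
  shows "((\<lambda>z. e (- m) z *\<^sub>C h z) \<longlongrightarrow> a m) F"
proof -
  have "hsupp (\<lambda>\<gamma>. a (\<gamma> - - m)) \<subseteq> {0..}"
  proof
    fix x assume "x \<in> hsupp (\<lambda>\<gamma>. a (\<gamma> - - m))"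
    then have "x + m \<in> hsupp a" by (simp add: hsupp_def)
    then have "m \<le> x + m" using supp by auto
    then show "x \<in> {0..}" by simp
  qed
  from germ_tendsto[OF germ_shift[OF h, of "- m"] this] show ?thesis by simp
qed

lemma germ_min:
  assumes "germ h a" "hsupp a \<noteq> {}"
  shows "\<exists>m. a m \<noteq> 0 \<and> hsupp a \<subseteq> {m..}"
  using well_orderedD[OF admD[OF germ_adm[OF assms(1)]], of "hsupp a"] assms(2)
  unfolding hsupp_def by auto

text \<open>Divided by the leading exponential, \<open>h\<close> tends to its leading coefficient.
  With \<open>germ_eventually_zero\<close> this is the source of every alternative below: a germ is
  eventually zero or eventually non-zero, and its series decides which.\<close>

lemma germ_eventually_nonzero:
  assumes h: "germ h a" and ne: "hsupp a \<noteq> {}"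
  shows "\<forall>\<^sub>F z in F. h z \<noteq> 0"
proof -
  obtain m where m: "a m \<noteq> 0" "hsupp a \<subseteq> {m..}" using germ_min[OF h ne] by blast
  have "\<forall>\<^sub>F z in F. e (- m) z *\<^sub>C h z \<noteq> 0"
    by (rule tendsto_imp_eventually_ne[OF germ_leading[OF h m(2)] m(1)])
  then show ?thesis by eventually_elim auto
qed

lemma germ_eventually_zero:
  assumes h: "germ h a" and "hsupp a = {}"
  shows "\<forall>\<^sub>F z in F. h z = 0"
  using germ_ev[OF h]
proof eventually_elim
  case (elim z)
  have "a \<gamma> = 0" for \<gamma> using assms(2) by (auto simp: hsupp_def)
  with elim have "((\<lambda>\<gamma>. 0) has_sum h z) (UNIV :: 'g set)" by simp
  then show ?case by (metis has_sum_0 has_sum_unique)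
qed

lemma germ_unique:
  assumes "germ h a" "germ h b"
  shows "a = b"
proof (rule ccontr)
  assume "a \<noteq> b"
  then have "hsupp (\<lambda>\<gamma>. a \<gamma> - b \<gamma>) \<noteq> {}" by (auto simp: hsupp_def fun_eq_iff)
  from germ_eventually_nonzero[OF germ_diff[OF assms] this] have "\<forall>\<^sub>F z in F. False" by simp
  then show False using F_nontriv by (simp add: eventually_False)
qed

text \<open>If the leading exponent \<open>m\<close> were negative, \<open>e (- m)\<close> would
  tend to \<open>0\<close> and so would its product with the bounded \<open>h\<close>; but this
  product tends to the leading coefficient.\<close>

lemma germ_bounded_nonneg:
  assumes h: "germ h a" and bd: "\<forall>\<^sub>F z in F. norm (h z) \<le> C"
  shows "hsupp a \<subseteq> {0..}"
proof (cases "hsupp a = {}")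
  case False
  then obtain m where m: "a m \<noteq> 0" "hsupp a \<subseteq> {m..}" using germ_min[OF h] by blast
  have "0 \<le> m"
  proof (rule ccontr)
    assume "\<not> 0 \<le> m"
    then have "(e (- m) \<longlongrightarrow> 0) F" by (intro exp_tendsto_0) simp
    then have "((\<lambda>z. cmod (e (- m) z) * C) \<longlongrightarrow> 0 * C) F"
      by (intro tendsto_mult tendsto_const tendsto_norm_zero)
    then have "((\<lambda>z. cmod (e (- m) z) * C) \<longlongrightarrow> 0) F" by simp
    moreover have "\<forall>\<^sub>F z in F. norm (e (- m) z *\<^sub>C h z) \<le> cmod (e (- m) z) * C"
      using bd by eventually_elim (simp add: norm_scaleC mult_left_mono)
    ultimately have "((\<lambda>z. e (- m) z *\<^sub>C h z) \<longlongrightarrow> 0) F" by (rule Lim_null_comparison[rotated])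
    then show False using germ_leading[OF h m(2)] m(1) F_nontriv tendsto_unique by blast
  qed
  then show ?thesis using m(2) by auto
qed simp

subsection \<open>Neumann series\<close>

text \<open>Where \<open>nsum a\<close> is below \<open>1/2\<close>, the family indexed by power and
  exponent is absolutely summable: summing over exponents first gives the geometric series of
  \<open>q z\<close>, summing over powers first gives the coefficients \<open>b\<close>. All
  supports lie in the monoid generated by the support of \<open>a\<close>, which is
  admissible.\<close>

lemma germ_neumann:
  fixes q :: "'z \<Rightarrow> 'a::{complex_banach_algebra, monoid_mult}"
  assumes q: "germ q a" and pos: "hsupp a \<subseteq> {0<..}"
  shows "\<exists>r b. germ r b \<and> hsupp b \<subseteq> {0..} \<and> (\<forall>\<^sub>F z in F. r z * (1 - q z) = 1 \<and> (1 - q z) * r z = 1)"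
proof -
  have pos': "hsupp a \<subseteq> {0..}" using pos by auto
  note wo_a = admD[OF germ_adm[OF q]]
  have adm_S: "adm (all_sums (hsupp a))" using germ_adm[OF q] pos' by (rule adm_all_sums)
  \<comment> \<open>Taken as an infinite sum over \<open>n\<close>, so its convergence is part of
    the double-series argument and no bound on the contributing powers is required.\<close>
  define b where "b \<gamma> = (\<Sum>\<^sub>\<infinity>n. conv_power a n \<gamma>)" for \<gamma>
  define r where "r z = (\<Sum>\<^sub>\<infinity>n. q z ^ n)" for z
  have hsupp_b: "hsupp b \<subseteq> all_sums (hsupp a)"
  proof
    fix \<gamma> assume "\<gamma> \<in> hsupp b"
    then have "b \<gamma> \<noteq> 0" by (simp add: hsupp_def)
    moreover have "b \<gamma> = 0" if "\<forall>n. conv_power a n \<gamma> = 0" using that by (simp add: b_def)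
    ultimately obtain n where "\<gamma> \<in> hsupp (conv_power a n)" unfolding hsupp_def by auto
    then show "\<gamma> \<in> all_sums (hsupp a)" using hsupp_conv_power by (rule rev_subsetD)
  qed
  have nsum_a: "(nsum a \<longlongrightarrow> 0) F"
    by (intro nsum_tendsto_0 germ_adm[OF q] eventually_mono[OF germ_ev[OF q]] pos) auto
  \<comment> \<open>Any bound below \<open>1\<close> would serve for the geometric majorant.\<close>
  have small: "\<forall>\<^sub>F z in F. nsum a z < 1/2"
    by (rule order_tendstoD(2)[OF nsum_a]) simp
  have key: "abs_conv b z \<and> ((\<lambda>\<gamma>. e \<gamma> z *\<^sub>C b \<gamma>) has_sum r z) UNIV \<and> (\<lambda>n. q z ^ n) sums r z"
    if z: "isexp z" "abs_conv a z" "((\<lambda>\<gamma>. e \<gamma> z *\<^sub>C a \<gamma>) has_sum q z) UNIV" "nsum a z < 1/2" for z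
  proof -
    have pw: "abs_conv (conv_power a n) z \<and> ((\<lambda>\<gamma>. e \<gamma> z *\<^sub>C conv_power a n \<gamma>) has_sum q z ^ n) UNIV \<and>
        nsum (conv_power a n) z \<le> norm (1::'a) * nsum a z ^ n" for n
    proof (induction n)
      case 0
      have "((\<lambda>\<gamma>. cmod (e \<gamma> z) * norm (conv_power a 0 \<gamma>)) has_sum norm (1::'a)) UNIV"
        by (rule has_sum_finite_neutralI[of "{0}"]) (auto simp: exp_zero z(1))
      moreover have "((\<lambda>\<gamma>. e \<gamma> z *\<^sub>C conv_power a 0 \<gamma>) has_sum q z ^ 0) UNIV"
        by (rule has_sum_finite_neutralI[of "{0}"]) (auto simp: exp_zero z(1) scaleC_one)
      ultimately show ?case
        unfolding abs_conv_def nsum_def using has_sum_imp_summable infsumI by fastforce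
    next
      case (Suc n)
      have wo: "well_ordered (hsupp (conv_power a n))"
        by (rule well_ordered_subset[OF admD[OF adm_S] hsupp_conv_power])
      note cp = conv_pointwise[OF bounded_bilinear_mult _ _ _ z(1) wo_a wo z(2) _ z(3), of 1 "q z ^ n"]
      have "nsum (conv (*) a (conv_power a n)) z \<le> 1 * (nsum a z * nsum (conv_power a n) z)"
        by (rule cp(3)) (use Suc in \<open>simp_all add: mult_scaleC_left mult_scaleC_right scaleC_scaleC norm_mult_ineq\<close>)
      also have "\<dots> \<le> nsum a z * (norm (1::'a) * nsum a z ^ n)"
        using Suc nsum_nonneg[of a z] by (simp add: mult_left_mono)
      finally have "nsum (conv_power a (Suc n)) z \<le> norm (1::'a) * nsum a z ^ Suc n"
        by (simp add: mult_ac)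
      moreover have "abs_conv (conv_power a (Suc n)) z"
        unfolding conv_power.simps
        by (rule cp(1)) (use Suc in \<open>simp_all add: mult_scaleC_left mult_scaleC_right scaleC_scaleC norm_mult_ineq\<close>)
      moreover have "((\<lambda>\<gamma>. e \<gamma> z *\<^sub>C conv_power a (Suc n) \<gamma>) has_sum q z ^ Suc n) UNIV"
        unfolding conv_power.simps power_Suc
        by (rule cp(2)) (use Suc in \<open>simp_all add: mult_scaleC_left mult_scaleC_right scaleC_scaleC norm_mult_ineq\<close>)
      ultimately show ?case by blast
    qed
    define f where "f = (\<lambda>(n, \<gamma>). e \<gamma> z *\<^sub>C conv_power a n \<gamma>)"
    have innern: "((\<lambda>\<gamma>. norm (f (n, \<gamma>))) has_sum nsum (conv_power a n) z) UNIV" for n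
      unfolding f_def prod.case norm_scaleC using pw[of n] by (intro abs_conv_has_sum) blast
    have nf: "(\<lambda>x. norm (f x)) summable_on UNIV \<times> UNIV"
    proof (rule summable_on_SigmaI[OF innern])
      have "summable (\<lambda>n. norm (1::'a) * nsum a z ^ n)"
        using z(4) nsum_nonneg[of a z] by (intro summable_mult summable_geometric) simp
      then have "summable (\<lambda>n. norm (nsum (conv_power a n) z))"
        by (rule summable_comparison_test'[of _ 0]) (use pw in \<open>simp add: nsum_nonneg\<close>)
      then show "(\<lambda>n. nsum (conv_power a n) z) summable_on UNIV"
        by (rule norm_summable_imp_summable_on)
    qed simp
    define s where "s = infsum f (UNIV \<times> UNIV)"
    have f: "(f has_sum s) (UNIV \<times> UNIV)"
      unfolding s_def by (rule has_sum_infsum[OF abs_summable_summable[OF nf]])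
    have "((\<lambda>n. q z ^ n) has_sum s) UNIV"
      by (rule has_sum_SigmaD[OF f]) (use pw in \<open>simp add: f_def\<close>)
    then have r: "((\<lambda>n. q z ^ n) has_sum r z) UNIV" and sr: "s = r z"
      unfolding r_def by (simp_all add: infsumI)
    have f': "((\<lambda>(\<gamma>, n). f (n, \<gamma>)) has_sum r z) (UNIV \<times> UNIV)"
      using f unfolding sr by (subst (asm) has_sum_swap)
    have nf': "(\<lambda>(\<gamma>, n). norm (f (n, \<gamma>))) summable_on UNIV \<times> UNIV"
      using nf by (subst (asm) summable_on_swap)
    have nf1: "(\<lambda>n. norm (f (n, \<gamma>))) summable_on UNIV" for \<gamma>
      by (rule summable_on_SigmaD1[OF nf']) simp
    have inner: "((\<lambda>n. f (n, \<gamma>)) has_sum e \<gamma> z *\<^sub>C b \<gamma>) UNIV" for \<gamma>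
    proof -
      have "(\<lambda>n. f (n, \<gamma>)) summable_on UNIV" using nf1 by (rule abs_summable_summable)
      \<comment> \<open>Exponentials do not vanish, so dividing by \<open>e \<gamma> z\<close> turns
        summability of the terms at one point into summability of the coefficients.\<close>
      then have "(\<lambda>n. inverse (e \<gamma> z) *\<^sub>C f (n, \<gamma>)) summable_on UNIV"
        by (rule summable_on_bounded_linear[OF bounded_linear_scaleC])
      then have "(\<lambda>n. conv_power a n \<gamma>) summable_on UNIV"
        using exp_nonzero[OF z(1)] by (simp add: f_def scaleC_scaleC scaleC_one)
      then have "((\<lambda>n. conv_power a n \<gamma>) has_sum b \<gamma>) UNIV"
        unfolding b_def by (rule has_sum_infsum)
      then show ?thesis unfolding f_def prod.case
        by (rule has_sum_bounded_linear[OF bounded_linear_scaleC])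
    qed
    have sum_b: "((\<lambda>\<gamma>. e \<gamma> z *\<^sub>C b \<gamma>) has_sum r z) UNIV"
      by (rule has_sum_SigmaD[OF f']) (use inner in simp)
    have "abs_conv b z"
    proof (rule abs_convI)
      have "((\<lambda>\<gamma>. \<Sum>\<^sub>\<infinity>n. norm (f (n, \<gamma>))) has_sum infsum (\<lambda>(\<gamma>, n). norm (f (n, \<gamma>))) (UNIV \<times> UNIV)) UNIV"
        by (rule has_sum_SigmaD[OF has_sum_infsum[OF nf']]) (use nf1 in \<open>simp add: has_sum_infsum\<close>)
      then show "(\<lambda>\<gamma>. \<Sum>\<^sub>\<infinity>n. norm (f (n, \<gamma>))) summable_on UNIV" by (rule has_sum_imp_summable)
      show "cmod (e \<gamma> z) * norm (b \<gamma>) \<le> (\<Sum>\<^sub>\<infinity>n. norm (f (n, \<gamma>)))" for \<gamma>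
        unfolding norm_scaleC[symmetric] by (rule norm_has_sum_bound[OF has_sum_infsum[OF nf1] inner])
    qed
    with sum_b has_sum_imp_sums[OF r] show ?thesis by simp
  qed
  have ev: "\<forall>\<^sub>F z in F. abs_conv b z \<and> ((\<lambda>\<gamma>. e \<gamma> z *\<^sub>C b \<gamma>) has_sum r z) UNIV \<and> (\<lambda>n. q z ^ n) sums r z"
    using germ_ev[OF q] eventually_isexp small
    by eventually_elim (rule key, simp_all)
  have "germ r b"
    unfolding germ_def using adm_subset[OF adm_S hsupp_b] ev by (auto elim: eventually_mono)
  moreover have "hsupp b \<subseteq> {0..}" using hsupp_b all_sums_nonneg[OF pos'] by (rule order_trans)
  moreover have "\<forall>\<^sub>F z in F. r z * (1 - q z) = 1 \<and> (1 - q z) * r z = 1"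
    using ev by eventually_elim (rule geometric_inverse, elim conjE)
  ultimately show ?thesis by blast
qed

text \<open>The constant term is split off first: with \<open>N\<close> the inverse of
  \<open>1 - a 0\<close>, one has \<open>1 - q = (1 - a 0) * (1 - N * (q - a 0))\<close>, and the
  second factor falls under \<open>germ_neumann\<close>.\<close>

lemma germ_neumann':
  fixes q :: "'z \<Rightarrow> 'a::{complex_banach_algebra, monoid_mult}"
  assumes q: "germ q a" and supp: "hsupp a \<subseteq> {0..}" and small: "norm (a 0) < 1"
  shows "\<exists>r b. germ r b \<and> hsupp b \<subseteq> {0..} \<and> (\<forall>\<^sub>F z in F. r z * (1 - q z) = 1 \<and> (1 - q z) * r z = 1)"
proof -
  obtain N where N: "N * (1 - a 0) = 1" "(1 - a 0) * N = 1"
    using banach_geometric_inverse[OF small] by blast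
  let ?a = "\<lambda>\<gamma>. N * (a \<gamma> - (if \<gamma> = 0 then a 0 else 0))"
  have g: "germ (\<lambda>z. N * (q z - a 0)) ?a"
    by (rule germ_linear[OF germ_diff[OF q germ_const] bounded_linear_mult_right mult_scaleC_right])
  have gt: "0 < \<gamma>" if "?a \<gamma> \<noteq> 0" for \<gamma>
  proof (cases "\<gamma> = 0")
    case True
    then show ?thesis using that by simp
  next
    case False
    then have "\<gamma> \<in> hsupp a" using that unfolding in_hsupp by (metis diff_zero mult_zero_right)
    then show ?thesis using supp False by (metis atLeast_iff order_le_less subsetD)
  qed
  have pos: "hsupp ?a \<subseteq> {0<..}"
    by (rule subsetI) (simp only: in_hsupp greaterThan_iff, rule gt)
  from germ_neumann[OF g pos] obtain r where "\<exists>b. germ r b \<and> hsupp b \<subseteq> {0..} \<and>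
    (\<forall>\<^sub>F z in F. r z * (1 - N * (q z - a 0)) = 1 \<and> (1 - N * (q z - a 0)) * r z = 1)" ..
  then obtain b where "germ r b \<and> hsupp b \<subseteq> {0..} \<and>
    (\<forall>\<^sub>F z in F. r z * (1 - N * (q z - a 0)) = 1 \<and> (1 - N * (q z - a 0)) * r z = 1)" ..
  then have r: "germ r b" "hsupp b \<subseteq> {0..}"
    "\<forall>\<^sub>F z in F. r z * (1 - N * (q z - a 0)) = 1 \<and> (1 - N * (q z - a 0)) * r z = 1"
    by simp_all
  have "germ (\<lambda>z. r z * N) (\<lambda>\<gamma>. b \<gamma> * N)"
    by (rule germ_linear[OF r(1) bounded_linear_mult_left]) (rule mult_scaleC_left)
  moreover have "hsupp (\<lambda>\<gamma>. b \<gamma> * N) \<subseteq> hsupp b"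
    unfolding hsupp_def by (intro Collect_mono) (metis mult_zero_left)
  then have "hsupp (\<lambda>\<gamma>. b \<gamma> * N) \<subseteq> {0..}" using r(2) by (rule order_trans)
  moreover have "\<forall>\<^sub>F z in F. r z * N * (1 - q z) = 1 \<and> (1 - q z) * (r z * N) = 1"
    using r(3)
  proof eventually_elim
    case (elim z)
    have eq: "1 - q z = (1 - a 0) * (1 - N * (q z - a 0))"
      by (simp add: right_diff_distrib N(2) mult.assoc[symmetric])
    have "r z * N * (1 - q z) = r z * (N * (1 - a 0)) * (1 - N * (q z - a 0))"
      unfolding eq by (simp add: mult.assoc)
    also have "\<dots> = 1" using elim N by simp
    finally have "r z * N * (1 - q z) = 1" .
    moreover have "(1 - q z) * (r z * N) = (1 - a 0) * ((1 - N * (q z - a 0)) * r z) * N"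
      unfolding eq by (simp add: mult.assoc)
    then have "(1 - q z) * (r z * N) = 1" using elim N by simp
    ultimately show ?case by blast
  qed
  ultimately show ?thesis by blast
qed

text \<open>Normalise by the leading term \<open>a m\<close> times \<open>e m\<close>. What is left
  is \<open>1\<close> minus a germ with positive exponents, and its Neumann series is multiplied
  back by the inverse of the leading term.\<close>

lemma germ_inverse:
  fixes h :: "'z \<Rightarrow> complex"
  assumes h: "germ h a" and ne: "hsupp a \<noteq> {}"
  shows "\<exists>b. germ (\<lambda>z. inverse (h z)) b"
proof -
  obtain m where m: "a m \<noteq> 0" "hsupp a \<subseteq> {m..}" using germ_min[OF h ne] by blast
  define c where "c = inverse (a m)"
  have g: "germ (\<lambda>z. c * (e (- m) z *\<^sub>C h z)) (\<lambda>\<gamma>. c * a (\<gamma> - - m))"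
    by (rule germ_linear[OF germ_shift[OF h] bounded_linear_mult_right]) (rule mult_scaleC_right)
  let ?b = "\<lambda>\<gamma>. (if \<gamma> = 0 then 1 else 0) - c * a (\<gamma> - - m)"
  have q: "germ (\<lambda>z. 1 - c * (e (- m) z *\<^sub>C h z)) ?b"
    by (rule germ_diff[OF germ_const g])
  have pos: "0 < \<gamma>" if "?b \<gamma> \<noteq> 0" for \<gamma>
  proof (cases "\<gamma> = 0")
    case True
    then show ?thesis using that m(1) by (simp add: c_def)
  next
    case False
    then have "\<gamma> + m \<in> hsupp a" using that by (auto simp: hsupp_def)
    then have "m \<le> \<gamma> + m" using m(2) by auto
    then show ?thesis using False by simp
  qed
  have supp: "hsupp ?b \<subseteq> {0<..}"
    by (rule subsetI) (simp only: in_hsupp greaterThan_iff, rule pos)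
  from germ_neumann[OF q supp] obtain r where "\<exists>b. germ r b \<and> hsupp b \<subseteq> {0..} \<and>
      (\<forall>\<^sub>F z in F. r z * (1 - (1 - c * (e (- m) z *\<^sub>C h z))) = 1 \<and>
      (1 - (1 - c * (e (- m) z *\<^sub>C h z))) * r z = 1)" ..
  then obtain b where "germ r b \<and> hsupp b \<subseteq> {0..} \<and>
      (\<forall>\<^sub>F z in F. r z * (1 - (1 - c * (e (- m) z *\<^sub>C h z))) = 1 \<and>
      (1 - (1 - c * (e (- m) z *\<^sub>C h z))) * r z = 1)" ..
  then have r: "germ r b" "\<forall>\<^sub>F z in F. r z * (1 - (1 - c * (e (- m) z *\<^sub>C h z))) = 1 \<and>
      (1 - (1 - c * (e (- m) z *\<^sub>C h z))) * r z = 1"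
    by blast+
  have "germ (\<lambda>z. c * (e (- m) z *\<^sub>C r z)) (\<lambda>\<gamma>. c * b (\<gamma> - - m))"
    by (rule germ_linear[OF germ_shift[OF r(1)] bounded_linear_mult_right]) (rule mult_scaleC_right)
  then have "germ (\<lambda>z. inverse (h z)) (\<lambda>\<gamma>. c * b (\<gamma> - - m))"
  proof (rule germ_cong)
    show "\<forall>\<^sub>F z in F. c * (e (- m) z *\<^sub>C r z) = inverse (h z)"
      using r(2)
    proof eventually_elim
      case (elim z)
      then have "(c * (e (- m) z * r z)) * h z = 1" by (simp add: scaleC_complex_def mult_ac)
      then show ?case by (simp add: scaleC_complex_def inverse_unique mult.commute[of _ "h z"])
    qed
  qed
  then show ?thesis by blast
qed

end

section \<open>Operators on a Hilbert space\<close>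

lemma cinner_zero_right [simp]: "cinner x 0 = 0"
  using cinner_scaleC_right[of x 0 0] by simp

lemma cinner_zero_left [simp]: "cinner 0 x = 0"
  by (subst cinner_commute) simp

lemma cinner_scaleC_left: "cinner (c *\<^sub>C x) y = cnj c * cinner x y"
  by (subst cinner_commute, subst (2) cinner_commute) (simp add: cinner_scaleC_right)

lemma cinner_add_left: "cinner (x + y) z = cinner x z + cinner y z"
  by (subst cinner_commute, subst (2) cinner_commute, subst (3) cinner_commute) (simp add: cinner_add_right)

lemma cinner_minus_right: "cinner x (- y) = - cinner x y"
  using cinner_scaleC_right[of x "-1" y] by (simp add: complex_vector.scale_minus_left scaleC_one)

lemma cinner_diff_right: "cinner x (y - z) = cinner x y - cinner x z"
  using cinner_add_right[of x y "- z"] by (simp add: cinner_minus_right)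

lemma cinner_sum_right: "cinner x (\<Sum>i\<in>I. f i) = (\<Sum>i\<in>I. cinner x (f i))"
  by (induction I rule: infinite_finite_induct) (simp_all add: cinner_add_right)

lemma cinner_sum_left: "cinner (\<Sum>i\<in>I. f i) x = (\<Sum>i\<in>I. cinner (f i) x)"
  by (induction I rule: infinite_finite_induct) (simp_all add: cinner_add_left)

lemma pythagoras:
  assumes "cinner x y = 0"
  shows "(norm (x + y))\<^sup>2 = (norm x)\<^sup>2 + (norm y)\<^sup>2"
proof -
  have "cinner y x = 0" using assms by (subst cinner_commute) simp
  then have "cinner (x + y) (x + y) = cinner x x + cinner y y"
    using assms by (simp add: cinner_add_right cinner_add_left)
  then have "complex_of_real ((norm (x + y))\<^sup>2) = complex_of_real ((norm x)\<^sup>2 + (norm y)\<^sup>2)"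
    by (simp only: cinner_self of_real_add)
  then show ?thesis by (simp only: of_real_eq_iff)
qed

lemma cinner_cauchy_schwarz: "cmod (cinner x y) \<le> norm x * norm y"
proof (cases "x = 0")
  case False
  \<comment> \<open>\<open>t *\<^sub>C x\<close> is the orthogonal projection of \<open>y\<close>
    onto the line through \<open>x\<close>.\<close>
  define t where "t = cinner x y / (norm x)\<^sup>2"
  have "cinner (t *\<^sub>C x) (y - t *\<^sub>C x) = cnj t * (cinner x y - t * cinner x x)"
    by (simp add: cinner_scaleC_left cinner_diff_right cinner_scaleC_right algebra_simps)
  also have "t * cinner x x = cinner x y" using False by (simp add: cinner_self t_def)
  finally have orth: "cinner (t *\<^sub>C x) (y - t *\<^sub>C x) = 0" by simp
  have "(norm y)\<^sup>2 = (norm (t *\<^sub>C x))\<^sup>2 + (norm (y - t *\<^sub>C x))\<^sup>2"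
    using pythagoras[OF orth] by simp
  then have "(norm (t *\<^sub>C x))\<^sup>2 \<le> (norm y)\<^sup>2" by simp
  then have "norm (t *\<^sub>C x) \<le> norm y" by (rule power2_le_imp_le) simp
  then have "cmod (cinner x y) / norm x \<le> norm y"
    using False by (simp add: norm_scaleC t_def norm_divide power2_eq_square norm_mult)
  then show ?thesis using False by (simp add: field_simps)
qed simp

lemma cinner_eqI:
  assumes "\<And>y. cinner y x = cinner y x'"
  shows "x = x'"
proof -
  have "cinner (x - x') (x - x') = 0" using assms by (simp add: cinner_diff_right)
  then show ?thesis by (simp add: cinner_self)
qed

lemma bounded_linear_cinner: "bounded_linear (cinner x)"
proof (rule bounded_linear_intro[where K = "norm x"])
  show "cinner x (y + z) = cinner x y + cinner x z" for y z by (rule cinner_add_right)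
  show "cinner x (r *\<^sub>R y) = r *\<^sub>R cinner x y" for r y
    by (simp add: scaleR_scaleC cinner_scaleC_right scaleC_complex_def)
  show "norm (cinner x y) \<le> norm y * norm x" for y
    using cinner_cauchy_schwarz[of x y] by (simp add: mult.commute)
qed

section \<open>Evaluation of operators and their matrix coefficients\<close>

lemma bop_apply_Bop:
  fixes f :: "'a::complex_normed_vector \<Rightarrow> 'a"
  assumes "bounded_linear f" "\<And>c x. f (c *\<^sub>C x) = c *\<^sub>C f x"
  shows "bop_apply (Bop (Blinfun f)) = f"
  using assms by (simp add: bop_apply.rep_eq Bop_inverse bounded_linear_Blinfun_apply)

lemma bounded_linear_bop_apply: "bounded_linear (bop_apply T)"
  by transfer (rule blinfun.bounded_linear_right)

lemma norm_bop_apply: "norm (bop_apply T x) \<le> norm T * norm x"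
  by transfer (rule norm_blinfun)

lemma norm_bop_bound: "0 \<le> c \<Longrightarrow> (\<And>x. norm (bop_apply T x) \<le> c * norm x) \<Longrightarrow> norm T \<le> c"
  by transfer (rule norm_blinfun_bound)

lemma bop_apply_zero_right [simp]: "bop_apply T 0 = 0"
  by (rule linear_0[OF bounded_linear.linear[OF bounded_linear_bop_apply]])

lemma bop_apply_zero [simp]: "bop_apply 0 x = 0"
  by transfer simp

lemma bop_apply_one [simp]: "bop_apply 1 x = x"
  by transfer simp

lemma bop_apply_diff: "bop_apply (S - T) x = bop_apply S x - bop_apply T x"
  by transfer (rule blinfun.diff_left)

lemma bop_apply_diff_right: "bop_apply T (x - y) = bop_apply T x - bop_apply T y"
  by transfer (rule blinfun.diff_right)

lemma bop_apply_sum: "bop_apply (\<Sum>i\<in>I. T i) x = (\<Sum>i\<in>I. bop_apply (T i) x)"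
  by (induction I rule: infinite_finite_induct) (simp_all add: bop_apply_add)

lemma bop_apply_sum_right: "bop_apply T (\<Sum>i\<in>I. f i) = (\<Sum>i\<in>I. bop_apply T (f i))"
  by (induction I rule: infinite_finite_induct) (simp_all add: bop_apply_add_right)

lemma bounded_linear_bop_apply_left: "bounded_linear (\<lambda>T. bop_apply T x)"
  by (rule bounded_linear_intro[where K = "norm x"])
    (simp_all add: bop_apply_add bop_apply_scaleR norm_bop_apply)

text \<open>These bounded functionals separate operators, so questions about operators reduce to
  scalar ones: the entries of a corner, and holomorphy in the plane.\<close>

definition matrix_coeff :: "'a::complex_hilbert_space \<Rightarrow> 'a \<Rightarrow> 'a bop \<Rightarrow> complex" where
  "matrix_coeff x y T = cinner x (bop_apply T y)"

lemma bounded_linear_matrix_coeff: "bounded_linear (matrix_coeff x y)"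
  unfolding matrix_coeff_def
  by (rule bounded_linear_compose[OF bounded_linear_cinner bounded_linear_bop_apply_left])

lemma matrix_coeff_scaleC: "matrix_coeff x y (c *\<^sub>C T) = c *\<^sub>C matrix_coeff x y T"
  by (simp add: matrix_coeff_def bop_apply_scaleC cinner_scaleC_right scaleC_complex_def)

lemma bop_eq_matrix_coeffI: "(\<And>x y. matrix_coeff x y S = matrix_coeff x y T) \<Longrightarrow> S = T"
  by (rule bop_eqI, rule cinner_eqI) (simp add: matrix_coeff_def)

subsection \<open>Finite rank operators and orthogonal projections\<close>

text \<open>\<open>finite_rank\<close> demands that the range be equal to a finite span. Containment
  suffices: the range is a subspace, hence the span of a maximal independent subset, whose size is
  bounded by that of \<open>B\<close>.\<close>

lemma finite_rank_iff: "finite_rank T \<longleftrightarrow> (\<exists>B. finite B \<and> range (bop_apply T) \<subseteq> cspan B)"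
proof
  assume "finite_rank T"
  then show "\<exists>B. finite B \<and> range (bop_apply T) \<subseteq> cspan B"
    unfolding finite_rank_def fin_dim_csubspace_def by auto
next
  assume "\<exists>B. finite B \<and> range (bop_apply T) \<subseteq> cspan B"
  then obtain B where B: "finite B" "range (bop_apply T) \<subseteq> cspan B" by blast
  let ?V = "range (bop_apply T)"
  have sub: "complex_vector.subspace ?V"
    unfolding complex_vector.subspace_def
  proof (intro conjI ballI allI)
    show "0 \<in> ?V" by (rule range_eqI[of _ _ 0]) simp
    show "x + y \<in> ?V" if "x \<in> ?V" "y \<in> ?V" for x y
      using that by (auto simp flip: bop_apply_add_right)
    show "c *\<^sub>C x \<in> ?V" if "x \<in> ?V" for c x
      using that by (auto simp flip: bop_apply_scaleC_right)
  qed
  obtain C where C: "C \<subseteq> ?V" "complex_vector.independent C" "?V \<subseteq> cspan C"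
    using complex_vector.maximal_independent_subset[of ?V] unfolding cspan_raw_def by blast
  have "finite C"
    using complex_vector.independent_span_bound[OF B(1) C(2)] C(1) B(2) unfolding cspan_raw_def by blast
  moreover have "?V = cspan C"
    using C(3) complex_vector.span_minimal[OF C(1) sub] unfolding cspan_raw_def by blast
  ultimately show "finite_rank T" unfolding finite_rank_def fin_dim_csubspace_def by blast
qed

lemma finite_rank_zero [simp]: "finite_rank 0"
  unfolding finite_rank_iff by (rule exI[of _ "{0}"]) (auto intro: complex_vector.span_base)

lemma finite_rank_add:
  assumes "finite_rank S" "finite_rank T"
  shows "finite_rank (S + T)"
proof -
  obtain B C where "finite B" "range (bop_apply S) \<subseteq> cspan B" "finite C" "range (bop_apply T) \<subseteq> cspan C"
    using assms unfolding finite_rank_iff by blast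
  then have "finite (B \<union> C)" "bop_apply S x + bop_apply T x \<in> cspan (B \<union> C)" for x
    using complex_vector.span_mono[of B "B \<union> C"] complex_vector.span_mono[of C "B \<union> C"]
    by (auto intro!: complex_vector.span_add)
  then show ?thesis unfolding finite_rank_iff bop_apply_add by blast
qed

lemma finite_rank_sum: "(\<And>i. i \<in> I \<Longrightarrow> finite_rank (T i)) \<Longrightarrow> finite_rank (\<Sum>i\<in>I. T i)"
  by (induction I rule: infinite_finite_induct) (auto intro: finite_rank_add)

lemma finite_rank_mult_right: "finite_rank S \<Longrightarrow> finite_rank (S * T)"
  unfolding finite_rank_iff by (auto simp: bop_apply_times)

lemma finite_rank_mult_left:
  assumes "finite_rank T"
  shows "finite_rank (S * T)"
proof -
  obtain B where B: "finite B" "range (bop_apply T) \<subseteq> cspan B" using assms unfolding finite_rank_iff by blast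
  have "bop_apply S x \<in> cspan (bop_apply S ` B)" if "x \<in> cspan B" for x
    using that
  proof (induction rule: complex_vector.span_induct_alt)
    case base
    then show ?case by (simp add: complex_vector.span_zero)
  next
    case (step c x y)
    show ?case
      unfolding bop_apply_add_right bop_apply_scaleC_right
      by (rule complex_vector.span_add, rule complex_vector.span_scale, rule complex_vector.span_base)
        (use step in simp_all)
  qed
  then show ?thesis unfolding finite_rank_iff bop_apply_times
    using B by (intro exI[of _ "bop_apply S ` B"]) auto
qed

definition rank_one :: "'a::complex_hilbert_space \<Rightarrow> 'a \<Rightarrow> 'a bop" where
  "rank_one u v = Bop (Blinfun (\<lambda>x. cinner v x *\<^sub>C u))"

lemma bop_apply_rank_one: "bop_apply (rank_one u v) x = cinner v x *\<^sub>C u"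
proof -
  have "bounded_linear (\<lambda>x. cinner v x *\<^sub>C u)"
    by (rule bounded_linear_compose[OF bounded_bilinear.bounded_linear_left[OF bounded_bilinear_scaleC]
          bounded_linear_cinner])
  then show ?thesis
    unfolding rank_one_def by (subst bop_apply_Bop) (simp_all add: cinner_scaleC_right scaleC_scaleC)
qed

lemma finite_rank_rank_one: "finite_rank (rank_one u v)"
proof -
  have "cinner v x *\<^sub>C u \<in> cspan {u}" for x
    by (rule complex_vector.span_scale, rule complex_vector.span_base) simp
  then show ?thesis unfolding finite_rank_iff by (intro exI[of _ "{u}"]) (auto simp: bop_apply_rank_one)
qed

definition orthonormal :: "(nat \<Rightarrow> 'a::complex_hilbert_space) \<Rightarrow> nat \<Rightarrow> bool" where
  "orthonormal u n \<longleftrightarrow> (\<forall>i<n. \<forall>j<n. cinner (u i) (u j) = (if i = j then 1 else 0))"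

definition proj :: "(nat \<Rightarrow> 'a::complex_hilbert_space) \<Rightarrow> nat \<Rightarrow> 'a bop" where
  "proj u n = (\<Sum>i<n. rank_one (u i) (u i))"

lemma bop_apply_proj: "bop_apply (proj u n) x = (\<Sum>i<n. cinner (u i) x *\<^sub>C u i)"
  by (simp add: proj_def bop_apply_sum bop_apply_rank_one)

lemma finite_rank_proj: "finite_rank (proj u n)"
  unfolding proj_def by (intro finite_rank_sum finite_rank_rank_one)

lemma cinner_proj:
  assumes "orthonormal u n" "i < n"
  shows "cinner (u i) (bop_apply (proj u n) x) = cinner (u i) x"
proof -
  have "cinner (u i) (bop_apply (proj u n) x) = (\<Sum>j<n. if j = i then cinner (u j) x else 0)"
    unfolding bop_apply_proj cinner_sum_right
    by (rule sum.cong) (use assms in \<open>auto simp: cinner_scaleC_right orthonormal_def\<close>)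
  then show ?thesis using assms by simp
qed

lemma proj_basis:
  assumes "orthonormal u n" "i < n"
  shows "bop_apply (proj u n) (u i) = u i"
proof -
  have "bop_apply (proj u n) (u i) = (\<Sum>j<n. if j = i then u j else 0)"
    unfolding bop_apply_proj
    by (rule sum.cong) (use assms in \<open>auto simp: scaleC_one orthonormal_def\<close>)
  then show ?thesis using assms by simp
qed

lemma proj_idem:
  assumes "orthonormal u n"
  shows "proj u n * proj u n = proj u n"
proof (rule bop_eqI)
  fix x
  show "bop_apply (proj u n * proj u n) x = bop_apply (proj u n) x"
    unfolding bop_apply_times
    by (subst bop_apply_proj, subst (2) bop_apply_proj) (simp add: cinner_proj[OF assms])
qed

lemma norm_minus_proj:
  assumes "orthonormal u n"
  shows "norm (x - bop_apply (proj u n) x) \<le> norm x"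
proof -
  let ?P = "bop_apply (proj u n)"
  have "cinner (?P x) (x - ?P x) = 0"
    by (subst bop_apply_proj)
      (simp add: cinner_sum_left cinner_scaleC_left cinner_diff_right cinner_proj[OF assms])
  from pythagoras[OF this] have "(norm (x - ?P x))\<^sup>2 \<le> (norm x)\<^sup>2" by simp
  then show ?thesis by (rule power2_le_imp_le) simp
qed

lemma gram_schmidt:
  assumes "finite B"
  shows "\<exists>u n. orthonormal u n \<and> (\<forall>b\<in>B. bop_apply (proj u n) b = b)"
  using assms
proof (induction B rule: finite_induct)
  case empty
  then show ?case by (intro exI[of _ "\<lambda>_. 0"] exI[of _ 0]) (simp add: orthonormal_def)
next
  case (insert b B)
  then obtain u n where u: "orthonormal u n" "\<forall>b\<in>B. bop_apply (proj u n) b = b" by blast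
  define v where "v = b - bop_apply (proj u n) b"
  show ?case
  proof (cases "v = 0")
    case True
    then show ?thesis using u by (intro exI[of _ u] exI[of _ n]) (simp add: v_def)
  next
    case False
    define w where "w = complex_of_real (inverse (norm v)) *\<^sub>C v"
    define u' where "u' = u(n := w)"
    have uv: "cinner (u i) v = 0" if "i < n" for i
      using cinner_proj[OF u(1) that, of b] by (simp add: v_def cinner_diff_right)
    have uw: "cinner (u i) w = 0" "cinner w (u i) = 0" if "i < n" for i
      using uv[OF that] by (simp add: w_def cinner_scaleC_right)
        (subst cinner_commute, simp add: uv[OF that] w_def cinner_scaleC_right)
    have "cinner w w = complex_of_real (inverse (norm v)) * (complex_of_real (inverse (norm v)) * cinner v v)"
      by (simp add: w_def cinner_scaleC_left cinner_scaleC_right)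
    also have "\<dots> = 1"
      using False by (simp add: cinner_self power2_eq_square field_simps)
    finally have ww: "cinner w w = 1" .
    have on: "orthonormal u' (Suc n)"
      using u(1) uw ww by (auto simp: orthonormal_def u'_def less_Suc_eq)
    have app: "bop_apply (proj u' (Suc n)) x = bop_apply (proj u n) x + cinner w x *\<^sub>C w" for x
      unfolding bop_apply_proj by (simp add: u'_def)
    have perp: "cinner w (bop_apply (proj u n) x) = 0" for x
      by (simp add: bop_apply_proj cinner_sum_right cinner_scaleC_right uw)
    have "bop_apply (proj u' (Suc n)) c = c" if "c \<in> B" for c
      using u(2) that perp[of c] by (simp add: app)
    moreover have "bop_apply (proj u' (Suc n)) b = b"
    proof -
      have "cinner w b = cinner w v" using perp[of b] by (simp add: v_def cinner_diff_right)
      also have "\<dots> = complex_of_real (norm v)"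
        using False by (simp add: w_def cinner_scaleC_left cinner_self power2_eq_square)
      finally have "cinner w b *\<^sub>C w = v"
        using False by (simp add: w_def scaleC_scaleC scaleC_one)
      then show ?thesis by (simp add: app v_def)
    qed
    ultimately show ?thesis using on by blast
  qed
qed

text \<open>The image of the unit ball has a finite \<open>\<epsilon>\<close>-net. Project onto the
  span of the net together with generators of \<open>H0\<close>: the complementary projection
  annihilates the net and does not increase norms.\<close>

lemma compact_op_approx:
  assumes T: "T \<in> compact_ops" and H0: "fin_dim_csubspace H0" and \<epsilon>: "0 < \<epsilon>"
  shows "\<exists>u n. orthonormal u n \<and> (\<forall>v\<in>H0. bop_apply (proj u n) v = v) \<and> norm ((1 - proj u n) * T) \<le> \<epsilon>"
proof -
  have "compact (closure (bop_apply T ` cball 0 1))" using T by (simp add: compact_ops_def)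
  then obtain k where k: "finite k" "closure (bop_apply T ` cball 0 1) \<subseteq> (\<Union>x\<in>k. ball x \<epsilon>)"
    using \<epsilon> unfolding compact_eq_totally_bounded by blast
  obtain B where B: "finite B" "H0 = cspan B" using H0 unfolding fin_dim_csubspace_def by blast
  obtain u n where u: "orthonormal u n" "\<forall>b\<in>k \<union> B. bop_apply (proj u n) b = b"
    using gram_schmidt[of "k \<union> B"] k(1) B(1) by blast
  have fix_H0: "bop_apply (proj u n) v = v" if "v \<in> H0" for v
    using that unfolding B(2)
  proof (induction rule: complex_vector.span_induct_alt)
    case base
    then show ?case by simp
  next
    case (step c x y)
    then show ?case using u(2) by (simp add: bop_apply_add_right bop_apply_scaleC_right)
  qed
  have unit: "norm (bop_apply ((1 - proj u n) * T) x) \<le> \<epsilon>" if "norm x \<le> 1" for x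
  proof -
    have "bop_apply T x \<in> closure (bop_apply T ` cball 0 1)"
      using that by (intro subsetD[OF closure_subset]) auto
    then obtain y where y: "y \<in> k" "dist y (bop_apply T x) < \<epsilon>" using k(2) by auto
    \<comment> \<open>The net point \<open>y\<close> is fixed by the projection, so it may be
      subtracted from \<open>T x\<close> at no cost.\<close>
    have "bop_apply ((1 - proj u n) * T) x = (bop_apply T x - y) - bop_apply (proj u n) (bop_apply T x - y)"
      using u(2) y(1) by (simp add: bop_apply_times bop_apply_diff bop_apply_diff_right)
    also have "norm \<dots> \<le> norm (bop_apply T x - y)" by (rule norm_minus_proj[OF u(1)])
    also have "\<dots> \<le> \<epsilon>" using y(2) by (simp add: dist_norm norm_minus_commute)
    finally show ?thesis .
  qed
  have "norm ((1 - proj u n) * T) \<le> \<epsilon>"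
  proof (rule norm_bop_bound)
    fix x
    let ?S = "(1 - proj u n) * T"
    show "norm (bop_apply ?S x) \<le> \<epsilon> * norm x"
    proof (cases "x = 0")
      case False
      have "norm (bop_apply ?S (inverse (norm x) *\<^sub>R x)) \<le> \<epsilon>" using False by (intro unit) simp
      then show ?thesis using False by (simp add: bop_apply_scaleR_right field_simps)
    qed simp
  qed (use \<epsilon> in simp)
  then show ?thesis using u(1) fix_H0 by blast
qed

subsection \<open>Inversion of finite rank perturbations of the identity\<close>

text \<open>For orthonormal \<open>u\<close>, the operator with matrix \<open>A\<close> on the span
  of the first \<open>n\<close> vectors and zero on the orthogonal complement; composition then
  becomes matrix multiplication.\<close>

definition corner_op :: "(nat \<Rightarrow> 'a::complex_hilbert_space) \<Rightarrow> nat \<Rightarrow> (nat \<Rightarrow> nat \<Rightarrow> complex) \<Rightarrow> 'a bop" where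
  "corner_op u n A = (\<Sum>i<n. \<Sum>j<n. A i j *\<^sub>C rank_one (u i) (u j))"

lemma corner_op_apply:
  "bop_apply (corner_op u n A) x = (\<Sum>i<n. \<Sum>j<n. (A i j * cinner (u j) x) *\<^sub>C u i)"
  by (simp add: corner_op_def bop_apply_sum bop_apply_scaleC bop_apply_rank_one scaleC_scaleC)

lemma corner_op_cong: "(\<And>i j. i < n \<Longrightarrow> j < n \<Longrightarrow> A i j = B i j) \<Longrightarrow> corner_op u n A = corner_op u n B"
  unfolding corner_op_def by (intro sum.cong) auto

lemma corner_op_one: "corner_op u n (\<lambda>i j. if i = j then 1 else 0) = proj u n"
proof -
  have "(\<Sum>j<n. (if i = j then 1 else 0) *\<^sub>C rank_one (u i) (u j)) = rank_one (u i) (u i)" if "i < n" for i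
  proof -
    have "(\<Sum>j<n. (if i = j then 1 else 0) *\<^sub>C rank_one (u i) (u j)) =
        (\<Sum>j<n. if i = j then rank_one (u i) (u j) else 0)"
      by (rule sum.cong) (auto simp: scaleC_one)
    then show ?thesis using that by simp
  qed
  then show ?thesis unfolding corner_op_def proj_def by (intro sum.cong) auto
qed

lemma corner_op_coeff:
  assumes "orthonormal u n" "i < n" "j < n"
  shows "matrix_coeff (u i) (u j) (corner_op u n A) = A i j"
proof -
  have "matrix_coeff (u i) (u j) (corner_op u n A) =
      (\<Sum>k<n. \<Sum>l<n. A k l * cinner (u l) (u j) * cinner (u i) (u k))"
    by (simp add: matrix_coeff_def corner_op_apply cinner_sum_right cinner_scaleC_right)
  also have "\<dots> = (\<Sum>k<n. \<Sum>l<n. if l = j then (if k = i then A k l else 0) else 0)"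
    by (intro sum.cong refl) (use assms in \<open>auto simp: orthonormal_def\<close>)
  also have "\<dots> = A i j" using assms by simp
  finally show ?thesis .
qed

lemma proj_corner:
  "proj u n * T * proj u n = corner_op u n (\<lambda>i j. matrix_coeff (u i) (u j) T)"
proof (rule bop_eqI)
  fix x
  have "bop_apply (proj u n * T * proj u n) x =
      (\<Sum>j<n. \<Sum>i<n. (cinner (u j) x * cinner (u i) (bop_apply T (u j))) *\<^sub>C u i)"
    by (simp add: bop_apply_times bop_apply_proj[of u n x] bop_apply_sum_right bop_apply_scaleC_right)
      (simp add: bop_apply_proj complex_vector.scale_sum_right scaleC_scaleC)
  also have "\<dots> = bop_apply (corner_op u n (\<lambda>i j. matrix_coeff (u i) (u j) T)) x"
    by (subst sum.swap) (simp add: corner_op_apply matrix_coeff_def mult.commute)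
  finally show "bop_apply (proj u n * T * proj u n) x =
      bop_apply (corner_op u n (\<lambda>i j. matrix_coeff (u i) (u j) T)) x" .
qed

lemma proj_mult_corner_op:
  assumes "orthonormal u n"
  shows "proj u n * corner_op u n A = corner_op u n A"
  by (rule bop_eqI)
    (simp add: bop_apply_times corner_op_apply bop_apply_sum_right bop_apply_scaleC_right proj_basis[OF assms])

lemma corner_op_mult_proj:
  assumes "orthonormal u n"
  shows "corner_op u n A * proj u n = corner_op u n A"
  by (rule bop_eqI) (simp add: bop_apply_times corner_op_apply cinner_proj[OF assms])

lemma corner_op_mult:
  assumes "orthonormal u n"
  shows "corner_op u n A * corner_op u n B = corner_op u n (\<lambda>i j. \<Sum>k<n. A i k * B k j)"
proof -
  have "matrix_coeff (u i) (u j) (corner_op u n A * corner_op u n B) = (\<Sum>k<n. A i k * B k j)"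
    if ij: "i < n" "j < n" for i j
  proof -
    have "bop_apply (corner_op u n B) (u j) = (\<Sum>k<n. B k j *\<^sub>C u k)"
    proof -
      have "bop_apply (corner_op u n B) (u j) = (\<Sum>k<n. \<Sum>l<n. if l = j then B k l *\<^sub>C u k else 0)"
        unfolding corner_op_apply
        by (intro sum.cong refl) (use assms ij in \<open>auto simp: orthonormal_def\<close>)
      then show ?thesis using ij by simp
    qed
    then have "matrix_coeff (u i) (u j) (corner_op u n A * corner_op u n B) =
        (\<Sum>k<n. B k j * matrix_coeff (u i) (u k) (corner_op u n A))"
      by (simp add: matrix_coeff_def bop_apply_times bop_apply_sum_right bop_apply_scaleC_right
          cinner_sum_right cinner_scaleC_right)
    also have "\<dots> = (\<Sum>k<n. A i k * B k j)"
      by (intro sum.cong) (use assms ij in \<open>auto simp: corner_op_coeff\<close>)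
    finally show ?thesis .
  qed
  then have "proj u n * (corner_op u n A * corner_op u n B) * proj u n =
      corner_op u n (\<lambda>i j. \<Sum>k<n. A i k * B k j)"
    unfolding proj_corner by (intro corner_op_cong) auto
  moreover have "proj u n * (corner_op u n A * corner_op u n B) * proj u n = corner_op u n A * corner_op u n B"
    by (metis assms corner_op_mult_proj mult.assoc proj_mult_corner_op)
  ultimately show ?thesis by simp
qed

text \<open>Relative to \<open>P\<close>, the operator \<open>1 - P * M\<close> is block triangular:
  its diagonal blocks are the corner \<open>P - P * M * P\<close> and the identity. Inverting such a
  block matrix with \<open>D\<close> the inverse of the corner gives
  \<open>1 + D * M\<close>.\<close>

lemma corner_inverse:
  fixes P M D :: "'a::{complex_banach_algebra, monoid_mult}"
  assumes P: "P * P = P" and D: "P * D = D" "D * P = D"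
    and inv: "D * (P - P * M * P) = P" "(P - P * M * P) * D = P"
  shows "(1 + D * M) * (1 - P * M) = 1" "(1 - P * M) * (1 + D * M) = 1"
proof -
  have "D - D * M * P = P"
    using inv(1) by (simp add: right_diff_distrib D mult.assoc[symmetric])
  moreover have "D * M * P = D - (D - D * M * P)" by simp
  ultimately have 1: "D * M * P = D - P" by simp
  have "D - P * M * D = P"
    using inv(2) by (simp add: left_diff_distrib D mult.assoc)
  moreover have "P * M * D = D - (D - P * M * D)" by simp
  ultimately have 2: "P * M * D = D - P" by simp
  have e1: "(1 + D * M) * (1 - P * M) = 1 + D * M - P * M - (D * M * P) * M"
    by (simp add: algebra_simps mult.assoc)
  show "(1 + D * M) * (1 - P * M) = 1" unfolding e1 1 by (simp add: left_diff_distrib)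
  have e2: "(1 - P * M) * (1 + D * M) = 1 + D * M - P * M - (P * M * D) * M"
    by (simp add: algebra_simps mult.assoc)
  show "(1 - P * M) * (1 + D * M) = 1" unfolding e2 2 by (simp add: left_diff_distrib)
qed

text \<open>The converse for block triangular operators: the compression of the inverse is a right
  inverse of the corner, and this is enough to make the determinant non-zero.\<close>

lemma corner_of_inverse:
  fixes P M X :: "'a::{complex_banach_algebra, monoid_mult}"
  assumes P: "P * P = P" and X: "X * (1 - P * M) = 1" "(1 - P * M) * X = 1"
  shows "(P - P * M * P) * (P * X * P) = P"
proof -
  have PP: "P * (P * y) = P * y" for y by (simp add: mult.assoc[symmetric] P)
  have "X - P * M * X = 1" using X(2) by (simp add: left_diff_distrib)
  moreover have "P * M * X = X - (X - P * M * X)" by simp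
  ultimately have PMX: "P * M * X = X - 1" by simp
  have "P * (P * M * X) = P * M * X" by (simp add: mult.assoc PP)
  then have "P * X - P = X - 1" unfolding PMX by (simp add: right_diff_distrib)
  then have PX: "P * X = P - 1 + X" by (simp add: algebra_simps)
  have "(P - P * M * P) * (P * X * P) = P * ((1 - P * M) * (P * X) * P)"
    by (simp add: left_diff_distrib right_diff_distrib mult.assoc PP)
  also have "(1 - P * M) * (P * X) = (1 - P * M) * (P - 1) + 1"
    unfolding PX by (simp add: distrib_left X(2))
  also have "P * (((1 - P * M) * (P - 1) + 1) * P) = P * ((1 - P * M) * ((P - 1) * P)) + P * P"
    by (simp add: distrib_left distrib_right mult.assoc)
  also have "(P - 1) * P = 0" by (simp add: left_diff_distrib P)
  finally show ?thesis by (simp add: P)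
qed

section \<open>Determinants and adjugates of matrices with variable entries\<close>

definition mdet :: "nat \<Rightarrow> (nat \<Rightarrow> nat \<Rightarrow> complex) \<Rightarrow> complex" where
  "mdet n A = Determinant.det (mat n n (\<lambda>(i, j). A i j))"

definition madj :: "nat \<Rightarrow> (nat \<Rightarrow> nat \<Rightarrow> complex) \<Rightarrow> nat \<Rightarrow> nat \<Rightarrow> complex" where
  "madj n A i j = adj_mat (mat n n (\<lambda>(i, j). A i j)) $$ (i, j)"

text \<open>The adjugate is preferred to the inverse because its entries are polynomials in those of
  \<open>A\<close>; the only division ever made is by the determinant, a single scalar germ.\<close>

lemma madj_mult:
  assumes "i < n" "j < n"
  shows "(\<Sum>k<n. A i k * madj n A k j) = (if i = j then mdet n A else 0)"
    and "(\<Sum>k<n. madj n A i k * A k j) = (if i = j then mdet n A else 0)"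
proof -
  let ?A = "mat n n (\<lambda>(i, j). A i j)"
  have A: "?A \<in> carrier_mat n n" by simp
  note adj = adj_mat[OF A]
  have "(?A * adj_mat ?A) $$ (i, j) = (\<Sum>k<n. A i k * madj n A k j)"
    using assms adj(1) by (simp add: scalar_prod_def madj_def lessThan_atLeast0)
  moreover have "(?A * adj_mat ?A) $$ (i, j) = (if i = j then mdet n A else 0)"
    unfolding adj(2) using assms by (simp add: mdet_def)
  ultimately show "(\<Sum>k<n. A i k * madj n A k j) = (if i = j then mdet n A else 0)" by simp
  have "(adj_mat ?A * ?A) $$ (i, j) = (\<Sum>k<n. madj n A i k * A k j)"
    using assms adj(1) by (simp add: scalar_prod_def madj_def lessThan_atLeast0)
  moreover have "(adj_mat ?A * ?A) $$ (i, j) = (if i = j then mdet n A else 0)"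
    unfolding adj(3) using assms by (simp add: mdet_def)
  ultimately show "(\<Sum>k<n. madj n A i k * A k j) = (if i = j then mdet n A else 0)" by simp
qed

lemma mdet_nonzero:
  assumes "\<And>i j. i < n \<Longrightarrow> j < n \<Longrightarrow> (\<Sum>k<n. A i k * B k j) = (if i = j then 1 else 0)"
  shows "mdet n A \<noteq> 0"
proof -
  let ?A = "mat n n (\<lambda>(i, j). A i j)" and ?B = "mat n n (\<lambda>(i, j). B i j)"
  have "?A * ?B = 1\<^sub>m n"
    by (rule eq_matI) (use assms in \<open>simp_all add: scalar_prod_def lessThan_atLeast0\<close>)
  then have "Determinant.det ?A * Determinant.det ?B = 1"
    using det_mult[of ?A n ?B] by simp
  then show ?thesis by (auto simp: mdet_def)
qed

text \<open>By the Leibniz formula the determinant is a polynomial in the entries, so it stays in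
  any class \<open>G\<close> that contains the constants and is closed under sums and products. The
  class applied later is that of functions represented by a series.\<close>

lemma det_closed:
  fixes A :: "'z \<Rightarrow> complex mat"
  assumes add: "\<And>f g. G f \<Longrightarrow> G g \<Longrightarrow> G (\<lambda>z. f z + g z)"
    and mult: "\<And>f g. G f \<Longrightarrow> G g \<Longrightarrow> G (\<lambda>z. f z * g z)" and const: "\<And>c. G (\<lambda>z. c)"
    and A: "\<And>z. A z \<in> carrier_mat n n" "\<And>i j. i < n \<Longrightarrow> j < n \<Longrightarrow> G (\<lambda>z. A z $$ (i, j))"
  shows "G (\<lambda>z. Determinant.det (A z))"
proof -
  have prod: "G (\<lambda>z. \<Prod>i\<in>I. f i z)" if "\<And>i. i \<in> I \<Longrightarrow> G (f i)" for I :: "nat set" and f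
    using that by (induction I rule: infinite_finite_induct) (simp_all add: mult const)
  have sum: "G (\<lambda>z. \<Sum>i\<in>I. f i z)" if "\<And>i. i \<in> I \<Longrightarrow> G (f i)" for I :: "(nat \<Rightarrow> nat) set" and f
    using that by (induction I rule: infinite_finite_induct) (simp_all add: add const)
  have "p i < n" if "p permutes {0..<n}" "i < n" for p i
    using permutes_in_image[OF that(1), of i] that(2) by simp
  then have "G (\<lambda>z. \<Sum>p\<in>{p. p permutes {0..<n}}. signof p * (\<Prod>i = 0..<n. A z $$ (i, p i)))"
    by (intro sum mult const prod A(2)) auto
  then show ?thesis by (simp only: det_def'[OF A(1)])
qed

lemma mdet_closed:
  assumes add: "\<And>f g. G f \<Longrightarrow> G g \<Longrightarrow> G (\<lambda>z. f z + g z)"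
    and mult: "\<And>f g. G f \<Longrightarrow> G g \<Longrightarrow> G (\<lambda>z. f z * g z)" and const: "\<And>c. G (\<lambda>z. c)"
    and A: "\<And>i j. i < n \<Longrightarrow> j < n \<Longrightarrow> G (\<lambda>z. A z i j)"
  shows "G (\<lambda>z. mdet n (A z))"
  unfolding mdet_def by (rule det_closed[where n = n and G = G and A = "\<lambda>z. mat n n (\<lambda>(i, j). A z i j)", OF add mult const]) (use A in auto)

lemma madj_closed:
  assumes add: "\<And>f g. G f \<Longrightarrow> G g \<Longrightarrow> G (\<lambda>z. f z + g z)"
    and mult: "\<And>f g. G f \<Longrightarrow> G g \<Longrightarrow> G (\<lambda>z. f z * g z)" and const: "\<And>c. G (\<lambda>z. c)"
    and A: "\<And>i j. i < n \<Longrightarrow> j < n \<Longrightarrow> G (\<lambda>z. A z i j)" and ij: "i < n" "j < n"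
  shows "G (\<lambda>z. madj n (A z) i j)"
proof -
  let ?B = "\<lambda>z. mat_delete (mat n n (\<lambda>(i, j). A z i j)) j i"
  have "G (\<lambda>z. Determinant.det (?B z))"
  proof (rule det_closed[where n = "n - 1" and G = G and A = ?B, OF add mult const])
    show "?B z \<in> carrier_mat (n - 1) (n - 1)" for z
      by (rule mat_delete_carrier) simp
    fix k l assume "k < n - 1" "l < n - 1"
    then show "G (\<lambda>z. ?B z $$ (k, l))"
      using ij by (auto simp: mat_delete_def intro!: A)
  qed
  then have "G (\<lambda>z. (- 1) ^ (j + i) * Determinant.det (?B z))" by (rule mult[OF const])
  then show ?thesis using ij by (simp add: madj_def adj_mat_def cofactor_def)
qed

lemma corner_op_diff: "corner_op u n (\<lambda>i j. A i j - B i j) = corner_op u n A - corner_op u n B"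
  by (simp add: corner_op_def complex_vector.scale_left_diff_distrib sum_subtractf)

lemma norm_one_minus_proj: "orthonormal u n \<Longrightarrow> norm (1 - proj u n) \<le> 1"
  by (rule norm_bop_bound) (simp_all add: bop_apply_diff norm_minus_proj)

lemma bop_invertibleI: "S * T = 1 \<Longrightarrow> T * S = 1 \<Longrightarrow> bop_invertible T"
  unfolding bop_invertible_def by blast

section \<open>The Fredholm alternative for germs\<close>

context germs
begin

lemma germ_matrix_coeff:
  assumes "germ h a"
  shows "germ (\<lambda>z. matrix_coeff x y (h z)) (\<lambda>\<gamma>. matrix_coeff x y (a \<gamma>))"
  using assms bounded_linear_matrix_coeff matrix_coeff_scaleC by (rule germ_linear)

lemma germ_scaleC_const:
  assumes "germ h a"
  shows "germ (\<lambda>z. h z *\<^sub>C T) (\<lambda>\<gamma>. a \<gamma> *\<^sub>C T)"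
  by (rule germ_linear[OF assms bounded_bilinear.bounded_linear_left[OF bounded_bilinear_scaleC]])
    (simp add: scaleC_scaleC scaleC_complex_def)

lemma germ_mult_left:
  fixes h :: "'z \<Rightarrow> 'a::complex_banach_algebra"
  assumes "germ h a"
  shows "germ (\<lambda>z. T * h z) (\<lambda>\<gamma>. T * a \<gamma>)"
  using assms bounded_linear_mult_right mult_scaleC_right by (rule germ_linear)

text \<open>The determinant of the corner is a scalar germ. If its series is zero, the corner is
  eventually singular and \<open>corner_of_inverse\<close> rules out invertibility; otherwise its
  reciprocal is a germ, and Cramer's rule produces \<open>D\<close>, all of whose coefficients live
  in the range of \<open>P\<close>.\<close>

lemma germ_corner_inverse:
  fixes M :: "'z \<Rightarrow> 'h::complex_hilbert_space bop"
  assumes M: "germ M m" and u: "orthonormal u n"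
  defines "P \<equiv> proj u n"
  shows "(\<forall>\<^sub>F z in F. \<not> bop_invertible (1 - P * M z)) \<or>
    (\<exists>D d. germ D d \<and> (\<forall>\<gamma>. finite_rank (d \<gamma>)) \<and>
      (\<forall>\<^sub>F z in F. (1 + D z * M z) * (1 - P * M z) = 1 \<and> (1 - P * M z) * (1 + D z * M z) = 1))"
proof -
  have PP: "P * P = P" unfolding P_def by (rule proj_idem[OF u])
  \<comment> \<open>The matrix of the corner \<open>P - P * M z * P\<close> in the basis
    \<open>u\<close>.\<close>
  define W where "W z i j = (if i = j then 1 else 0) - matrix_coeff (u i) (u j) (M z)" for z i j
  have corner_W: "corner_op u n (W z) = P - P * M z * P" for z
    using corner_op_diff[of u n "\<lambda>i j. if i = j then 1 else 0" "\<lambda>i j. matrix_coeff (u i) (u j) (M z)"]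
    unfolding corner_op_one proj_corner[symmetric] P_def W_def .
  define G where "G f \<longleftrightarrow> (\<exists>a. germ f a)" for f :: "'z \<Rightarrow> complex"
  have G_add: "G (\<lambda>z. f z + g z)" if fg: "G f" "G g" for f g
  proof -
    obtain a where "germ f a" using fg(1) unfolding G_def ..
    moreover obtain b where "germ g b" using fg(2) unfolding G_def ..
    ultimately show ?thesis unfolding G_def by (intro exI) (rule germ_add)
  qed
  have G_mult: "G (\<lambda>z. f z * g z)" if fg: "G f" "G g" for f g
  proof -
    obtain a where "germ f a" using fg(1) unfolding G_def ..
    moreover obtain b where "germ g b" using fg(2) unfolding G_def ..
    ultimately show ?thesis unfolding G_def by (intro exI) (rule germ_times)
  qed
  have G_const: "G (\<lambda>z. c)" for c
    unfolding G_def by (rule exI, rule germ_const)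
  have G_W: "G (\<lambda>z. W z i j)" for i j
    unfolding W_def G_def by (rule exI, rule germ_diff[OF germ_const germ_matrix_coeff[OF M]])
  have "G (\<lambda>z. mdet n (W z))"
    by (rule mdet_closed[where G = G, OF G_add G_mult G_const G_W])
  then obtain s where s: "germ (\<lambda>z. mdet n (W z)) s" unfolding G_def by blast
  show ?thesis
  proof (cases "hsupp s = {}")
    case True
    have "\<forall>\<^sub>F z in F. \<not> bop_invertible (1 - P * M z)"
      using germ_eventually_zero[OF s True]
    proof eventually_elim
      case (elim z)
      show ?case
      proof
        assume "bop_invertible (1 - P * M z)"
        then obtain X where X: "X * (1 - P * M z) = 1" "(1 - P * M z) * X = 1"
          unfolding bop_invertible_def by blast
        define B where "B i j = matrix_coeff (u i) (u j) X" for i j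
        have "corner_op u n (W z) * (P * X * P) = P"
          unfolding corner_W by (rule corner_of_inverse[OF PP X])
        then have eq: "corner_op u n (\<lambda>i j. \<Sum>k<n. W z i k * B k j) = corner_op u n (\<lambda>i j. if i = j then 1 else 0)"
          unfolding P_def proj_corner corner_op_mult[OF u] B_def corner_op_one .
        have "(\<Sum>k<n. W z i k * B k j) = (if i = j then 1 else 0)" if "i < n" "j < n" for i j
          using arg_cong[OF eq, of "matrix_coeff (u i) (u j)"] by (simp add: corner_op_coeff[OF u that])
        then have "mdet n (W z) \<noteq> 0" by (rule mdet_nonzero)
        with elim show False by simp
      qed
    qed
    then show ?thesis ..
  next
    case False
    obtain t where t: "germ (\<lambda>z. inverse (mdet n (W z))) t"
      using germ_inverse[OF s False] by blast
    \<comment> \<open>Cramer's rule for the inverse of \<open>W z\<close>.\<close>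
    define C where "C z i j = inverse (mdet n (W z)) * madj n (W z) i j" for z i j
    have "G (\<lambda>z. C z i j)" if "i < n" "j < n" for i j
    proof -
      have "G (\<lambda>z. inverse (mdet n (W z)))" unfolding G_def using t by blast
      moreover have "G (\<lambda>z. madj n (W z) i j)"
        by (rule madj_closed[where G = G, OF G_add G_mult G_const G_W that])
      ultimately show ?thesis unfolding C_def by (rule G_mult)
    qed
    then have "\<forall>i j. \<exists>a. i < n \<longrightarrow> j < n \<longrightarrow> germ (\<lambda>z. C z i j) a" unfolding G_def by blast
    then obtain c where c: "\<And>i j. i < n \<Longrightarrow> j < n \<Longrightarrow> germ (\<lambda>z. C z i j) (c i j)" by metis
    define D where "D z = corner_op u n (C z)" for z
    define d where "d \<gamma> = corner_op u n (\<lambda>i j. c i j \<gamma>)" for \<gamma>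
    have D: "germ D d"
      unfolding D_def[abs_def] d_def[abs_def] corner_op_def
      by (intro germ_sum germ_scaleC_const c) auto
    have fr: "finite_rank (d \<gamma>)" for \<gamma>
    proof -
      have "d \<gamma> = proj u n * d \<gamma>" unfolding d_def by (rule proj_mult_corner_op[OF u, symmetric])
      then show ?thesis by (metis finite_rank_mult_right finite_rank_proj)
    qed
    have "\<forall>\<^sub>F z in F. (1 + D z * M z) * (1 - P * M z) = 1 \<and> (1 - P * M z) * (1 + D z * M z) = 1"
      using germ_eventually_nonzero[OF s False]
    proof eventually_elim
      case (elim z)
      have inv1: "(\<Sum>k<n. C z i k * W z k j) = (if i = j then 1 else 0)" if "i < n" "j < n" for i j
        unfolding C_def mult.assoc sum_distrib_left[symmetric] madj_mult(2)[OF that] using elim by simp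
      have inv2: "(\<Sum>k<n. W z i k * C z k j) = (if i = j then 1 else 0)" if "i < n" "j < n" for i j
        unfolding C_def mult.left_commute[of "W z i _"] sum_distrib_left[symmetric] madj_mult(1)[OF that]
        using elim by simp
      have "D z * corner_op u n (W z) = P" "corner_op u n (W z) * D z = P"
        unfolding D_def corner_op_mult[OF u] P_def corner_op_one[symmetric]
        by (rule corner_op_cong, erule inv1, assumption, rule corner_op_cong, erule inv2, assumption)
      moreover have "P * D z = D z" "D z * P = D z"
        unfolding D_def P_def by (rule proj_mult_corner_op[OF u] corner_op_mult_proj[OF u])+
      ultimately show ?case
        unfolding corner_W by (intro conjI corner_inverse[OF PP])
    qed
    then show ?thesis using D fr by blast
  qed
qed

text \<open>A projection is needed for which the complementary part of \<open>h\<close> has only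
  non-negative exponents and a constant term of norm below \<open>1\<close>. Then
  \<open>1 - Q * h\<close> is inverted by a Neumann series without negative exponents, and all that
  can fail, or create negative exponents in the inverse, is confined to a finite rank
  corner.\<close>

theorem germ_fredholm:
  fixes h :: "'z \<Rightarrow> 'h::complex_hilbert_space bop"
  assumes h: "germ h a" and H0: "fin_dim_csubspace H0"
    and neg: "\<And>\<gamma>. \<gamma> < 0 \<Longrightarrow> range (bop_apply (a \<gamma>)) \<subseteq> H0"
    and cpt: "\<forall>\<^sub>F z in F. h z \<in> compact_ops"
  shows "(\<forall>\<^sub>F z in F. \<not> bop_invertible (1 - h z)) \<or>
    (\<exists>x b. germ x b \<and> (\<forall>\<gamma><0. finite_rank (b \<gamma>)) \<and>
      (\<forall>\<^sub>F z in F. x z * (1 - h z) = 1 \<and> (1 - h z) * x z = 1))"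
proof -
  \<comment> \<open>Any compact value serves here; the aim is a finite rank projection that fixes
    \<open>H0\<close> and so absorbs the negative coefficients.\<close>
  obtain z0 where "h z0 \<in> compact_ops" using eventually_happens'[OF F_nontriv cpt] by blast
  from compact_op_approx[OF this H0, of 1] obtain u0 n0 where u0: "orthonormal u0 n0"
    "\<forall>v\<in>H0. bop_apply (proj u0 n0) v = v" by auto
  define P0 where "P0 = proj u0 n0"
  have neg0: "(1 - P0) * a \<gamma> = 0" if "\<gamma> < 0" for \<gamma>
  proof (rule bop_eqI)
    fix x
    have "bop_apply (a \<gamma>) x \<in> H0" using neg[OF that] by (rule subsetD) simp
    then have "bop_apply P0 (bop_apply (a \<gamma>) x) = bop_apply (a \<gamma>) x" using u0(2) by (simp add: P0_def)
    then show "bop_apply ((1 - P0) * a \<gamma>) x = bop_apply 0 x" by (simp add: bop_apply_times bop_apply_diff)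
  qed
  have supp0: "hsupp (\<lambda>\<gamma>. (1 - P0) * a \<gamma>) \<subseteq> {0..}"
    using neg0 unfolding hsupp_def by (auto simp: not_less[symmetric])
  have lim: "((\<lambda>z. (1 - P0) * h z) \<longlongrightarrow> (1 - P0) * a 0) F"
    by (rule germ_tendsto[OF germ_mult_left[OF h] supp0])
  \<comment> \<open>The limit \<open>(1 - P0) * a 0\<close> is not known to be compact, so the
    second projection is fitted to the compact value \<open>h z1\<close>. The errors
    \<open>1/4\<close> from the distance to the limit and \<open>1/4\<close> from the approximation
    add up to less than \<open>1\<close>.\<close>
  have "\<forall>\<^sub>F z in F. dist ((1 - P0) * h z) ((1 - P0) * a 0) < 1/4 \<and> h z \<in> compact_ops"
    by (intro eventually_conj tendstoD[OF lim] cpt) simp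
  then obtain z1 where z1: "dist ((1 - P0) * h z1) ((1 - P0) * a 0) < 1/4" "h z1 \<in> compact_ops"
    using eventually_happens'[OF F_nontriv] by blast
  have "fin_dim_csubspace (range (bop_apply P0))"
    using finite_rank_proj unfolding finite_rank_def P0_def by blast
  from compact_op_approx[OF z1(2) this, of "1/4"] obtain u n where u: "orthonormal u n"
    "\<forall>v\<in>range (bop_apply P0). bop_apply (proj u n) v = v" "norm ((1 - proj u n) * h z1) \<le> 1/4" by auto
  define P where "P = proj u n"
  define Q where "Q = 1 - P"
  \<comment> \<open>The range of \<open>P\<close> contains that of \<open>P0\<close>, so
    \<open>Q\<close> annihilates \<open>P0\<close> and can absorb the factor \<open>1 - P0\<close>
    on its right.\<close>
  have QP0: "Q * (1 - P0) = Q"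
  proof -
    have "Q * P0 = 0" unfolding Q_def P_def
      by (rule bop_eqI) (use u(2) in \<open>simp add: bop_apply_times bop_apply_diff\<close>)
    then show ?thesis by (simp add: right_diff_distrib)
  qed
  have QP0': "Q * ((1 - P0) * y) = Q * y" for y by (simp add: mult.assoc[symmetric] QP0)
  have Qa: "Q * a \<gamma> = Q * ((1 - P0) * a \<gamma>)" for \<gamma> by (simp only: QP0')
  have supp: "hsupp (\<lambda>\<gamma>. Q * a \<gamma>) \<subseteq> {0..}"
    unfolding hsupp_def using neg0 by (auto simp: Qa not_less[symmetric])
  have small: "norm (Q * a 0) < 1"
  proof -
    have "Q * a 0 = Q * ((1 - P0) * a 0 - (1 - P0) * h z1) + Q * h z1"
      by (simp add: right_diff_distrib[of Q "(1 - P0) * a 0"] QP0')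
    also have "norm \<dots> \<le> norm Q * norm ((1 - P0) * a 0 - (1 - P0) * h z1) + norm (Q * h z1)"
      by (rule order_trans[OF norm_triangle_ineq]) (simp add: norm_mult_ineq)
    also have "\<dots> \<le> 1 * (1/4) + 1/4"
      using z1(1) u(3) norm_one_minus_proj[OF u(1)]
      by (intro add_mono mult_mono) (auto simp: dist_norm norm_minus_commute Q_def P_def)
    finally show ?thesis by simp
  qed
  from germ_neumann'[OF germ_mult_left[OF h] supp small]
  obtain r where "\<exists>b. germ r b \<and> hsupp b \<subseteq> {0..} \<and>
    (\<forall>\<^sub>F z in F. r z * (1 - Q * h z) = 1 \<and> (1 - Q * h z) * r z = 1)" ..
  then obtain br where "germ r br \<and> hsupp br \<subseteq> {0..} \<and>
    (\<forall>\<^sub>F z in F. r z * (1 - Q * h z) = 1 \<and> (1 - Q * h z) * r z = 1)" ..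
  then have r: "germ r br" "hsupp br \<subseteq> {0..}"
    "\<forall>\<^sub>F z in F. r z * (1 - Q * h z) = 1 \<and> (1 - Q * h z) * r z = 1" by simp_all
  define M where "M z = h z * r z" for z
  define m where "m = conv (*) a br"
  have M: "germ M m" unfolding M_def[abs_def] m_def by (rule germ_times[OF h r(1)])
  \<comment> \<open>Since \<open>M z\<close> carries the factor \<open>r z\<close>, multiplying
    \<open>P * M z\<close> by \<open>1 - Q * h z\<close> returns \<open>P * h z\<close>, and
    \<open>P + Q = 1\<close>.\<close>
  have factor: "1 - h z = (1 - P * M z) * (1 - Q * h z)" if "r z * (1 - Q * h z) = 1" for z
  proof -
    have "(1 - P * M z) * (1 - Q * h z) = 1 - Q * h z - P * h z * (r z * (1 - Q * h z))"
      unfolding M_def by (simp add: left_diff_distrib[of 1] mult.assoc)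
    also have "\<dots> = 1 - h z" unfolding that by (simp add: Q_def left_diff_distrib)
    finally show ?thesis by simp
  qed
  from germ_corner_inverse[OF M u(1)] show ?thesis
  proof
    assume "\<forall>\<^sub>F z in F. \<not> bop_invertible (1 - proj u n * M z)"
    then have "\<forall>\<^sub>F z in F. \<not> bop_invertible (1 - h z)"
      using r(3)
    proof eventually_elim
      case (elim z)
      \<comment> \<open>As \<open>1 - Q * h z\<close> has inverse \<open>r z\<close>, the two
        operators \<open>1 - h z\<close> and \<open>1 - P * M z\<close> are invertible
        together.\<close>
      have *: "1 - P * M z = (1 - h z) * r z"
        using factor[of z] elim(2) by (simp add: mult.assoc)
      show ?case
      proof
        assume "bop_invertible (1 - h z)"
        then obtain Y where Y: "Y * (1 - h z) = 1" "(1 - h z) * Y = 1"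
          unfolding bop_invertible_def by blast
        have "((1 - Q * h z) * Y) * (1 - P * M z) = (1 - Q * h z) * (Y * (1 - h z)) * r z"
          unfolding * by (simp only: mult.assoc)
        then have 1: "((1 - Q * h z) * Y) * (1 - P * M z) = 1" using elim(2) Y by simp
        have "(1 - P * M z) * ((1 - Q * h z) * Y) = (1 - h z) * (r z * (1 - Q * h z)) * Y"
          unfolding * by (simp only: mult.assoc)
        then have 2: "(1 - P * M z) * ((1 - Q * h z) * Y) = 1" using elim(2) Y by simp
        from elim(1) bop_invertibleI[OF 1 2] show False by (simp add: P_def)
      qed
    qed
    then show ?thesis ..
  next
    assume "\<exists>D d. germ D d \<and> (\<forall>\<gamma>. finite_rank (d \<gamma>)) \<and>
      (\<forall>\<^sub>F z in F. (1 + D z * M z) * (1 - proj u n * M z) = 1 \<and> (1 - proj u n * M z) * (1 + D z * M z) = 1)"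
    then obtain D where "\<exists>d. germ D d \<and> (\<forall>\<gamma>. finite_rank (d \<gamma>)) \<and>
      (\<forall>\<^sub>F z in F. (1 + D z * M z) * (1 - P * M z) = 1 \<and> (1 - P * M z) * (1 + D z * M z) = 1)"
      unfolding P_def ..
    then obtain d where "germ D d \<and> (\<forall>\<gamma>. finite_rank (d \<gamma>)) \<and>
      (\<forall>\<^sub>F z in F. (1 + D z * M z) * (1 - P * M z) = 1 \<and> (1 - P * M z) * (1 + D z * M z) = 1)" ..
    then have D: "germ D d" "\<And>\<gamma>. finite_rank (d \<gamma>)"
      "\<forall>\<^sub>F z in F. (1 + D z * M z) * (1 - P * M z) = 1 \<and> (1 - P * M z) * (1 + D z * M z) = 1" by simp_all
    \<comment> \<open>The inverse \<open>r * (1 + D * M)\<close> expanded: the first summand has no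
      negative exponents, and every coefficient of the second contains a coefficient of
      \<open>D\<close>, hence has finite rank.\<close>
    define x where "x z = r z + r z * (D z * M z)" for z
    define b where "b \<gamma> = br \<gamma> + conv (*) br (conv (*) d m) \<gamma>" for \<gamma>
    have "germ x b"
      unfolding x_def[abs_def] b_def[abs_def] by (intro germ_add germ_times r(1) D(1) M)
    moreover have "finite_rank (b \<gamma>)" if "\<gamma> < 0" for \<gamma>
    proof -
      have "br \<gamma> = 0" using r(2) that by (force simp: hsupp_def)
      moreover have "finite_rank (conv (*) d m \<delta>)" for \<delta>
        unfolding conv_def by (intro finite_rank_sum finite_rank_mult_right D(2))
      then have "finite_rank (conv (*) br (conv (*) d m) \<gamma>)"
        unfolding conv_def[of "(*)" br] by (intro finite_rank_sum finite_rank_mult_left)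
      ultimately show ?thesis by (simp add: b_def)
    qed
    moreover have "\<forall>\<^sub>F z in F. x z * (1 - h z) = 1 \<and> (1 - h z) * x z = 1"
      using r(3) D(3)
    proof eventually_elim
      case (elim z)
      have x: "x z = r z * (1 + D z * M z)" by (simp add: x_def distrib_left)
      have f: "1 - h z = (1 - P * M z) * (1 - Q * h z)" using elim(1) by (intro factor) simp
      have "x z * (1 - h z) = r z * ((1 + D z * M z) * (1 - P * M z)) * (1 - Q * h z)"
        unfolding x f by (simp only: mult.assoc)
      moreover have "(1 - h z) * x z = (1 - P * M z) * ((1 - Q * h z) * r z) * (1 + D z * M z)"
        unfolding x f by (simp only: mult.assoc)
      ultimately show ?case using elim by simp
    qed
    ultimately show ?thesis by blast
  qed
qed

end

section \<open>The algebra of Hahn series\<close>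

lemma hahn_mult_eq_conv: "hahn_mult a b = conv (*\<^sub>C) a b"
proof
  fix \<gamma>
  show "hahn_mult a b \<gamma> = conv (*\<^sub>C) a b \<gamma>"
    unfolding hahn_mult_def conv_def
    by (rule sum.reindex_bij_witness[where i = "\<lambda>\<alpha>. (\<alpha>, \<gamma> - \<alpha>)" and j = fst]) auto
qed

text \<open>Both sides are finite sums over the triples of exponents with total
  \<open>\<gamma>\<close>, bracketed differently.\<close>

lemma conv_assoc:
  fixes a b :: "'g::linordered_ab_group_add \<Rightarrow> complex" and c :: "'g \<Rightarrow> 'a::complex_normed_vector"
  assumes a: "well_ordered (hsupp a)" and b: "well_ordered (hsupp b)" and c: "well_ordered (hsupp c)"
  shows "conv (*\<^sub>C) a (conv (*\<^sub>C) b c) = conv (*\<^sub>C) (conv (*) a b) c"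
proof
  fix \<gamma>
  let ?A = "hsupp a" and ?B = "hsupp b" and ?C = "hsupp c"
  let ?BC = "{\<beta> + \<delta> |\<beta> \<delta>. \<beta> \<in> ?B \<and> \<delta> \<in> ?C}" and ?AB = "{\<alpha> + \<beta> |\<alpha> \<beta>. \<alpha> \<in> ?A \<and> \<beta> \<in> ?B}"
  \<comment> \<open>Sumsets replace the supports of the inner products, where cancellation could
    remove exponents; the extra terms are zero, and the index sets become explicit and stay
    finite.\<close>
  define X where "X = {\<alpha>\<in>?A. \<gamma> - \<alpha> \<in> ?BC}"
  define Y where "Y = {\<sigma>\<in>?AB. \<gamma> - \<sigma> \<in> ?C}"
  have finX: "finite X" unfolding X_def by (rule sumset_fibre_finite[OF a well_ordered_sumset[OF b c]])
  have finY: "finite Y" unfolding Y_def by (rule sumset_fibre_finite[OF well_ordered_sumset[OF a b] c])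
  have finB: "finite {\<beta>\<in>?B. \<gamma> - \<alpha> - \<beta> \<in> ?C}" for \<alpha> by (rule sumset_fibre_finite[OF b c])
  have finA: "finite {\<alpha>\<in>?A. \<sigma> - \<alpha> \<in> ?B}" for \<sigma> by (rule sumset_fibre_finite[OF a b])
  have "conv (*\<^sub>C) a (conv (*\<^sub>C) b c) \<gamma> = (\<Sum>\<alpha>\<in>X. a \<alpha> *\<^sub>C conv (*\<^sub>C) b c (\<gamma> - \<alpha>))"
    unfolding conv_def[of "(*\<^sub>C)" a] using hsupp_conv[of "(*\<^sub>C)" b c]
    by (intro sum.mono_neutral_left finX) (auto simp: X_def in_hsupp)
  also have "\<dots> = (\<Sum>\<alpha>\<in>X. \<Sum>\<beta>\<in>{\<beta>\<in>?B. \<gamma> - \<alpha> - \<beta> \<in> ?C}. (a \<alpha> * b \<beta>) *\<^sub>C c (\<gamma> - \<alpha> - \<beta>))"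
    by (simp add: conv_def[of "(*\<^sub>C)" b] complex_vector.scale_sum_right scaleC_scaleC)
  also have "\<dots> = (\<Sum>(\<alpha>, \<beta>)\<in>(SIGMA \<alpha>:X. {\<beta>\<in>?B. \<gamma> - \<alpha> - \<beta> \<in> ?C}). (a \<alpha> * b \<beta>) *\<^sub>C c (\<gamma> - \<alpha> - \<beta>))"
    by (rule sum.Sigma) (use finX finB in auto)
  also have "\<dots> = (\<Sum>(\<sigma>, \<alpha>)\<in>(SIGMA \<sigma>:Y. {\<alpha>\<in>?A. \<sigma> - \<alpha> \<in> ?B}). (a \<alpha> * b (\<sigma> - \<alpha>)) *\<^sub>C c (\<gamma> - \<sigma>))"
  proof (rule sum.reindex_bij_witness[where i = "\<lambda>(\<sigma>, \<alpha>). (\<alpha>, \<sigma> - \<alpha>)" and j = "\<lambda>(\<alpha>, \<beta>). (\<alpha> + \<beta>, \<alpha>)"])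
    fix p assume "p \<in> (SIGMA \<alpha>:X. {\<beta>\<in>?B. \<gamma> - \<alpha> - \<beta> \<in> ?C})"
    then obtain \<alpha> \<beta> where p: "p = (\<alpha>, \<beta>)" "\<alpha> \<in> ?A" "\<beta> \<in> ?B" "\<gamma> - \<alpha> - \<beta> \<in> ?C" by (auto simp: X_def)
    then have "\<alpha> + \<beta> \<in> ?AB" "\<gamma> - (\<alpha> + \<beta>) \<in> ?C" by (blast, simp add: diff_diff_eq)
    then show "(case p of (\<alpha>, \<beta>) \<Rightarrow> (\<alpha> + \<beta>, \<alpha>)) \<in> (SIGMA \<sigma>:Y. {\<alpha>\<in>?A. \<sigma> - \<alpha> \<in> ?B})"
      using p unfolding Y_def by simp
    show "(case case p of (\<alpha>, \<beta>) \<Rightarrow> (\<alpha> + \<beta>, \<alpha>) of (\<sigma>, \<alpha>) \<Rightarrow> (a \<alpha> * b (\<sigma> - \<alpha>)) *\<^sub>C c (\<gamma> - \<sigma>)) =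
        (case p of (\<alpha>, \<beta>) \<Rightarrow> (a \<alpha> * b \<beta>) *\<^sub>C c (\<gamma> - \<alpha> - \<beta>))"
      using p by (simp add: diff_diff_eq)
    show "(case case p of (\<alpha>, \<beta>) \<Rightarrow> (\<alpha> + \<beta>, \<alpha>) of (\<sigma>, \<alpha>) \<Rightarrow> (\<alpha>, \<sigma> - \<alpha>)) = p"
      using p by simp
  next
    fix p assume "p \<in> (SIGMA \<sigma>:Y. {\<alpha>\<in>?A. \<sigma> - \<alpha> \<in> ?B})"
    then obtain \<sigma> \<alpha> where p: "p = (\<sigma>, \<alpha>)" "\<alpha> \<in> ?A" "\<sigma> - \<alpha> \<in> ?B" "\<gamma> - \<sigma> \<in> ?C" by (auto simp: Y_def)
    have "\<gamma> - \<alpha> = (\<sigma> - \<alpha>) + (\<gamma> - \<sigma>)" by simp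
    then have "\<gamma> - \<alpha> \<in> ?BC" using p(3,4) by blast
    then show "(case p of (\<sigma>, \<alpha>) \<Rightarrow> (\<alpha>, \<sigma> - \<alpha>)) \<in> (SIGMA \<alpha>:X. {\<beta>\<in>?B. \<gamma> - \<alpha> - \<beta> \<in> ?C})"
      using p unfolding X_def by simp
    show "(case case p of (\<sigma>, \<alpha>) \<Rightarrow> (\<alpha>, \<sigma> - \<alpha>) of (\<alpha>, \<beta>) \<Rightarrow> (\<alpha> + \<beta>, \<alpha>)) = p"
      using p by simp
  qed
  also have "\<dots> = (\<Sum>\<sigma>\<in>Y. \<Sum>\<alpha>\<in>{\<alpha>\<in>?A. \<sigma> - \<alpha> \<in> ?B}. (a \<alpha> * b (\<sigma> - \<alpha>)) *\<^sub>C c (\<gamma> - \<sigma>))"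
    by (rule sum.Sigma[symmetric]) (use finY finA in auto)
  also have "\<dots> = (\<Sum>\<sigma>\<in>Y. conv (*) a b \<sigma> *\<^sub>C c (\<gamma> - \<sigma>))"
    by (simp add: conv_def[of "(*)" a] complex_vector.scale_sum_left)
  also have "\<dots> = conv (*\<^sub>C) (conv (*) a b) c \<gamma>"
    unfolding conv_def[of "(*\<^sub>C)" "conv (*) a b"] using hsupp_conv[of "(*)" a b]
    by (intro sum.mono_neutral_right finY) (auto simp: Y_def in_hsupp)
  finally show "conv (*\<^sub>C) a (conv (*\<^sub>C) b c) \<gamma> = conv (*\<^sub>C) (conv (*) a b) c \<gamma>" .
qed

lemma conv_commute:
  fixes a b :: "'g::linordered_ab_group_add \<Rightarrow> complex"
  shows "conv (*) a b = conv (*) b a"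
proof
  fix \<gamma>
  show "conv (*) a b \<gamma> = conv (*) b a \<gamma>"
    unfolding conv_def
    by (rule sum.reindex_bij_witness[where i = "\<lambda>\<alpha>. \<gamma> - \<alpha>" and j = "\<lambda>\<alpha>. \<gamma> - \<alpha>"]) (auto simp: mult.commute)
qed

lemma conv_hahn_one:
  fixes c :: "'g::linordered_ab_group_add \<Rightarrow> 'a::complex_normed_vector"
  shows "conv (*\<^sub>C) hahn_one c = c"
proof
  fix \<gamma> :: 'g
  have one: "\<alpha> \<in> hsupp (hahn_one :: 'g \<Rightarrow> complex) \<longleftrightarrow> \<alpha> = 0" for \<alpha>
    by (simp add: in_hsupp hahn_one_def)
  have "conv (*\<^sub>C) hahn_one c \<gamma> = (\<Sum>\<alpha>\<in>{0}. hahn_one \<alpha> *\<^sub>C c (\<gamma> - \<alpha>))"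
    unfolding conv_def by (rule sum.mono_neutral_left) (auto simp: one)
  then show "conv (*\<^sub>C) hahn_one c \<gamma> = c \<gamma>"
    by (simp add: hahn_one_def scaleC_one)
qed

text \<open>Identifies the formal quotient of two series with the series of the quotient function,
  once the latter is known to multiply back to the numerator.\<close>

lemma hahn_inverse_mult:
  assumes "well_ordered (hsupp b)" "well_ordered (hsupp p)" "is_hahn_inverse b b'"
  shows "hahn_mult b' (conv (*\<^sub>C) b p) = p"
proof -
  have b': "well_ordered (hsupp b')" "conv (*\<^sub>C) b b' = hahn_one"
    using assms(3) unfolding is_hahn_inverse_def hahn_series_def hahn_mult_eq_conv by blast+
  have "((*\<^sub>C) :: complex \<Rightarrow> complex \<Rightarrow> complex) = (*)" by (intro ext) (rule scaleC_complex_def)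
  then have one: "conv (*) b' b = hahn_one" using b'(2) by (simp add: conv_commute[of b'])
  show ?thesis
    unfolding hahn_mult_eq_conv by (simp add: conv_assoc[OF b'(1) assms(1,2)] one conv_hahn_one)
qed

section \<open>The logarithmic cover\<close>

lemma polar_coords_zero [simp]: "polar_coords 0 = (0, 0)"
  unfolding zero_logcover0_def by (rule of_polar_inverse) simp

lemma zmod_zero [simp]: "zmod 0 = 0"
  by (simp add: zmod_def)

lemma polar_coords_cases: "z = 0 \<or> 0 < fst (polar_coords z)"
  using polar_coords[of z] polar_coords_inverse[of z] unfolding zero_logcover0_def by auto

lemma zmod_pos: "z \<noteq> 0 \<Longrightarrow> 0 < zmod z"
  using polar_coords_cases[of z] by (simp add: zmod_def)

lemma polar_coords_eq: "polar_coords z = (zmod z, zarg z)"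
  by (simp add: zmod_def zarg_def)

lemma of_polar_zmod_zarg: "of_polar (zmod z, zarg z) = z"
  using polar_coords_inverse[of z] by (simp add: polar_coords_eq)

lemma polar_coords_of_polar: "0 < r \<Longrightarrow> polar_coords (of_polar (r, \<phi>)) = (r, \<phi>)"
  by (rule of_polar_inverse) simp

lemma zmod_of_polar: "0 < r \<Longrightarrow> zmod (of_polar (r, \<phi>)) = r"
  by (simp add: zmod_def polar_coords_of_polar)

lemma zarg_of_polar: "0 < r \<Longrightarrow> zarg (of_polar (r, \<phi>)) = \<phi>"
  by (simp add: zarg_def polar_coords_of_polar)

lemma of_polar_nonzero: "0 < r \<Longrightarrow> of_polar (r, \<phi>) \<noteq> 0"
  using zmod_of_polar[of r \<phi>] by auto

lemma zmod_zreal: "0 < x \<Longrightarrow> zmod (zreal x) = x"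
  unfolding zreal_def by (rule zmod_of_polar)

section \<open>Neighbourhoods and limits in the cover\<close>

lemma open_zdisc: "0 < \<epsilon> \<Longrightarrow> open (zdisc \<epsilon>)"
  unfolding open_logcover0_def by (rule generate_topology.Basis) blast

lemma open_of_polar: "open U \<Longrightarrow> U \<subseteq> {0<..} \<times> UNIV \<Longrightarrow> open (of_polar ` U)"
  unfolding open_logcover0_def by (rule generate_topology.Basis) blast

text \<open>The topology is given by generators, so this is an induction on how \<open>W\<close> is
  generated. Discs cause no trouble, being open in polar coordinates away from
  \<open>0\<close>.\<close>

lemma open_nbhd_nonzero:
  assumes "open W" "z \<in> W" "z \<noteq> 0"
  shows "\<exists>U. open U \<and> U \<subseteq> {0<..} \<times> UNIV \<and> polar_coords z \<in> U \<and> of_polar ` U \<subseteq> W"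
  using assms unfolding open_logcover0_def
proof (induction rule: generate_topology.induct)
  case UNIV
  have "open ({0<..} \<times> UNIV :: (real \<times> real) set)" by (intro open_Times) auto
  moreover have "polar_coords z \<in> {0<..} \<times> UNIV" using zmod_pos[OF UNIV(2)] by (simp add: polar_coords_eq)
  ultimately show ?case by (intro exI[of _ "{0<..} \<times> UNIV"]) simp
next
  case (Int a b)
  then obtain U V where "open U" "U \<subseteq> {0<..} \<times> UNIV" "polar_coords z \<in> U" "of_polar ` U \<subseteq> a"
    "open V" "polar_coords z \<in> V" "of_polar ` V \<subseteq> b" by auto
  then show ?case by (intro exI[of _ "U \<inter> V"]) auto
next
  case (UN K)
  then obtain k where "k \<in> K" "z \<in> k" by blast
  from UN(2)[OF \<open>k \<in> K\<close> \<open>z \<in> k\<close> UN(4)]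
  obtain U where "open U" "U \<subseteq> {0<..} \<times> UNIV" "polar_coords z \<in> U" "of_polar ` U \<subseteq> k" by auto
  then show ?case using \<open>k \<in> K\<close> by (intro exI[of _ U]) auto
next
  case (Basis s)
  then consider U where "s = of_polar ` U" "open U" "U \<subseteq> {0<..} \<times> UNIV" | \<epsilon> where "s = zdisc \<epsilon>" "0 < \<epsilon>"
    by blast
  then show ?case
  proof cases
    case 1
    then obtain p where p: "p \<in> U" "z = of_polar p" using Basis by blast
    then have "polar_coords z = p" using 1(3) polar_coords_of_polar[of "fst p" "snd p"] by auto
    then show ?thesis using 1 p by (intro exI[of _ U]) auto
  next
    case 2
    let ?U = "{0<..<\<epsilon>} \<times> (UNIV :: real set)"
    have "open ?U" by (intro open_Times) auto
    moreover have "polar_coords z \<in> ?U"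
      using zmod_pos[OF Basis(3)] Basis(2) 2 by (simp add: polar_coords_eq zdisc_def)
    moreover have "of_polar ` ?U \<subseteq> s" using 2 by (auto simp: zdisc_def zmod_of_polar)
    ultimately show ?thesis by (intro exI[of _ ?U]) auto
  qed
qed

text \<open>Among the generators only the discs contain \<open>0\<close>, and the smaller of two
  discs is contained in their intersection.\<close>

lemma open_nbhd_zero:
  assumes "open W" "0 \<in> W"
  shows "\<exists>\<epsilon>>0. zdisc \<epsilon> \<subseteq> W"
  using assms unfolding open_logcover0_def
proof (induction rule: generate_topology.induct)
  case UNIV
  then show ?case by (intro exI[of _ 1]) auto
next
  case (Int a b)
  then obtain \<epsilon> \<delta> where "0 < \<epsilon>" "zdisc \<epsilon> \<subseteq> a" "0 < \<delta>" "zdisc \<delta> \<subseteq> b" by auto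
  then show ?case by (intro exI[of _ "min \<epsilon> \<delta>"]) (auto simp: zdisc_def)
next
  case (UN K)
  then show ?case by blast
next
  case (Basis s)
  then consider U where "s = of_polar ` U" "U \<subseteq> {0<..} \<times> UNIV" | \<epsilon> where "s = zdisc \<epsilon>" "0 < \<epsilon>"
    by blast
  then show ?case
  proof cases
    case 1
    then obtain r \<phi> where "0 < r" "0 = of_polar (r, \<phi>)" using Basis by auto
    then show ?thesis using of_polar_nonzero by metis
  qed blast
qed

text \<open>Separation allows any one point to be removed from a punctured neighbourhood, as happens
  in \<open>clopen_dichotomy\<close>.\<close>

instance logcover0 :: t1_space
proof
  fix x y :: logcover0
  assume "x \<noteq> y"
  show "\<exists>U. open U \<and> x \<in> U \<and> y \<notin> U"
  proof (cases "x = 0")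
    case True
    then show ?thesis using \<open>x \<noteq> y\<close> zmod_pos[of y] open_zdisc[of "zmod y"]
      by (intro exI[of _ "zdisc (zmod y)"]) (auto simp: zdisc_def)
  next
    case False
    let ?U = "{0<..} \<times> UNIV - {polar_coords y}"
    have "open ?U" by (intro open_Diff open_Times) auto
    then have "open (of_polar ` ?U)" by (rule open_of_polar) auto
    moreover have "x \<in> of_polar ` ?U"
    proof (rule image_eqI[of _ _ "polar_coords x"])
      show "x = of_polar (polar_coords x)" by (simp add: polar_coords_inverse)
      show "polar_coords x \<in> ?U"
        using \<open>x \<noteq> y\<close> zmod_pos[OF False] by (auto simp: polar_coords_inject) (simp add: polar_coords_eq)
    qed
    moreover have "y \<notin> of_polar ` ?U"
    proof
      assume "y \<in> of_polar ` ?U"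
      then obtain p where "p \<in> ?U" "y = of_polar p" by blast
      then show False using polar_coords_of_polar[of "fst p" "snd p"] by auto
    qed
    ultimately show ?thesis by blast
  qed
qed

lemma eventually_at_zero:
  assumes "0 \<notin> Y"
  shows "eventually P (at 0 within Y) \<longleftrightarrow> (\<exists>\<epsilon>>0. \<forall>z\<in>Y \<inter> zdisc \<epsilon>. P z)"
proof
  assume "eventually P (at 0 within Y)"
  then obtain S where S: "open S" "0 \<in> S" "\<forall>x\<in>S. x \<noteq> 0 \<longrightarrow> x \<in> Y \<longrightarrow> P x"
    unfolding eventually_at_topological by auto
  obtain \<epsilon> where e: "0 < \<epsilon>" "zdisc \<epsilon> \<subseteq> S" using open_nbhd_zero[OF S(1,2)] by auto
  have "P z" if "z \<in> Y \<inter> zdisc \<epsilon>" for z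
  proof -
    have "z \<in> S" "z \<in> Y" "z \<noteq> 0" using that e(2) assms by auto
    then show ?thesis using S(3) by simp
  qed
  then show "\<exists>\<epsilon>>0. \<forall>z\<in>Y \<inter> zdisc \<epsilon>. P z" using e(1) by (intro exI[of _ \<epsilon>]) simp
next
  assume "\<exists>\<epsilon>>0. \<forall>z\<in>Y \<inter> zdisc \<epsilon>. P z"
  then obtain \<epsilon> where e: "0 < \<epsilon>" "\<forall>z\<in>Y \<inter> zdisc \<epsilon>. P z" by auto
  then show "eventually P (at 0 within Y)"
    unfolding eventually_at_topological
    by (intro exI[of _ "zdisc \<epsilon>"]) (auto simp: open_zdisc, simp add: zdisc_def)
qed

lemma tendsto_of_polar:
  assumes "(f \<longlongrightarrow> r) F" "(g \<longlongrightarrow> \<phi>) F" "0 < r"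
  shows "((\<lambda>x. of_polar (f x, g x)) \<longlongrightarrow> of_polar (r, \<phi>)) F"
proof (rule topological_tendstoI)
  fix W assume W: "open W" "of_polar (r, \<phi>) \<in> W"
  obtain U where U: "open U" "polar_coords (of_polar (r, \<phi>)) \<in> U" "of_polar ` U \<subseteq> W"
    using open_nbhd_nonzero[OF W of_polar_nonzero[OF assms(3)]] by blast
  then have "(r, \<phi>) \<in> U" by (simp add: polar_coords_of_polar assms(3))
  with tendsto_Pair[OF assms(1,2)] U(1) have "\<forall>\<^sub>F x in F. (f x, g x) \<in> U"
    by (rule topological_tendstoD)
  then show "\<forall>\<^sub>F x in F. of_polar (f x, g x) \<in> W" by eventually_elim (use U(3) in blast)
qed

lemma tendsto_polar_coords:
  assumes "z \<noteq> 0"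
  shows "(polar_coords \<longlongrightarrow> polar_coords z) (nhds z)"
proof (rule topological_tendstoI)
  fix U :: "(real \<times> real) set" assume U: "open U" "polar_coords z \<in> U"
  let ?V = "U \<inter> {0<..} \<times> UNIV"
  have "open ?V" using U(1) by (intro open_Int open_Times) auto
  then have "open (of_polar ` ?V)" by (rule open_of_polar) auto
  moreover have "z \<in> of_polar ` ?V"
    by (rule image_eqI[of _ _ "polar_coords z"])
      (use U zmod_pos[OF assms] in \<open>auto simp: polar_coords_inverse, simp add: polar_coords_eq\<close>)
  moreover have "polar_coords w \<in> U" if "w \<in> of_polar ` ?V" for w
    using that by (auto simp: polar_coords_of_polar)
  ultimately show "\<forall>\<^sub>F w in nhds z. polar_coords w \<in> U"
    unfolding eventually_nhds by (intro exI[of _ "of_polar ` ?V"]) simp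
qed

lemma tendsto_zmod: "z \<noteq> 0 \<Longrightarrow> (zmod \<longlongrightarrow> zmod z) (nhds z)"
  unfolding zmod_def by (rule tendsto_fst[OF tendsto_polar_coords])

lemma tendsto_zarg: "z \<noteq> 0 \<Longrightarrow> (zarg \<longlongrightarrow> zarg z) (nhds z)"
  unfolding zarg_def by (rule tendsto_snd[OF tendsto_polar_coords])

lemma tendsto_zproj: "z \<noteq> 0 \<Longrightarrow> (zproj \<longlongrightarrow> zproj z) (nhds z)"
  unfolding zproj_def rcis_def cis_conv_exp
  by (intro tendsto_intros tendsto_zmod tendsto_zarg)

lemma cmod_zproj: "cmod (zproj z) = zmod z"
  using zmod_pos[of z] by (cases "z = 0") (simp_all add: zproj_def)

text \<open>The branch of the inverse of the covering map that sends \<open>zproj z\<close> to \<open>z\<close>.\<close>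

definition zsection :: "logcover0 \<Rightarrow> complex \<Rightarrow> logcover0" where
  "zsection z w = of_polar (cmod w, zarg z + Arg (w / zproj z))"

context
  fixes z :: logcover0
  assumes z: "z \<noteq> 0"
begin

lemma zproj_nonzero: "zproj z \<noteq> 0"
  using cmod_zproj[of z] zmod_pos[OF z] by auto

text \<open>In the ball of radius \<open>zmod z\<close> the quotient by the centre stays within
  distance \<open>1\<close> of \<open>1\<close>. It thus has positive real part and avoids the cut
  of the principal argument.\<close>

lemma ball_quotient:
  assumes "w \<in> ball (zproj z) (zmod z)"
  shows "w \<noteq> 0" "w / zproj z \<notin> \<real>\<^sub>\<le>\<^sub>0"
proof -
  have "cmod (w - zproj z) < cmod (zproj z)"
    using assms by (simp add: dist_norm norm_minus_commute cmod_zproj)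
  then show "w \<noteq> 0" by auto
  have "cmod (w / zproj z - 1) = cmod (w - zproj z) / cmod (zproj z)"
    using zproj_nonzero by (simp add: norm_divide[symmetric] diff_divide_distrib)
  also have "\<dots> < 1" using \<open>cmod (w - zproj z) < _\<close> zproj_nonzero by (simp add: divide_less_eq)
  finally have "\<bar>Re (w / zproj z - 1)\<bar> < 1" using abs_Re_le_cmod le_less_trans by blast
  then have "0 < Re (w / zproj z)" by simp
  then show "w / zproj z \<notin> \<real>\<^sub>\<le>\<^sub>0" by (auto simp: complex_nonpos_Reals_iff)
qed

lemma zproj_zsection:
  assumes "w \<in> ball (zproj z) (zmod z)"
  shows "zproj (zsection z w) = w"
proof -
  have w: "0 < cmod w" using ball_quotient[OF assms] by simp
  have "zproj (zsection z w) = rcis (cmod w) (zarg z + Arg (w / zproj z))"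
    unfolding zproj_def[of "zsection z w"] by (simp add: zsection_def zmod_of_polar[OF w] zarg_of_polar[OF w])
  also have "\<dots> = rcis (zmod z) (zarg z) * rcis (cmod w / zmod z) (Arg (w / zproj z))"
    using zmod_pos[OF z] by (simp add: rcis_mult)
  also have "\<dots> = zproj z * rcis (cmod (w / zproj z)) (Arg (w / zproj z))"
    by (simp add: zproj_def[symmetric] norm_divide cmod_zproj)
  also have "\<dots> = w" using zproj_nonzero by (simp only: rcis_cmod_Arg) simp
  finally show ?thesis .
qed

lemma zsection_nonzero: "w \<in> ball (zproj z) (zmod z) \<Longrightarrow> zsection z w \<noteq> 0"
  unfolding zsection_def using ball_quotient by (intro of_polar_nonzero) simp

lemma zsection_zproj: "zsection z (zproj z) = z"
  using zproj_nonzero of_polar_zmod_zarg[of z] by (simp add: zsection_def cmod_zproj)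

lemma tendsto_zsection:
  assumes "w \<in> ball (zproj z) (zmod z)"
  shows "(zsection z \<longlongrightarrow> zsection z w) (nhds w)"
proof -
  have "isCont Arg (w / zproj z)" by (rule continuous_at_Arg[OF ball_quotient(2)[OF assms]])
  then have "((\<lambda>v. Arg (v / zproj z)) \<longlongrightarrow> Arg (w / zproj z)) (nhds w)"
    by (rule isCont_tendsto_compose) (intro tendsto_divide filterlim_ident tendsto_const zproj_nonzero)
  then show ?thesis
    unfolding zsection_def[abs_def] using ball_quotient[OF assms]
    by (intro tendsto_of_polar tendsto_intros filterlim_ident) auto
qed

text \<open>Once the angle of \<open>w\<close> is within \<open>pi\<close> of that of
  \<open>z\<close>, the principal argument of the quotient is exactly the difference of the angles;
  this singles out the sheet that contains \<open>z\<close>.\<close>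

lemma eventually_zsection:
  "\<forall>\<^sub>F w in nhds z. w \<noteq> 0 \<and> zproj w \<in> ball (zproj z) (zmod z) \<and> zsection z (zproj w) = w"
proof -
  have "\<forall>\<^sub>F w in nhds z. 0 < zmod w"
    by (rule order_tendstoD(1)[OF tendsto_zmod[OF z] zmod_pos[OF z]])
  moreover have "\<forall>\<^sub>F w in nhds z. dist (zarg w) (zarg z) < pi"
    by (rule tendstoD[OF tendsto_zarg[OF z]]) simp
  moreover have "\<forall>\<^sub>F w in nhds z. dist (zproj w) (zproj z) < zmod z"
    by (rule tendstoD[OF tendsto_zproj[OF z] zmod_pos[OF z]])
  ultimately show ?thesis
  proof eventually_elim
    case (elim w)
    then have w: "w \<noteq> 0" by auto
    have "zproj w / zproj z = rcis (zmod w / zmod z) (zarg w - zarg z)"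
      unfolding zproj_def by (simp add: rcis_divide)
    moreover have "0 < zmod w / zmod z" using elim zmod_pos[OF z] by simp
    moreover have "zarg w - zarg z \<in> {-pi<..pi}" using elim(2) by (auto simp: dist_real_def abs_less_iff)
    ultimately have "Arg (zproj w / zproj z) = zarg w - zarg z" by (simp only: Arg_rcis)
    then have "zsection z (zproj w) = w"
      by (simp add: zsection_def cmod_zproj of_polar_zmod_zarg)
    then show ?case using elim w by (simp add: dist_commute)
  qed
qed

lemma filterlim_zproj_at: "filterlim zproj (at (zproj z)) (at z)"
  unfolding filterlim_at
proof
  show "(zproj \<longlongrightarrow> zproj z) (at z)"
    by (rule filterlim_mono[OF tendsto_zproj[OF z]]) (simp_all add: at_within_le_nhds)
  have "\<forall>\<^sub>F w in at z. zsection z (zproj w) = w"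
    using eventually_zsection unfolding eventually_at_filter by eventually_elim simp
  moreover have "\<forall>\<^sub>F w in at z. w \<noteq> z" by (rule eventually_neq_at_within)
  ultimately show "\<forall>\<^sub>F w in at z. zproj w \<in> UNIV \<and> zproj w \<noteq> zproj z"
    by eventually_elim (use zsection_zproj in auto)
qed

lemma filterlim_zsection_at:
  assumes w: "w \<in> ball (zproj z) (zmod z)"
  shows "filterlim (zsection z) (at (zsection z w)) (at w)"
  unfolding filterlim_at
proof
  show "(zsection z \<longlongrightarrow> zsection z w) (at w)"
    by (rule filterlim_mono[OF tendsto_zsection[OF w]]) (simp_all add: at_within_le_nhds)
  have "\<forall>\<^sub>F v in at w. v \<in> ball (zproj z) (zmod z)"
    using w by (intro eventually_at_in_open') auto
  moreover have "\<forall>\<^sub>F v in at w. v \<noteq> w" by (rule eventually_neq_at_within)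
  ultimately show "\<forall>\<^sub>F v in at w. zsection z v \<in> UNIV \<and> zsection z v \<noteq> zsection z w"
  proof eventually_elim
    case (elim v)
    then show ?case using zproj_zsection[of v] zproj_zsection[OF w] by auto
  qed
qed

text \<open>The section maps punctured neighbourhoods in the plane, which has no isolated points,
  into those of \<open>z\<close>.\<close>

lemma at_nonzero_neq_bot: "at z \<noteq> bot"
proof
  assume *: "at z = bot"
  have "filterlim (zsection z) (at z) (at (zproj z))"
    using filterlim_zsection_at[of "zproj z"] zmod_pos[OF z] by (simp add: zsection_zproj)
  then have "at (zproj z) = bot" unfolding * filterlim_def by (simp add: bot_unique filtermap_bot_iff)
  then show False by simp
qed

end

section \<open>Derivatives in the local coordinate\<close>

lemma has_zderiv_continuous:
  assumes "z \<noteq> 0" "has_zderiv h D z"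
  shows "(h \<longlongrightarrow> h z) (at z)"
proof -
  have "((\<lambda>w. zproj w - zproj z) \<longlongrightarrow> 0) (at z)"
    using filterlim_zproj_at[OF assms(1)] by (simp add: filterlim_at LIM_zero_iff)
  from tendsto_scaleC[OF this assms(2)[unfolded has_zderiv_def]]
  have "((\<lambda>w. (zproj w - zproj z) *\<^sub>C inverse (zproj w - zproj z) *\<^sub>C (h w - h z)) \<longlongrightarrow> 0) (at z)" by simp
  moreover have "\<forall>\<^sub>F w in at z. zproj w \<noteq> zproj z"
    using filterlim_zproj_at[OF assms(1)] by (simp add: filterlim_at)
  then have "\<forall>\<^sub>F w in at z. (zproj w - zproj z) *\<^sub>C inverse (zproj w - zproj z) *\<^sub>C (h w - h z) = h w - h z"
    by eventually_elim (simp add: scaleC_scaleC scaleC_one)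
  ultimately have "((\<lambda>w. h w - h z) \<longlongrightarrow> 0) (at z)" by (rule Lim_transform_eventually)
  then show ?thesis by (simp add: LIM_zero_iff)
qed

subsection \<open>Laurent series as germs\<close>

definition laurent_exp :: "logcover0 \<Rightarrow> int \<Rightarrow> logcover0 \<Rightarrow> complex" where
  "laurent_exp z k w = (zproj w - zproj z) powi k"

lemma eventually_zproj_neq: "z \<noteq> 0 \<Longrightarrow> \<forall>\<^sub>F w in at z. zproj w \<noteq> zproj z"
  using filterlim_zproj_at[of z] by (simp add: filterlim_at)

lemma tendsto_zproj_diff: "z \<noteq> 0 \<Longrightarrow> ((\<lambda>w. zproj w - zproj z) \<longlongrightarrow> 0) (at z)"
  using filterlim_zproj_at[of z] by (simp add: filterlim_at LIM_zero_iff)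

lemma germs_laurent:
  assumes "z \<noteq> 0"
  shows "germs (at z) (at z) (laurent_exp z)"
proof
  show "at z \<noteq> bot" by (rule at_nonzero_neq_bot[OF assms])
  show "\<forall>\<^sub>F w in at z. \<forall>\<alpha> \<beta>. laurent_exp z (\<alpha> + \<beta>) w = laurent_exp z \<alpha> w * laurent_exp z \<beta> w \<and>
      laurent_exp z \<alpha> w \<noteq> 0"
    using eventually_zproj_neq[OF assms]
    by eventually_elim (simp add: laurent_exp_def power_int_add power_int_not_zero)
  fix k :: int assume "0 < k"
  then have k: "laurent_exp z k w = (zproj w - zproj z) ^ nat k" for w
    by (simp add: laurent_exp_def power_int_def)
  have "((\<lambda>w. (zproj w - zproj z) ^ nat k) \<longlongrightarrow> 0 ^ nat k) (at z)"
    by (rule tendsto_power[OF tendsto_zproj_diff[OF assms]])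
  moreover have "(0::complex) ^ nat k = 0" using \<open>0 < k\<close> by (simp add: zero_power)
  moreover have "laurent_exp z k = (\<lambda>w. (zproj w - zproj z) ^ nat k)" using k by (rule ext)
  ultimately show "(laurent_exp z k \<longlongrightarrow> 0) (at z)" by simp
qed simp

lemma well_ordered_int:
  fixes S :: "int set"
  assumes "\<And>k. k \<in> S \<Longrightarrow> m \<le> k"
  shows "well_ordered S"
  unfolding well_ordered_def
proof (intro allI impI)
  fix B assume B: "B \<subseteq> S" "B \<noteq> {}"
  then obtain b where "b \<in> B" by blast
  then obtain k where k: "k \<in> B" "\<And>l. l \<in> B \<Longrightarrow> nat (k - m) \<le> nat (l - m)"
    using ex_has_least_nat[of "\<lambda>k. k \<in> B" b "\<lambda>k. nat (k - m)"] by blast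
  have "k \<le> l" if "l \<in> B" for l
    using k(2)[OF that] assms[of k] assms[of l] k(1) that B(1) by (auto simp: nat_le_iff)
  then show "\<exists>m\<in>B. \<forall>b\<in>B. m \<le> b" using k(1) by blast
qed

text \<open>Powers with non-negative exponent increase with the modulus of the base, so every point
  closer to the centre is dominated; a lower bound is all that admissibility requires of integer
  exponents.\<close>

lemma adm_laurent:
  assumes "z \<noteq> 0" "\<And>k. k \<in> S \<Longrightarrow> m \<le> k"
  shows "germs.adm (at z) (at z) (laurent_exp z) S"
proof -
  interpret germs "at z" "at z" "laurent_exp z" by (rule germs_laurent[OF assms(1)])
  have "wm {0..}"
    unfolding wm_def using eventually_zproj_neq[OF assms(1)]
  proof eventually_elim
    case (elim x)
    then have "0 < cmod (zproj x - zproj z)" by simp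
    with tendsto_zproj_diff[OF assms(1)]
    have "\<forall>\<^sub>F w in at z. dist (zproj w - zproj z) 0 < cmod (zproj x - zproj z)" by (rule tendstoD)
    then show ?case
      by eventually_elim (auto simp: laurent_exp_def norm_power_int intro!: power_int_mono)
  qed
  then have "wm (gaps S k)" for k by (rule wm_subset) (auto simp: gaps_def)
  moreover have "well_ordered S" using assms(2) by (rule well_ordered_int)
  ultimately show ?thesis by (simp add: adm_def)
qed

lemma germ_imp_laurent:
  assumes z: "z \<noteq> 0" and h: "germs.germ (at z) (at z) (laurent_exp z) h A"
  shows "has_laurent_expansion_at h z A"
proof -
  interpret germs "at z" "at z" "laurent_exp z" by (rule germs_laurent[OF z])
  have "\<exists>m. \<forall>k<m. A k = 0"
  proof (cases "hsupp A = {}")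
    case True
    then show ?thesis by (auto simp: hsupp_def)
  next
    case False
    then obtain m where "A m \<noteq> 0" "hsupp A \<subseteq> {m..}" using germ_min[OF h] by blast
    then have "\<forall>k<m. A k = 0" by (auto simp: hsupp_def)
    then show ?thesis ..
  qed
  moreover have "\<forall>\<^sub>F w in at z. ((\<lambda>k. ((zproj w - zproj z) powi k) *\<^sub>C A k) has_sum h w) UNIV"
    using germ_ev[OF h] by eventually_elim (simp add: laurent_exp_def)
  ultimately show ?thesis by (simp add: has_laurent_expansion_at_def)
qed

text \<open>An expansion is only required to be summable in the sense of \<open>has_sum\<close>,
  which in infinite dimension need not mean absolutely. Boundedness of the terms at one point
  \<open>x\<close> gives a geometric majorant at points closer to the centre, as in Abel's
  lemma.\<close>

lemma laurent_imp_germ: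
  fixes h :: "logcover0 \<Rightarrow> 'a::{complex_normed_vector, banach}"
  assumes z: "z \<noteq> 0" and h: "has_laurent_expansion_at h z A"
  shows "germs.germ (at z) (at z) (laurent_exp z) h A"
proof -
  interpret germs "at z" "at z" "laurent_exp z" by (rule germs_laurent[OF z])
  obtain m where m: "\<And>k. k < m \<Longrightarrow> A k = 0"
    and ev: "\<forall>\<^sub>F w in at z. ((\<lambda>k. ((zproj w - zproj z) powi k) *\<^sub>C A k) has_sum h w) UNIV"
    using h unfolding has_laurent_expansion_at_def by blast
  obtain x where x: "((\<lambda>k. ((zproj x - zproj z) powi k) *\<^sub>C A k) has_sum h x) UNIV" "zproj x \<noteq> zproj z"
    using eventually_happens'[OF F_nontriv eventually_conj[OF ev eventually_zproj_neq[OF z]]] by blast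
  define d where "d = cmod (zproj x - zproj z)"
  have d: "0 < d" using x(2) by (simp add: d_def)
  have bij: "bij_betw (\<lambda>n. m + int n) UNIV {m..}"
    by (rule bij_betw_byWitness[where f' = "\<lambda>k. nat (k - m)"]) auto
  have "(\<lambda>k. ((zproj x - zproj z) powi k) *\<^sub>C A k) summable_on {m..}"
    by (rule summable_on_subset_banach[OF has_sum_imp_summable[OF x(1)]]) simp
  then have "(\<lambda>n. ((zproj x - zproj z) powi (m + int n)) *\<^sub>C A (m + int n)) summable_on UNIV"
    by (subst summable_on_reindex_bij_betw[OF bij])
  then have "(\<lambda>n. ((zproj x - zproj z) powi (m + int n)) *\<^sub>C A (m + int n)) \<longlonglongrightarrow> 0"
    by (intro summable_LIMSEQ_zero summable_on_imp_summable)
  then have "Bseq (\<lambda>n. ((zproj x - zproj z) powi (m + int n)) *\<^sub>C A (m + int n))"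
    by (intro convergent_imp_Bseq convergentI)
  then obtain K where K: "\<And>n. norm (((zproj x - zproj z) powi (m + int n)) *\<^sub>C A (m + int n)) \<le> K"
    unfolding Bseq_def by blast
  \<comment> \<open>Half the distance of \<open>x\<close> keeps the ratio \<open>t\<close> below
    \<open>1\<close>.\<close>
  have "\<forall>\<^sub>F w in at z. dist (zproj w - zproj z) 0 < d / 2"
    by (rule tendstoD[OF tendsto_zproj_diff[OF z]]) (use d in simp)
  with ev eventually_zproj_neq[OF z] have "\<forall>\<^sub>F w in at z. abs_conv A w \<and> ((\<lambda>k. laurent_exp z k w *\<^sub>C A k) has_sum h w) UNIV"
  proof eventually_elim
    case (elim w)
    define t where "t = cmod (zproj w - zproj z) / d"
    have t: "0 < t" "t < 1" using elim d by (simp_all add: t_def field_simps)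
    have le: "cmod (laurent_exp z (m + int n) w) * norm (A (m + int n)) \<le> K * t powi m * t ^ n" for n
    proof -
      have "cmod (laurent_exp z (m + int n) w) = t powi (m + int n) * d powi (m + int n)"
        using d by (simp add: laurent_exp_def norm_power_int t_def power_int_divide_distrib)
      also have "\<dots> * norm (A (m + int n)) = t powi (m + int n) *
          norm (((zproj x - zproj z) powi (m + int n)) *\<^sub>C A (m + int n))"
        by (simp add: norm_scaleC norm_power_int d_def)
      also have "\<dots> \<le> t powi (m + int n) * K" using K t by (intro mult_left_mono) auto
      also have "\<dots> = K * t powi m * t ^ n" using t by (simp add: power_int_add)
      finally show ?thesis .
    qed
    have "summable (\<lambda>n. K * t powi m * t ^ n)" using t by (intro summable_mult summable_geometric) simp
    then have "summable (\<lambda>n. norm (cmod (laurent_exp z (m + int n) w) * norm (A (m + int n))))"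
      by (rule summable_comparison_test'[of _ 0]) (use le in simp)
    then have "(\<lambda>n. cmod (laurent_exp z (m + int n) w) * norm (A (m + int n))) summable_on UNIV"
      by (rule norm_summable_imp_summable_on)
    then have "(\<lambda>k. cmod (laurent_exp z k w) * norm (A k)) summable_on {m..}"
      by (subst (asm) summable_on_reindex_bij_betw[OF bij])
    moreover have "(\<lambda>k. cmod (laurent_exp z k w) * norm (A k)) summable_on UNIV \<longleftrightarrow>
        (\<lambda>k. cmod (laurent_exp z k w) * norm (A k)) summable_on {m..}"
      by (rule summable_on_cong_neutral) (auto simp: m)
    ultimately have "(\<lambda>k. cmod (laurent_exp z k w) * norm (A k)) summable_on UNIV" by simp
    then show ?case using elim by (simp add: abs_conv_def laurent_exp_def)
  qed
  moreover have "adm (hsupp A)"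
    by (rule adm_laurent[OF z, of _ m]) (use m in \<open>force simp: hsupp_def not_less[symmetric]\<close>)
  ultimately show ?thesis by (simp add: germ_def)
qed

text \<open>With the constant term removed, the difference quotient is the same series shifted down
  by one exponent, and its limit is the new constant term.\<close>

lemma laurent_has_zderiv:
  assumes z: "z \<noteq> 0" and h: "germs.germ (at z) (at z) (laurent_exp z) h A"
    and supp: "hsupp A \<subseteq> {0..}" and hz: "h z = A 0"
  shows "has_zderiv h (A 1) z"
proof -
  interpret germs "at z" "at z" "laurent_exp z" by (rule germs_laurent[OF z])
  have g: "germ (\<lambda>w. laurent_exp z (- 1) w *\<^sub>C (h w - h z)) (\<lambda>k. A (k - - 1) - (if k - - 1 = 0 then h z else 0))"
    by (rule germ_shift[OF germ_diff[OF h germ_const]])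
  have "hsupp (\<lambda>k. A (k - - 1) - (if k - - 1 = 0 then h z else 0)) \<subseteq> {0..}"
  proof
    fix k assume "k \<in> hsupp (\<lambda>k. A (k - - 1) - (if k - - 1 = 0 then h z else 0))"
    then have *: "A (k + 1) - (if k + 1 = 0 then h z else 0) \<noteq> 0" by (simp add: in_hsupp)
    then have "k + 1 \<noteq> 0" using hz by (metis diff_self)
    with * have "k + 1 \<in> hsupp A" "k + 1 \<noteq> 0" by (simp_all add: in_hsupp)
    then have "0 \<le> k + 1" "k + 1 \<noteq> 0" using supp by auto
    then show "k \<in> {0..}" by simp
  qed
  from germ_tendsto[OF g this]
  show ?thesis unfolding has_zderiv_def by (simp add: laurent_exp_def power_int_minus)
qed

subsection \<open>Taylor series of operator-valued functions\<close>

text \<open>The coefficients are operator-valued Cauchy integrals; the expansion itself only has to be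
  checked on matrix coefficients, which are scalar holomorphic functions.\<close>

lemma bop_taylor:
  fixes \<phi> :: "complex \<Rightarrow> 'h::complex_hilbert_space bop"
  assumes R: "0 < R" and cont: "continuous_on (ball c R) \<phi>"
    and hol: "\<And>x y. (\<lambda>w. matrix_coeff x y (\<phi> w)) holomorphic_on ball c R"
  shows "\<exists>A r. 0 < r \<and> (\<forall>w\<in>ball c r. ((\<lambda>k. (w - c) ^ k *\<^sub>C A k) has_sum \<phi> w) (UNIV :: nat set))"
proof -
  \<comment> \<open>A smaller radius, so that the circle of integration lies inside the open
    ball.\<close>
  define r where "r = R / 2"
  have r: "0 < r" "r < R" using R by (simp_all add: r_def)
  define E where "E t = of_real r * exp (2 * of_real pi * \<i> * of_real t)" for t :: real
  have normE: "cmod (E t) = r" for t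
    using r by (simp add: E_def norm_mult)
  have E_nz: "E t \<noteq> 0" for t using normE[of t] r by auto
  have contE: "continuous_on {0..1} E" unfolding E_def by (intro continuous_intros)
  have path: "circlepath c r = (\<lambda>t. c + E t)" by (simp add: circlepath E_def)
  have "continuous_on {0..1} (\<lambda>t. \<phi> (c + E t))"
    by (rule continuous_on_compose2[OF cont])
      (use contE normE r in \<open>auto intro!: continuous_intros simp: dist_norm\<close>)
  note contphi = this
  have "bounded ((\<lambda>t. \<phi> (c + E t)) ` {0..1})"
    by (intro compact_imp_bounded compact_continuous_image contphi compact_Icc)
  then obtain M where "\<forall>y\<in>(\<lambda>t. \<phi> (c + E t)) ` {0..1}. norm y \<le> M"
    unfolding bounded_iff ..
  then have M: "norm (\<phi> (c + E t)) \<le> M" if "t \<in> {0..1}" for t using that by simp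
  \<comment> \<open>Cauchy's integrand over the circle of radius \<open>r\<close>. Differentiating
    the path yields \<open>2 * pi * \<i> * E t\<close>, which cancels both the prefactor of Cauchy's
    formula and one power of \<open>E t\<close>; hence exponent \<open>k\<close> and no
    constant.\<close>
  define I where "I k t = inverse (E t) ^ k *\<^sub>C \<phi> (c + E t)" for k t
  define A where "A k = integral {0..1} (I k)" for k
  have contI: "continuous_on {0..1} (I k)" for k
    unfolding I_def[abs_def]
    by (rule bounded_bilinear.continuous_on[OF bounded_bilinear_scaleC _ contphi])
      (intro continuous_intros contE, simp add: E_nz)
  have normI: "norm (I k t) \<le> inverse r ^ k * M" if "t \<in> {0..1}" for k t
    using M[OF that] r by (simp add: I_def norm_scaleC norm_power norm_inverse normE mult_left_mono)
  have normA: "norm (A k) \<le> inverse r ^ k * M" for k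
    using integral_bound[OF _ contI, of k "inverse r ^ k * M"] normI[of _ k] by (simp add: A_def)
  have coeff: "matrix_coeff x y (A k) = (deriv ^^ k) (\<lambda>w. matrix_coeff x y (\<phi> w)) c / fact k" for x y k
  proof -
    let ?g = "\<lambda>w. matrix_coeff x y (\<phi> w)"
    have sub: "cball c r \<subseteq> ball c R" "ball c r \<subseteq> ball c R" using r by (auto intro: order_le_less_trans)
    have "((\<lambda>u. ?g u / (u - c) ^ Suc k) has_contour_integral
        (2 * pi * \<i>) / fact k * (deriv ^^ k) ?g c) (circlepath c r)"
      by (rule Cauchy_has_contour_integral_higher_derivative_circlepath)
        (use r sub in \<open>auto intro: holomorphic_on_subset[OF hol] continuous_on_subset[OF holomorphic_on_imp_continuous_on[OF hol]]\<close>)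
    then have "((\<lambda>t. ?g (c + E t) / E t ^ Suc k * vector_derivative (circlepath c r) (at t within {0..1}))
        has_integral (2 * pi * \<i>) / fact k * (deriv ^^ k) ?g c) {0..1}"
      unfolding has_contour_integral_def by (simp add: path)
    then have 1: "((\<lambda>t. (2 * pi * \<i>) * matrix_coeff x y (I k t)) has_integral
        (2 * pi * \<i>) / fact k * (deriv ^^ k) ?g c) {0..1}"
    proof (rule has_integral_eq[rotated])
      fix t :: real assume t: "t \<in> {0..1}"
      have "vector_derivative (circlepath c r) (at t within {0..1}) = 2 * pi * \<i> * E t"
        using t by (subst vector_derivative_circlepath01) (simp_all add: E_def)
      then show "?g (c + E t) / E t ^ Suc k * vector_derivative (circlepath c r) (at t within {0..1}) =
          (2 * pi * \<i>) * matrix_coeff x y (I k t)"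
        using E_nz[of t] by (simp add: I_def matrix_coeff_scaleC scaleC_complex_def power_inverse field_simps)
    qed
    have "(I k has_integral A k) {0..1}"
      unfolding A_def by (intro integrable_integral integrable_continuous_interval contI)
    from has_integral_linear[OF this bounded_linear_matrix_coeff]
    have "((\<lambda>t. matrix_coeff x y (I k t)) has_integral matrix_coeff x y (A k)) {0..1}"
      by (simp add: o_def)
    then have "((\<lambda>t. (2 * pi * \<i>) * matrix_coeff x y (I k t)) has_integral
        (2 * pi * \<i>) * matrix_coeff x y (A k)) {0..1}"
      by (rule has_integral_mult_right)
    from has_integral_unique[OF this 1] show ?thesis by (simp add: field_simps)
  qed
  have "((\<lambda>k. (w - c) ^ k *\<^sub>C A k) has_sum \<phi> w) UNIV" if w: "w \<in> ball c r" for w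
  proof -
    have "cmod (w - c) < r" using w by (simp add: dist_norm norm_minus_commute)
    then have q: "cmod (w - c) / r < 1" "0 \<le> cmod (w - c) / r" using r by simp_all
    \<comment> \<open>Cauchy's estimate for the coefficients, giving a geometric majorant inside the
      circle.\<close>
    have le: "norm ((w - c) ^ k *\<^sub>C A k) \<le> M * (cmod (w - c) / r) ^ k" for k
    proof -
      have "norm ((w - c) ^ k *\<^sub>C A k) \<le> cmod (w - c) ^ k * (inverse r ^ k * M)"
        using normA[of k] by (simp add: norm_scaleC norm_power mult_left_mono)
      also have "\<dots> = M * (cmod (w - c) / r) ^ k"
        by (simp add: power_divide power_inverse divide_inverse power_mult_distrib)
      finally show ?thesis .
    qed
    have "summable (\<lambda>k. M * (cmod (w - c) / r) ^ k)"
      using q by (intro summable_mult summable_geometric) simp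
    then have "summable (\<lambda>k. norm ((w - c) ^ k *\<^sub>C A k))"
      by (rule summable_comparison_test'[where N = 0]) (use le in simp)
    then have "(\<lambda>k. (w - c) ^ k *\<^sub>C A k) summable_on UNIV" by (rule norm_summable_imp_summable_on)
    then obtain S where S: "((\<lambda>k. (w - c) ^ k *\<^sub>C A k) has_sum S) UNIV" unfolding summable_on_def ..
    have "S = \<phi> w"
    proof (rule bop_eq_matrix_coeffI)
      fix x y
      let ?g = "\<lambda>w. matrix_coeff x y (\<phi> w)"
      have "((\<lambda>k. matrix_coeff x y ((w - c) ^ k *\<^sub>C A k)) has_sum matrix_coeff x y S) UNIV"
        by (rule has_sum_bounded_linear[OF bounded_linear_matrix_coeff S])
      then have "(\<lambda>k. (deriv ^^ k) ?g c / fact k * (w - c) ^ k) sums matrix_coeff x y S"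
        by (intro has_sum_imp_sums) (simp add: matrix_coeff_scaleC scaleC_complex_def coeff mult.commute)
      moreover have "(\<lambda>k. (deriv ^^ k) ?g c / fact k * (w - c) ^ k) sums ?g w"
        by (rule holomorphic_power_series[OF holomorphic_on_subset[OF hol] w]) (use r in auto)
      ultimately show "matrix_coeff x y S = ?g w" by (rule sums_unique2)
    qed
    with S show ?thesis by simp
  qed
  then show ?thesis using r(1) by (intro exI[of _ A] exI[of _ r]) simp
qed

text \<open>Composition with the section \<open>\<sigma>\<close> moves \<open>f\<close> to a ball in
  the plane, where the scalar theory applies to its matrix coefficients; the Taylor series found
  there is carried back by \<open>zproj\<close>.\<close>

lemma bop_laurent_of_holomorphic:
  fixes f :: "logcover0 \<Rightarrow> 'h::complex_hilbert_space bop"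
  assumes z: "z \<noteq> 0" and f: "\<forall>\<^sub>F w in nhds z. \<exists>D. has_zderiv f D w"
  shows "\<exists>A. has_laurent_expansion_at f z A \<and> (\<forall>k<0. A k = 0)"
proof -
  define c where "c = zproj z"
  define \<sigma> where "\<sigma> = zsection z"
  have sc: "\<sigma> c = z" unfolding \<sigma>_def c_def by (rule zsection_zproj[OF z])
  have "(\<sigma> \<longlongrightarrow> \<sigma> c) (nhds c)"
    unfolding \<sigma>_def c_def using zmod_pos[OF z] by (intro tendsto_zsection[OF z]) simp
  then have "\<forall>\<^sub>F w in nhds c. \<exists>D. has_zderiv f D (\<sigma> w)"
    using f unfolding sc by (rule eventually_compose_filterlim[rotated])
  then obtain R0 where R0: "0 < R0" "\<And>w. dist w c < R0 \<Longrightarrow> \<exists>D. has_zderiv f D (\<sigma> w)"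
    unfolding eventually_nhds_metric by auto
  define R where "R = min R0 (zmod z)"
  have R: "0 < R" using R0(1) zmod_pos[OF z] by (simp add: R_def)
  have ball: "w \<in> ball (zproj z) (zmod z)" if "w \<in> ball c R" for w
    using that by (simp add: R_def c_def)
  have ex_D: "\<exists>D. has_zderiv f D (\<sigma> w)" if "w \<in> ball c R" for w
    using that by (intro R0(2)) (simp add: R_def dist_commute)
  have snz: "\<sigma> w \<noteq> 0" if "w \<in> ball c R" for w
    unfolding \<sigma>_def by (rule zsection_nonzero[OF z ball[OF that]])
  have lim: "filterlim \<sigma> (at (\<sigma> w)) (at w)" if "w \<in> ball c R" for w
    unfolding \<sigma>_def by (rule filterlim_zsection_at[OF z ball[OF that]])
  have inv: "zproj (\<sigma> w) = w" if "w \<in> ball c R" for w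
    unfolding \<sigma>_def by (rule zproj_zsection[OF z ball[OF that]])
  have "isCont (\<lambda>w. f (\<sigma> w)) w" if w: "w \<in> ball c R" for w
  proof -
    obtain D where "has_zderiv f D (\<sigma> w)" using ex_D[OF w] ..
    then have "(f \<longlongrightarrow> f (\<sigma> w)) (at (\<sigma> w))" by (rule has_zderiv_continuous[OF snz[OF w]])
    then show ?thesis unfolding isCont_def by (rule filterlim_compose[OF _ lim[OF w]])
  qed
  then have cont: "continuous_on (ball c R) (\<lambda>w. f (\<sigma> w))" by (intro continuous_at_imp_continuous_on) simp
  have hol: "(\<lambda>w. matrix_coeff x y (f (\<sigma> w))) holomorphic_on ball c R" for x y
    unfolding holomorphic_on_open[OF open_ball]
  proof
    fix w assume w: "w \<in> ball c R"
    obtain D where "has_zderiv f D (\<sigma> w)" using ex_D[OF w] ..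
    then have "((\<lambda>v. inverse (zproj v - w) *\<^sub>C (f v - f (\<sigma> w))) \<longlongrightarrow> D) (at (\<sigma> w))"
      unfolding has_zderiv_def inv[OF w] .
    from filterlim_compose[OF this lim[OF w]]
    have "((\<lambda>u. inverse (zproj (\<sigma> u) - w) *\<^sub>C (f (\<sigma> u) - f (\<sigma> w))) \<longlongrightarrow> D) (at w)" .
    from bounded_linear.tendsto[OF bounded_linear_matrix_coeff this]
    have "((\<lambda>u. matrix_coeff x y (inverse (zproj (\<sigma> u) - w) *\<^sub>C (f (\<sigma> u) - f (\<sigma> w)))) \<longlongrightarrow>
        matrix_coeff x y D) (at w)" .
    moreover have "\<forall>\<^sub>F u in at w. u \<in> ball c R" using w by (intro eventually_at_in_open') auto
    then have "\<forall>\<^sub>F u in at w. matrix_coeff x y (inverse (zproj (\<sigma> u) - w) *\<^sub>C (f (\<sigma> u) - f (\<sigma> w))) =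
        (matrix_coeff x y (f (\<sigma> u)) - matrix_coeff x y (f (\<sigma> w))) / (u - w)"
    proof eventually_elim
      case (elim u)
      show ?case
        using linear_diff[OF bounded_linear.linear[OF bounded_linear_matrix_coeff[of x y]]]
        by (simp add: inv[OF elim] matrix_coeff_scaleC scaleC_complex_def divide_inverse mult.commute)
    qed
    ultimately have "((\<lambda>u. (matrix_coeff x y (f (\<sigma> u)) - matrix_coeff x y (f (\<sigma> w))) / (u - w)) \<longlongrightarrow>
        matrix_coeff x y D) (at w)" by (rule Lim_transform_eventually)
    then show "\<exists>f'. ((\<lambda>w. matrix_coeff x y (f (\<sigma> w))) has_field_derivative f') (at w)"
      unfolding has_field_derivative_iff by (rule exI)
  qed
  obtain A r where r: "0 < r" "\<forall>w\<in>ball c r. ((\<lambda>k. (w - c) ^ k *\<^sub>C A k) has_sum f (\<sigma> w)) UNIV"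
    using bop_taylor[OF R cont hol] by auto
  define B where "B k = (if k < 0 then 0 else A (nat k))" for k :: int
  have "\<forall>\<^sub>F w in nhds z. dist (zproj w) (zproj z) < r"
    by (rule tendstoD[OF tendsto_zproj[OF z] r(1)])
  with eventually_zsection[OF z]
  have "\<forall>\<^sub>F w in nhds z. ((\<lambda>k. ((zproj w - zproj z) powi k) *\<^sub>C B k) has_sum f w) UNIV"
  proof eventually_elim
    case (elim w)
    have bij: "bij_betw int UNIV {0..}" by (rule bij_betw_byWitness[where f' = nat]) auto
    have "((\<lambda>k. (zproj w - c) ^ k *\<^sub>C A k) has_sum f (\<sigma> (zproj w))) UNIV"
      using elim(2) by (intro r(2)[rule_format]) (simp add: c_def dist_commute)
    then have "((\<lambda>n. ((zproj w - zproj z) powi (int n)) *\<^sub>C B (int n)) has_sum f w) UNIV"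
      using elim(1) by (simp add: B_def c_def \<sigma>_def)
    then have "((\<lambda>k. ((zproj w - zproj z) powi k) *\<^sub>C B k) has_sum f w) {0..}"
      by (subst (asm) has_sum_reindex_bij_betw[OF bij])
    moreover have "((\<lambda>k. ((zproj w - zproj z) powi k) *\<^sub>C B k) has_sum f w) {0..} \<longleftrightarrow>
        ((\<lambda>k. ((zproj w - zproj z) powi k) *\<^sub>C B k) has_sum f w) UNIV"
      by (rule has_sum_cong_neutral) (auto simp: B_def)
    ultimately show ?case by simp
  qed
  then have "\<forall>\<^sub>F w in at z. ((\<lambda>k. ((zproj w - zproj z) powi k) *\<^sub>C B k) has_sum f w) UNIV"
    unfolding eventually_at_filter by eventually_elim simp
  moreover have "\<forall>k<0. B k = 0" by (simp add: B_def)
  ultimately show ?thesis unfolding has_laurent_expansion_at_def by (intro exI[of _ B]) auto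
qed

section \<open>Hahn holomorphic functions as germs at zero\<close>

context hahn_exponents
begin

lemma eventually_zero: "eventually P (at 0 within Y) \<longleftrightarrow> (\<exists>\<epsilon>>0. \<forall>z\<in>Y \<inter> zdisc \<epsilon>. P z)"
  by (rule eventually_at_zero[OF zero_notin_Y])

lemma eventually_FB_iff:
  "eventually P (filtermap zreal (at_right 0)) \<longleftrightarrow> (\<exists>r>0. \<forall>x\<in>{0<..<r}. P (zreal x))"
  unfolding eventually_filtermap eventually_at_right_field by auto

lemma e_zero: "z \<in> Y \<Longrightarrow> e 0 z = 1"
  using e_add[of z 0 0] e_nonzero[of z 0] by simp

sublocale germs "at 0 within Y" "filtermap zreal (at_right 0)" e
proof
  obtain \<delta> where \<delta>: "0 < \<delta>" "zreal ` {0<..<\<delta>} \<subseteq> Y" using interval_in_Y by blast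
  show "filtermap zreal (at_right 0) \<le> at 0 within Y"
    unfolding le_filter_def
  proof (intro allI impI)
    fix P assume "eventually P (at 0 within Y)"
    then obtain \<epsilon> where \<epsilon>: "0 < \<epsilon>" "\<forall>z\<in>Y \<inter> zdisc \<epsilon>. P z" unfolding eventually_zero by auto
    have "P (zreal x)" if "x \<in> {0<..<min \<epsilon> \<delta>}" for x
    proof -
      have "zreal x \<in> Y" using \<delta>(2) that by auto
      moreover have "zreal x \<in> zdisc \<epsilon>" using that by (simp add: zdisc_def zmod_zreal)
      ultimately show ?thesis using \<epsilon>(2) by simp
    qed
    then show "eventually P (filtermap zreal (at_right 0))"
      unfolding eventually_FB_iff using \<epsilon>(1) \<delta>(1) by (intro exI[of _ "min \<epsilon> \<delta>"]) simp
  qed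
  show "filtermap zreal (at_right 0) \<noteq> bot" by (simp add: filtermap_bot_iff)
  show "\<forall>\<^sub>F z in at 0 within Y. \<forall>\<alpha> \<beta>. e (\<alpha> + \<beta>) z = e \<alpha> z * e \<beta> z \<and> e \<alpha> z \<noteq> 0"
    unfolding eventually_zero using e_add e_nonzero by (intro exI[of _ 1]) simp
  show "(e \<gamma> \<longlongrightarrow> 0) (at 0 within Y)" if "0 < \<gamma>" for \<gamma>
    using e_tendsto_0[OF that] by (simp add: tendsto_norm_zero_iff)
qed

lemma exp_bdd_above:
  assumes "Y' \<subseteq> Y" "0 \<le> \<alpha>"
  shows "bdd_above ((\<lambda>z. cmod (e \<alpha> z)) ` (Y' \<inter> zdisc \<epsilon>))"
proof (cases "\<alpha> = 0")
  case True
  then show ?thesis using assms by (intro bdd_aboveI[of _ 1]) (auto simp: e_zero)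
next
  case False
  then have "bounded (e \<alpha> ` Y)" using assms by (intro e_bounded) simp
  then obtain K where "\<And>z. z \<in> Y \<Longrightarrow> cmod (e \<alpha> z) \<le> K" unfolding bounded_iff by auto
  then show ?thesis using assms by (intro bdd_aboveI[of _ K]) auto
qed

lemma exp_le_exp_norm:
  assumes "Y' \<subseteq> Y" "0 \<le> \<alpha>" "z \<in> Y' \<inter> zdisc \<epsilon>"
  shows "cmod (e \<alpha> z) \<le> exp_norm Y' e \<epsilon> \<alpha>"
  unfolding exp_norm_def by (rule cSUP_upper[OF assms(3) exp_bdd_above[OF assms(1,2)]])

lemma small_points:
  assumes "0 < \<delta>"
  shows "\<exists>r>0. zreal ` {0<..<r} \<subseteq> Y \<inter> zdisc \<delta>"
proof -
  obtain \<delta>' where \<delta>': "0 < \<delta>'" "zreal ` {0<..<\<delta>'} \<subseteq> Y" using interval_in_Y by blast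
  show ?thesis
  proof (intro exI[of _ "min \<delta>' \<delta>"] conjI subsetI)
    fix z assume "z \<in> zreal ` {0<..<min \<delta>' \<delta>}"
    then obtain x where x: "z = zreal x" "0 < x" "x < \<delta>'" "x < \<delta>" by auto
    then have "z \<in> Y" using \<delta>'(2) by auto
    then show "z \<in> Y \<inter> zdisc \<delta>" using x by (simp add: zdisc_def zmod_zreal)
  qed (use \<delta>'(1) assms in simp)
qed

lemma small_points_nonempty: "0 < \<delta> \<Longrightarrow> Y \<inter> zdisc \<delta> \<noteq> {}"
proof -
  assume "0 < \<delta>"
  then obtain r where r: "0 < r" "zreal ` {0<..<r} \<subseteq> Y \<inter> zdisc \<delta>" using small_points[of \<delta>] by blast
  then have "zreal (r / 2) \<in> Y \<inter> zdisc \<delta>" by (auto intro!: subsetD[OF r(2)])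
  then show ?thesis by auto
qed

text \<open>Suprema over \<open>Y'\<close> near \<open>0\<close> bound the values there. The
  exponents are non-negative, which makes the suprema finite; the domain \<open>Y'\<close> stands
  for \<open>Y\<close> itself or for its intersection with a disc.\<close>

lemma wm_of_weakly_monotonous:
  assumes \<delta>: "0 < \<delta>" "Y \<inter> zdisc \<delta> \<subseteq> Y'" "Y' \<subseteq> Y" and S: "S \<subseteq> {0..}" and wm: "weakly_monotonous Y' e S"
  shows "wm S"
proof -
  obtain r where r: "0 < r" "\<And>x. x \<in> {0<..<r} \<Longrightarrow> \<exists>\<rho>. 0 < \<rho> \<and> \<rho> \<le> x \<and>
      (\<forall>\<alpha>\<in>S. exp_norm Y' e \<rho> \<alpha> \<le> cmod (e \<alpha> (zreal x)))"
    using wm unfolding weakly_monotonous_def by auto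
  have "\<forall>\<^sub>F z in at 0 within Y. \<forall>\<alpha>\<in>S. cmod (e \<alpha> z) \<le> cmod (e \<alpha> (zreal x))" if x: "x \<in> {0<..<r}" for x
  proof -
    obtain \<rho> where \<rho>: "0 < \<rho>" "\<forall>\<alpha>\<in>S. exp_norm Y' e \<rho> \<alpha> \<le> cmod (e \<alpha> (zreal x))" using r(2)[OF x] by auto
    have "cmod (e \<alpha> z) \<le> cmod (e \<alpha> (zreal x))" if "z \<in> Y \<inter> zdisc (min \<rho> \<delta>)" "\<alpha> \<in> S" for z \<alpha>
    proof -
      have "z \<in> Y' \<inter> zdisc \<rho>" "Y' \<subseteq> Y" using that \<delta> by (auto simp: zdisc_def)
      moreover have "0 \<le> \<alpha>" using that S by auto
      ultimately have "cmod (e \<alpha> z) \<le> exp_norm Y' e \<rho> \<alpha>" by (intro exp_le_exp_norm)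
      also have "\<dots> \<le> cmod (e \<alpha> (zreal x))" using \<rho>(2) that by simp
      finally show ?thesis .
    qed
    then show ?thesis unfolding eventually_zero using \<rho>(1) \<delta>(1) by (intro exI[of _ "min \<rho> \<delta>"]) simp
  qed
  then show ?thesis unfolding wm_def eventually_FB_iff using r(1) by (intro exI[of _ r]) simp
qed

lemma exp_norm_le:
  assumes \<rho>: "0 < \<rho>" "0 < \<delta>" "Y' = Y \<inter> zdisc \<delta>"
    and le: "\<And>z. z \<in> Y \<inter> zdisc \<rho> \<Longrightarrow> cmod (e \<alpha> z) \<le> K"
  shows "exp_norm Y' e \<rho> \<alpha> \<le> K"
  unfolding exp_norm_def
proof (rule cSUP_least)
  have "Y' \<inter> zdisc \<rho> = Y \<inter> zdisc (min \<delta> \<rho>)" unfolding \<rho>(3) by (auto simp: zdisc_def)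
  then show "Y' \<inter> zdisc \<rho> \<noteq> {}" using small_points_nonempty[of "min \<delta> \<rho>"] \<rho> by simp
  show "cmod (e \<alpha> z) \<le> K" if "z \<in> Y' \<inter> zdisc \<rho>" for z using that \<rho>(3) by (intro le) auto
qed

lemma weakly_monotonous_of_wm:
  assumes \<delta>: "0 < \<delta>" "Y' = Y \<inter> zdisc \<delta>" and wm: "wm S"
  shows "weakly_monotonous Y' e S"
proof -
  obtain r where r: "0 < r" "\<And>x. x \<in> {0<..<r} \<Longrightarrow>
      \<forall>\<^sub>F z in at 0 within Y. \<forall>\<alpha>\<in>S. cmod (e \<alpha> z) \<le> cmod (e \<alpha> (zreal x))"
    using wm unfolding wm_def eventually_FB_iff by auto
  obtain r' where r': "0 < r'" "zreal ` {0<..<r'} \<subseteq> Y'" using small_points[OF \<delta>(1)] \<delta>(2) by auto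
  have "\<exists>\<rho>. 0 < \<rho> \<and> \<rho> \<le> x \<and> (\<forall>\<alpha>\<in>S. exp_norm Y' e \<rho> \<alpha> \<le> cmod (e \<alpha> (zreal x)))"
    if x: "x \<in> {0<..<min r r'}" for x
  proof -
    have "x \<in> {0<..<r}" using x by simp
    from r(2)[OF this] obtain \<rho> where \<rho>: "0 < \<rho>"
      "\<forall>z\<in>Y \<inter> zdisc \<rho>. \<forall>\<alpha>\<in>S. cmod (e \<alpha> z) \<le> cmod (e \<alpha> (zreal x))"
      unfolding eventually_zero by auto
    have "exp_norm Y' e (min \<rho> x) \<alpha> \<le> cmod (e \<alpha> (zreal x))" if "\<alpha> \<in> S" for \<alpha>
      by (rule exp_norm_le[OF _ \<delta>]) (use \<rho> x that in \<open>auto simp: zdisc_def\<close>)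
    then show ?thesis using \<rho>(1) x by (intro exI[of _ "min \<rho> x"]) simp
  qed
  moreover have "zreal ` {0<..<min r r'} \<subseteq> Y'" using r'(2) by (rule order_trans[rotated]) auto
  ultimately show ?thesis
    unfolding weakly_monotonous_def using r(1) r'(1) by (intro exI[of _ "min r r'"]) simp
qed

text \<open>The singletons among the sets \<open>B\<close> already give domination of the gaps at
  each single exponent of \<open>S\<close>.\<close>

lemma admissible_imp_adm:
  assumes \<delta>: "0 < \<delta>" "Y \<inter> zdisc \<delta> \<subseteq> Y'" "Y' \<subseteq> Y" and S: "admissible Y' e S"
  shows "adm S"
  unfolding adm_def
proof (intro conjI ballI)
  show "well_ordered S" using S by (simp add: admissible_def)
  fix m assume m: "m \<in> S"
  have L: "(LEAST \<beta>. \<beta> \<in> {m}) = m" by (rule Least_equality) auto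
  have "weakly_monotonous Y' e {\<alpha> - (LEAST \<beta>. \<beta> \<in> {m}) |\<alpha>. \<alpha> \<in> S \<and> (LEAST \<beta>. \<beta> \<in> {m}) < \<alpha>}"
    using S m unfolding admissible_def by auto
  then have "wm {\<alpha> - m |\<alpha>. \<alpha> \<in> S \<and> m < \<alpha>}"
    unfolding L by (rule wm_of_weakly_monotonous[OF \<delta>, rotated]) auto
  \<comment> \<open>\<open>admissible\<close> takes strict inequalities while \<open>gaps\<close>
    contains the difference \<open>0\<close>.\<close>
  then have "wm ({\<alpha> - m |\<alpha>. \<alpha> \<in> S \<and> m < \<alpha>} \<union> {0})" by (intro wm_Un wm_single) simp_all
  then show "wm (gaps S m)" by (rule wm_subset) (auto simp: gaps_def order_le_less)
qed

text \<open>\<open>wm_gaps\<close> covers an arbitrary shift, in particular the least element of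
  each \<open>B\<close>, and exponents strictly above the shift form a subset of the gaps.\<close>

lemma adm_imp_admissible:
  assumes \<delta>: "0 < \<delta>" "Y' = Y \<inter> zdisc \<delta>" and S: "adm S" "S \<subseteq> {0..}"
  shows "admissible Y' e S"
  unfolding admissible_def
proof (intro conjI allI impI)
  show "S \<subseteq> {0..}" by (rule S(2))
  show "well_ordered S" by (rule admD[OF S(1)])
  have "gaps S 0 = S" using S(2) by (auto simp: gaps_def)
  then have "wm S" using wm_gaps[OF S(1), of 0] by simp
  then show "weakly_monotonous Y' e S" by (rule weakly_monotonous_of_wm[OF \<delta>])
  fix B
  have "wm {\<alpha> - (LEAST \<beta>. \<beta> \<in> B) |\<alpha>. \<alpha> \<in> S \<and> (LEAST \<beta>. \<beta> \<in> B) < \<alpha>}"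
    by (rule wm_subset[OF wm_gaps[OF S(1), of "LEAST \<beta>. \<beta> \<in> B"]]) (auto simp: gaps_def)
  then show "weakly_monotonous Y' e {\<alpha> - (LEAST \<beta>. \<beta> \<in> B) |\<alpha>. \<alpha> \<in> S \<and> (LEAST \<beta>. \<beta> \<in> B) < \<alpha>}"
    by (rule weakly_monotonous_of_wm[OF \<delta>])
qed

lemma hahn_holomorphic_germ:
  assumes \<delta>: "0 < \<delta>" "Y \<inter> zdisc \<delta> \<subseteq> Y'" "Y' \<subseteq> Y" and h: "hahn_holomorphic_with Y' e R h a"
  shows "germ h a" "hsupp a \<subseteq> {0..}"
proof -
  have S: "admissible Y' e (hsupp a)" using h by (simp add: hahn_holomorphic_with_def)
  then show supp: "hsupp a \<subseteq> {0..}" by (simp add: admissible_def)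
  obtain \<epsilon> where \<epsilon>: "0 < \<epsilon>" "normally_convergent Y' e \<epsilon> a"
    "\<And>z. z \<in> Y' \<inter> zdisc \<epsilon> \<Longrightarrow> ((\<lambda>\<gamma>. e \<gamma> z *\<^sub>C a \<gamma>) has_sum h z) (hsupp a)"
    using h unfolding hahn_holomorphic_with_def by auto
  have "abs_conv a z \<and> ((\<lambda>\<gamma>. e \<gamma> z *\<^sub>C a \<gamma>) has_sum h z) UNIV" if z: "z \<in> Y' \<inter> zdisc \<epsilon>" for z
  proof
    have "(\<lambda>\<gamma>. cmod (e \<gamma> z) * norm (a \<gamma>)) summable_on hsupp a"
    proof (rule summable_on_comparison_test)
      show "(\<lambda>\<gamma>. norm (a \<gamma>) * exp_norm Y' e \<epsilon> \<gamma>) summable_on hsupp a"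
        using \<epsilon>(2) by (simp add: normally_convergent_def)
      fix \<gamma> assume "\<gamma> \<in> hsupp a"
      then have "0 \<le> \<gamma>" using supp by auto
      from exp_le_exp_norm[OF \<delta>(3) this z]
      show "cmod (e \<gamma> z) * norm (a \<gamma>) \<le> norm (a \<gamma>) * exp_norm Y' e \<epsilon> \<gamma>"
        by (subst mult.commute) (simp add: mult_left_mono)
    qed simp
    moreover have "(\<lambda>\<gamma>. cmod (e \<gamma> z) * norm (a \<gamma>)) summable_on hsupp a \<longleftrightarrow>
        (\<lambda>\<gamma>. cmod (e \<gamma> z) * norm (a \<gamma>)) summable_on UNIV"
      by (rule summable_on_cong_neutral) auto
    ultimately show "abs_conv a z" by (simp add: abs_conv_def)
    have "((\<lambda>\<gamma>. e \<gamma> z *\<^sub>C a \<gamma>) has_sum h z) (hsupp a) \<longleftrightarrow> ((\<lambda>\<gamma>. e \<gamma> z *\<^sub>C a \<gamma>) has_sum h z) UNIV"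
      by (rule has_sum_cong_neutral) auto
    then show "((\<lambda>\<gamma>. e \<gamma> z *\<^sub>C a \<gamma>) has_sum h z) UNIV" using \<epsilon>(3)[OF z] by simp
  qed
  moreover have "z \<in> Y' \<inter> zdisc \<epsilon>" if "z \<in> Y \<inter> zdisc (min \<epsilon> \<delta>)" for z
    using that \<delta>(2) by (auto simp: zdisc_def)
  ultimately have "\<forall>\<^sub>F z in at 0 within Y. abs_conv a z \<and> ((\<lambda>\<gamma>. e \<gamma> z *\<^sub>C a \<gamma>) has_sum h z) UNIV"
    unfolding eventually_zero using \<epsilon>(1) \<delta>(1) by (intro exI[of _ "min \<epsilon> \<delta>"]) simp
  then show "germ h a" using admissible_imp_adm[OF \<delta> S] by (simp add: germ_def)
qed

text \<open>Normal convergence from one point: at a base point \<open>x\<close> with absolute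
  convergence and domination, the sup norm of \<open>e \<gamma>\<close> on a small disc is at most
  \<open>cmod (e \<gamma> x)\<close>, so the series at \<open>x\<close> is a majorant. Countability
  of the support also follows from summability at \<open>x\<close>.\<close>

lemma hahn_holomorphic_withI:
  assumes \<delta>: "0 < \<delta>" "Y' = Y \<inter> zdisc \<delta>" and h: "germ h a" "hsupp a \<subseteq> {0..}"
    and cont: "continuous_on (insert 0 Y') h" and hol: "zholomorphic_on h Y'"
  shows "hahn_holomorphic_with Y' e UNIV h a"
proof -
  have "gaps (hsupp a) 0 = hsupp a" using h(2) by (auto simp: gaps_def)
  then have "wm (hsupp a)" using wm_gaps[OF germ_adm[OF h(1)], of 0] by simp
  then have "\<forall>\<^sub>F x in filtermap zreal (at_right 0). abs_conv a x \<and> isexp x \<and>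
      (\<forall>\<^sub>F z in at 0 within Y. \<forall>\<gamma>\<in>hsupp a. cmod (e \<gamma> z) \<le> cmod (e \<gamma> x))"
    using eventually_FB[OF germ_ev[OF h(1)]] eventually_FB[OF eventually_isexp]
    unfolding wm_def by eventually_elim simp
  then obtain x where x: "abs_conv a x" "isexp x"
    "\<forall>\<^sub>F z in at 0 within Y. \<forall>\<gamma>\<in>hsupp a. cmod (e \<gamma> z) \<le> cmod (e \<gamma> x)"
    using eventually_happens'[OF FB_nontriv] by blast
  obtain \<rho> where \<rho>: "0 < \<rho>" "\<And>z \<gamma>. z \<in> Y \<inter> zdisc \<rho> \<Longrightarrow> \<gamma> \<in> hsupp a \<Longrightarrow> cmod (e \<gamma> z) \<le> cmod (e \<gamma> x)"
    "\<And>z. z \<in> Y \<inter> zdisc \<rho> \<Longrightarrow> ((\<lambda>\<gamma>. e \<gamma> z *\<^sub>C a \<gamma>) has_sum h z) UNIV"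
    using eventually_conj[OF x(3) germ_ev[OF h(1)]] unfolding eventually_zero by auto
  have sub: "Y' \<subseteq> Y" using \<delta>(2) by auto
  have "(\<lambda>\<gamma>. norm (a \<gamma>) * exp_norm Y' e \<rho> \<gamma>) summable_on hsupp a"
  proof (rule summable_on_comparison_test)
    show "(\<lambda>\<gamma>. cmod (e \<gamma> x) * norm (a \<gamma>)) summable_on hsupp a"
      by (rule summable_on_subset_banach[of _ UNIV]) (use x(1) in \<open>simp_all add: abs_conv_def\<close>)
    fix \<gamma> assume g: "\<gamma> \<in> hsupp a"
    have "exp_norm Y' e \<rho> \<gamma> \<le> cmod (e \<gamma> x)"
      by (rule exp_norm_le[OF \<rho>(1) \<delta>]) (rule \<rho>(2)[OF _ g])
    then show "norm (a \<gamma>) * exp_norm Y' e \<rho> \<gamma> \<le> cmod (e \<gamma> x) * norm (a \<gamma>)"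
      by (subst (2) mult.commute) (simp add: mult_left_mono)
    \<comment> \<open>The supremum runs over a non-empty set; one of its points shows that it is
      non-negative.\<close>
    obtain y where y: "y \<in> Y \<inter> zdisc (min \<delta> \<rho>)" using small_points_nonempty[of "min \<delta> \<rho>"] \<rho>(1) \<delta>(1) by auto
    then have "y \<in> Y' \<inter> zdisc \<rho>" unfolding \<delta>(2) by (simp add: zdisc_def)
    then have "cmod (e \<gamma> y) \<le> exp_norm Y' e \<rho> \<gamma>" using g h(2) by (intro exp_le_exp_norm[OF sub]) auto
    then have "0 \<le> exp_norm Y' e \<rho> \<gamma>" using norm_ge_zero order_trans by blast
    then show "0 \<le> norm (a \<gamma>) * exp_norm Y' e \<rho> \<gamma>" by simp
  qed
  moreover have "countable (hsupp a)"
  proof -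
    have "countable {\<gamma>\<in>UNIV. cmod (e \<gamma> x) * norm (a \<gamma>) \<noteq> 0}"
      by (rule abs_summable_countable) (use x(1) in \<open>simp add: abs_conv_def abs_mult\<close>)
    moreover have "{\<gamma>\<in>UNIV. cmod (e \<gamma> x) * norm (a \<gamma>) \<noteq> 0} = hsupp a"
      using exp_nonzero[OF x(2)] by (auto simp: hsupp_def)
    ultimately show ?thesis by simp
  qed
  moreover have "((\<lambda>\<gamma>. e \<gamma> z *\<^sub>C a \<gamma>) has_sum h z) (hsupp a)" if "z \<in> Y' \<inter> zdisc \<rho>" for z
  proof -
    have "((\<lambda>\<gamma>. e \<gamma> z *\<^sub>C a \<gamma>) has_sum h z) (hsupp a) \<longleftrightarrow> ((\<lambda>\<gamma>. e \<gamma> z *\<^sub>C a \<gamma>) has_sum h z) UNIV"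
      by (rule has_sum_cong_neutral) auto
    then show ?thesis using \<rho>(3)[of z] that sub by auto
  qed
  ultimately show ?thesis
    unfolding hahn_holomorphic_with_def normally_convergent_def
    using cont hol adm_imp_admissible[OF \<delta> germ_adm[OF h(1)] h(2)] \<rho>(1)
    by (intro conjI exI[of _ \<rho>]) auto
qed

end

section \<open>The analytic Fredholm theorem\<close>

lemma bop_inverse_unique:
  fixes S S' T :: "'a::monoid_mult"
  assumes "S * T = 1" "T * S' = 1"
  shows "S = S'"
  by (metis assms mult.assoc mult_1_left mult_1_right)

text \<open>With \<open>S\<close> the inverse of \<open>T0\<close>, write
  \<open>T w = T0 * (1 - S * (T0 - T w))\<close>; the second factor is inverted by a geometric
  series once \<open>T w\<close> is close to \<open>T0\<close>.\<close>

lemma eventually_bop_invertible: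
  fixes T :: "'z \<Rightarrow> 'h::complex_hilbert_space bop"
  assumes lim: "(T \<longlongrightarrow> T0) F" and inv: "bop_invertible T0"
  shows "\<forall>\<^sub>F w in F. bop_invertible (T w)"
proof -
  obtain S where S: "S * T0 = 1" "T0 * S = 1" using inv unfolding bop_invertible_def by blast
  have "((\<lambda>w. S * (T0 - T w)) \<longlongrightarrow> S * (T0 - T0)) F" by (intro tendsto_intros lim)
  then have "((\<lambda>w. S * (T0 - T w)) \<longlongrightarrow> 0) F" by simp
  from tendstoD[OF this, of 1] have "\<forall>\<^sub>F w in F. norm (S * (T0 - T w)) < 1" by simp
  then show ?thesis
  proof eventually_elim
    case (elim w)
    obtain r where r: "r * (1 - S * (T0 - T w)) = 1" "(1 - S * (T0 - T w)) * r = 1"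
      using banach_geometric_inverse[OF elim] by auto
    have Tw: "T w = T0 * (1 - S * (T0 - T w))"
      by (simp add: right_diff_distrib mult.assoc[symmetric] S)
    show ?case
    proof (rule bop_invertibleI)
      have "r * S * T w = r * (S * T0) * (1 - S * (T0 - T w))" by (subst Tw) (simp only: mult.assoc)
      then show "r * S * T w = 1" using r S by simp
      have "T w * (r * S) = T0 * ((1 - S * (T0 - T w)) * r) * S" by (subst Tw) (simp only: mult.assoc)
      then show "T w * (r * S) = 1" using r S by simp
    qed
  qed
qed

text \<open>From \<open>S w - S0 = S w * (T0 - T w) * S0\<close> one gets a bound that still
  contains \<open>S w\<close>. When the product \<open>d\<close> of the last two norms is below
  \<open>1/2\<close>, the unknown part is absorbed into the left-hand side, which accounts for the
  factor \<open>2\<close>.\<close>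

lemma tendsto_bop_inverse:
  fixes T S :: "'z \<Rightarrow> 'h::complex_hilbert_space bop"
  assumes lim: "(T \<longlongrightarrow> T0) F" and S0: "S0 * T0 = 1" "T0 * S0 = 1"
    and S: "\<forall>\<^sub>F w in F. S w * T w = 1 \<and> T w * S w = 1"
  shows "(S \<longlongrightarrow> S0) F"
proof -
  have 0: "((\<lambda>w. norm (T0 - T w)) \<longlongrightarrow> 0) F"
    using tendsto_diff[OF tendsto_const lim, of T0] by (intro tendsto_norm_zero) simp
  have "((\<lambda>w. norm (T0 - T w) * norm S0) \<longlongrightarrow> 0 * norm S0) F" by (intro tendsto_mult 0 tendsto_const)
  then have "\<forall>\<^sub>F w in F. norm (T0 - T w) * norm S0 < 1/2" by (rule order_tendstoD(2)) simp
  with S have "\<forall>\<^sub>F w in F. norm (S w - S0) \<le> 2 * norm S0 * (norm (T0 - T w) * norm S0)"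
  proof eventually_elim
    case (elim w)
    define d where "d = norm (T0 - T w) * norm S0"
    have "S w * (T0 - T w) * S0 = S w * (T0 * S0) - (S w * T w) * S0"
      by (simp add: right_diff_distrib left_diff_distrib mult.assoc)
    then have "S w - S0 = S w * (T0 - T w) * S0" using elim S0 by simp
    then have "norm (S w - S0) \<le> norm (S w) * d"
      unfolding d_def using norm_mult_ineq[of "S w * (T0 - T w)" S0] norm_mult_ineq[of "S w" "T0 - T w"]
      by (smt (verit) mult.assoc mult_right_mono norm_ge_zero)
    also have "norm (S w) \<le> norm S0 + norm (S w - S0)" using norm_triangle_ineq[of S0 "S w - S0"] by simp
    then have "norm (S w) * d \<le> (norm S0 + norm (S w - S0)) * d" by (rule mult_right_mono) (simp add: d_def)
    finally have "norm (S w - S0) \<le> norm S0 * d + norm (S w - S0) * d" by (simp add: distrib_right)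
    moreover have "norm (S w - S0) * d \<le> norm (S w - S0) * (1/2)"
      using elim by (intro mult_left_mono) (simp_all add: d_def)
    ultimately have "norm (S w - S0) \<le> 2 * norm S0 * d" by simp
    then show ?case by (simp add: d_def)
  qed
  moreover have "((\<lambda>w. 2 * norm S0 * (norm (T0 - T w) * norm S0)) \<longlongrightarrow> 2 * norm S0 * (0 * norm S0)) F"
    by (intro tendsto_mult 0 tendsto_const)
  then have "((\<lambda>w. 2 * norm S0 * (norm (T0 - T w) * norm S0)) \<longlongrightarrow> 0) F" by simp
  ultimately have "((\<lambda>w. S w - S0) \<longlongrightarrow> 0) F" by (rule Lim_null_comparison)
  then show ?thesis by (simp add: LIM_zero_iff)
qed

section \<open>Rules for derivatives and for multiplication by a monomial\<close>

lemma has_zderiv_cong: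
  assumes "has_zderiv h D z" "\<forall>\<^sub>F w in at z. h w = k w" "h z = k z"
  shows "has_zderiv k D z"
  using assms(1) unfolding has_zderiv_def
  by (rule Lim_transform_eventually) (use assms(2) in eventually_elim, simp add: assms(3))

lemma has_zderiv_scaleC:
  fixes h :: "logcover0 \<Rightarrow> 'a::complex_normed_vector"
  assumes z: "z \<noteq> 0" and g: "has_zderiv g D z" and h: "has_zderiv h D' z"
  shows "has_zderiv (\<lambda>w. g w *\<^sub>C h w) (D *\<^sub>C h z + g z *\<^sub>C D') z"
proof -
  let ?i = "\<lambda>w. inverse (zproj w - zproj z)"
  have "((\<lambda>w. (?i w *\<^sub>C (g w - g z)) *\<^sub>C h w + g z *\<^sub>C (?i w *\<^sub>C (h w - h z))) \<longlongrightarrow>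
      D *\<^sub>C h z + g z *\<^sub>C D') (at z)"
    using g h has_zderiv_continuous[OF z h] unfolding has_zderiv_def
    by (intro tendsto_add tendsto_scaleC tendsto_const)
  moreover have "(?i w *\<^sub>C (g w - g z)) *\<^sub>C h w + g z *\<^sub>C (?i w *\<^sub>C (h w - h z)) =
      ?i w *\<^sub>C (g w *\<^sub>C h w - g z *\<^sub>C h z)" for w
    by (simp add: scaleC_eq_complex scaleC_scaleC complex_vector.scale_right_diff_distrib
        complex_vector.scale_left_diff_distrib right_diff_distrib left_diff_distrib mult.commute)
  ultimately show ?thesis unfolding has_zderiv_def by simp
qed

lemma conv_single:
  fixes c :: "'g::linordered_ab_group_add \<Rightarrow> 'a::complex_normed_vector"
  shows "conv (*\<^sub>C) (\<lambda>\<gamma>. if \<gamma> = m then 1 else 0) c = (\<lambda>\<gamma>. c (\<gamma> - m))"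
proof
  fix \<gamma>
  have one: "\<alpha> \<in> hsupp (\<lambda>\<gamma>. if \<gamma> = m then 1 else (0::complex)) \<longleftrightarrow> \<alpha> = m" for \<alpha>
    by (simp add: in_hsupp)
  have "conv (*\<^sub>C) (\<lambda>\<gamma>. if \<gamma> = m then 1 else 0) c \<gamma> =
      (\<Sum>\<alpha>\<in>{m}. (if \<alpha> = m then 1 else 0) *\<^sub>C c (\<gamma> - \<alpha>))"
    unfolding conv_def by (rule sum.mono_neutral_left) (auto simp: one)
  then show "conv (*\<^sub>C) (\<lambda>\<gamma>. if \<gamma> = m then 1 else 0) c \<gamma> = c (\<gamma> - m)" by (simp add: scaleC_one)
qed

section \<open>Connectedness, and the way back from germs to Hahn functions\<close>

context hahn_exponents
begin

lemma nonzero_Y: "z \<in> Y \<Longrightarrow> z \<noteq> 0"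
  using zero_notin_Y by auto

lemma at_within_Y0: "z \<in> Y \<Longrightarrow> at z within insert 0 Y = at z"
  by (rule at_within_open_subset[OF _ open_Y]) auto

lemma at_within_zero: "at 0 within insert 0 Y = at 0 within Y"
  by (rule filter_eqI) (auto simp: eventually_at_topological)

lemma at_Y0_nontriv:
  assumes "z \<in> insert 0 Y"
  shows "at z within insert 0 Y \<noteq> bot"
  using assms F_nontriv at_nonzero_neq_bot[OF nonzero_Y, of z] at_within_Y0[of z] at_within_zero by auto

text \<open>The points near which \<open>P\<close> holds, and those near which it fails, both form
  relatively open sets. They cover the domain by assumption and are disjoint because the domain has
  no isolated points, so connectedness leaves only one of them.\<close>

lemma clopen_dichotomy:
  assumes conn: "connected (insert 0 Y)"
    and alt: "\<And>z. z \<in> insert 0 Y \<Longrightarrow>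
      (\<forall>\<^sub>F w in at z within insert 0 Y. P w) \<or> (\<forall>\<^sub>F w in at z within insert 0 Y. \<not> P w)"
  shows "(\<forall>z\<in>insert 0 Y. \<forall>\<^sub>F w in at z within insert 0 Y. P w) \<or>
    (\<forall>z\<in>insert 0 Y. \<forall>\<^sub>F w in at z within insert 0 Y. \<not> P w)"
proof -
  let ?Y = "insert 0 Y"
  \<comment> \<open>The exceptional point may lie anywhere, not only at the point considered. This
    makes \<open>U Q\<close> open by construction; a foreign exception is discarded by the
    separation axiom.\<close>
  define U where "U Q = \<Union>{V. open V \<and> (\<exists>z. \<forall>w\<in>V \<inter> ?Y - {z}. Q w)}" for Q
  have open_U: "open (U Q)" for Q unfolding U_def by (rule open_Union) simp
  have U: "z \<in> U Q" if ev: "\<forall>\<^sub>F w in at z within ?Y. Q w" for z Q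
  proof -
    obtain V where V: "open V" "z \<in> V" "\<forall>w\<in>V. w \<noteq> z \<longrightarrow> w \<in> ?Y \<longrightarrow> Q w"
      using ev unfolding eventually_at_topological by auto
    then have "V \<in> {V. open V \<and> (\<exists>z. \<forall>w\<in>V \<inter> ?Y - {z}. Q w)}" by auto
    then show ?thesis unfolding U_def using V(2) by (rule UnionI)
  qed
  have U': "\<forall>\<^sub>F w in at z within ?Y. Q w" if zU: "z \<in> U Q" for z Q
  proof -
    obtain V where "V \<in> {V. open V \<and> (\<exists>z. \<forall>w\<in>V \<inter> ?Y - {z}. Q w)}" "z \<in> V"
      using zU unfolding U_def by (rule UnionE)
    then obtain y where V: "open V" "z \<in> V" "\<forall>w\<in>V \<inter> ?Y - {y}. Q w" by auto
    have "\<forall>\<^sub>F w in at z within ?Y. w \<in> V" by (rule eventually_at_in_open'[OF V(1,2), THEN filter_leD[OF at_le, rotated]]) auto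
    moreover have "\<forall>\<^sub>F w in at z within ?Y. w \<noteq> y" by (rule eventually_neq_at_within)
    moreover have "\<forall>\<^sub>F w in at z within ?Y. w \<in> ?Y" by (auto simp: eventually_at_filter)
    ultimately show ?thesis by eventually_elim (use V(3) in auto)
  qed
  have "?Y \<subseteq> U P \<union> U (\<lambda>w. \<not> P w)" using alt U by blast
  moreover have "U P \<inter> U (\<lambda>w. \<not> P w) \<inter> ?Y = {}"
  proof (rule ccontr)
    assume "U P \<inter> U (\<lambda>w. \<not> P w) \<inter> ?Y \<noteq> {}"
    then obtain z where z: "z \<in> U P" "z \<in> U (\<lambda>w. \<not> P w)" "z \<in> ?Y" by auto
    from U'[OF z(1)] U'[OF z(2)] have "\<forall>\<^sub>F w in at z within ?Y. False" by eventually_elim simp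
    then show False using at_Y0_nontriv[OF z(3)] by (simp add: eventually_False)
  qed
  ultimately have "U P \<inter> ?Y = {} \<or> U (\<lambda>w. \<not> P w) \<inter> ?Y = {}"
    using connectedD[OF conn open_U open_U, of P "\<lambda>w. \<not> P w"] by blast
  then show ?thesis
  proof
    assume *: "U P \<inter> ?Y = {}"
    have "\<forall>\<^sub>F w in at z within ?Y. \<not> P w" if "z \<in> ?Y" for z
      using alt[OF that] U[of P z] that * by auto
    then show ?thesis by simp
  next
    assume *: "U (\<lambda>w. \<not> P w) \<inter> ?Y = {}"
    have "\<forall>\<^sub>F w in at z within ?Y. P w" if "z \<in> ?Y" for z
      using alt[OF that] U[of "\<lambda>w. \<not> P w" z] that * by auto
    then show ?thesis by simp
  qed
qed

lemma germ_hahn_holomorphic: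
  assumes \<delta>: "0 < \<delta>" "Y' = Y \<inter> zdisc \<delta>" and h: "germ h a" "hsupp a \<subseteq> {0..}" "h 0 = a 0"
    and hol: "\<And>z. z \<in> Y' \<Longrightarrow> \<exists>D. has_zderiv h D z"
  shows "hahn_holomorphic_with Y' e UNIV h a"
proof (rule hahn_holomorphic_withI[OF \<delta> h(1,2)])
  show "zholomorphic_on h Y'" using hol by (simp add: zholomorphic_on_def)
  show "continuous_on (insert 0 Y') h"
    unfolding continuous_on_def
  proof
    fix z assume "z \<in> insert 0 Y'"
    then consider "z = 0" | "z \<in> Y'" by blast
    then show "(h \<longlongrightarrow> h z) (at z within insert 0 Y')"
    proof cases
      case 1
      have "(h \<longlongrightarrow> a 0) (at 0 within insert 0 Y)"
        unfolding at_within_zero by (rule germ_tendsto[OF h(1,2)])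
      then have "(h \<longlongrightarrow> a 0) (at 0 within insert 0 Y')" by (rule tendsto_within_subset) (use \<delta>(2) in auto)
      then show ?thesis using 1 h(3) by simp
    next
      case 2
      then have "z \<noteq> 0" using \<delta>(2) by (auto dest: nonzero_Y)
      moreover obtain D where "has_zderiv h D z" using hol[OF 2] by auto
      ultimately have "(h \<longlongrightarrow> h z) (at z)" by (rule has_zderiv_continuous)
      then show ?thesis by (rule tendsto_within_subset) simp
    qed
  qed
qed

text \<open>A single monomial serves as denominator: with \<open>- m\<close> a lower bound of the
  support, multiplication by \<open>e m\<close> shifts all exponents to be non-negative, and the
  formal inverse is the monomial at \<open>- m\<close>.\<close>

lemma germ_hahn_meromorphic:
  fixes h :: "logcover0 \<Rightarrow> 'a::complex_banach_algebra"
  assumes h: "germ h a" and mero: "zmeromorphic_on h Y"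
    and hol: "\<forall>\<^sub>F z in at 0 within Y. \<exists>D. has_zderiv h D z"
  shows "hahn_meromorphic_with Y e UNIV h a"
proof -
  obtain \<delta> where \<delta>: "0 < \<delta>" "\<And>z. z \<in> Y \<inter> zdisc \<delta> \<Longrightarrow> \<exists>D. has_zderiv h D z"
    using hol unfolding eventually_zero by auto
  obtain m where m: "0 \<le> m" "\<And>\<gamma>. \<gamma> \<in> hsupp a \<Longrightarrow> - m \<le> \<gamma>"
  proof (cases "hsupp a = {}")
    case True
    then show ?thesis using that[of 0] by simp
  next
    case False
    then obtain \<mu> where \<mu>: "hsupp a \<subseteq> {\<mu>..}" using germ_min[OF h] by blast
    \<comment> \<open>The maximum with \<open>0\<close> keeps the denominator \<open>e m\<close>
      itself free of negative exponents.\<close>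
    show ?thesis
    proof (rule that[of "max 0 (- \<mu>)"])
      show "- max 0 (- \<mu>) \<le> \<gamma>" if "\<gamma> \<in> hsupp a" for \<gamma>
      proof -
        have "- max 0 (- \<mu>) \<le> \<mu>" by (simp add: minus_le_iff)
        also have "\<mu> \<le> \<gamma>" using \<mu> that by auto
        finally show ?thesis .
      qed
    qed simp
  qed
  define b where "b \<gamma> = (if \<gamma> = m then 1 else 0 :: complex)" for \<gamma>
  define b' where "b' \<gamma> = (if \<gamma> = - m then 1 else 0 :: complex)" for \<gamma>
  define c where "c \<gamma> = a (\<gamma> - m)" for \<gamma>
  \<comment> \<open>At \<open>0\<close> both \<open>g\<close> and \<open>k\<close> receive their
    constant coefficient, the limit of the germ, which makes them continuous there.\<close>
  define g where "g z = (if z = 0 then b 0 else e m z)" for z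
  define k where "k z = (if z = 0 then c 0 else e m z *\<^sub>C h z)" for z
  have e_deriv: "\<exists>D. has_zderiv (e m) D z" if "z \<in> Y" for z
    using e_holomorphic[of m] that by (simp add: zholomorphic_on_def)
  have ev0: "\<forall>\<^sub>F z in at 0 within Y. z \<noteq> 0" by (rule eventually_neq_at_within)
  have nz: "\<forall>\<^sub>F w in at z. w \<noteq> 0" for z :: logcover0 by (rule eventually_neq_at_within)
  have "germ g b"
  proof (rule germ_cong)
    show "germ (\<lambda>z. e m z *\<^sub>C 1) b" unfolding b_def[abs_def] by (rule germ_single)
    show "\<forall>\<^sub>F z in at 0 within Y. e m z *\<^sub>C 1 = g z"
      using ev0 by eventually_elim (simp add: g_def scaleC_eq_complex)
  qed
  moreover have "hsupp b \<subseteq> {0..}" using m(1) by (auto simp: b_def hsupp_def)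
  moreover have "\<exists>D. has_zderiv g D z" if z: "z \<in> Y \<inter> zdisc \<delta>" for z
  proof -
    have z0: "z \<noteq> 0" using z nonzero_Y by auto
    obtain D where D: "has_zderiv (e m) D z" using e_deriv[of z] z by auto
    have "has_zderiv g D z"
    proof (rule has_zderiv_cong[OF D])
      show "\<forall>\<^sub>F w in at z. e m w = g w" using nz[of z] by eventually_elim (simp add: g_def)
    qed (simp add: g_def z0)
    then show ?thesis ..
  qed
  ultimately have g: "hahn_holomorphic_with (Y \<inter> zdisc \<delta>) e UNIV g b"
    by (intro germ_hahn_holomorphic[OF \<delta>(1) refl]) (auto simp: g_def)
  have "germ k c"
  proof (rule germ_cong)
    show "germ (\<lambda>z. e m z *\<^sub>C h z) c" unfolding c_def[abs_def] by (rule germ_shift[OF h])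
    show "\<forall>\<^sub>F z in at 0 within Y. e m z *\<^sub>C h z = k z"
      using ev0 by eventually_elim (simp add: k_def)
  qed
  moreover have "hsupp c \<subseteq> {0..}"
  proof
    fix \<gamma> assume "\<gamma> \<in> hsupp c"
    then have "\<gamma> - m \<in> hsupp a" by (simp add: c_def in_hsupp)
    from m(2)[OF this] show "\<gamma> \<in> {0..}" by simp
  qed
  moreover have "\<exists>D. has_zderiv k D z" if z: "z \<in> Y \<inter> zdisc \<delta>" for z
  proof -
    have z0: "z \<noteq> 0" using z nonzero_Y by auto
    obtain D where D: "has_zderiv (e m) D z" using e_deriv[of z] z by auto
    obtain D' where D': "has_zderiv h D' z" using \<delta>(2)[OF z] ..
    have "has_zderiv k (D *\<^sub>C h z + e m z *\<^sub>C D') z"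
    proof (rule has_zderiv_cong[OF has_zderiv_scaleC[OF z0 D D']])
      show "\<forall>\<^sub>F w in at z. e m w *\<^sub>C h w = k w" using nz[of z] by eventually_elim (simp add: k_def)
    qed (simp add: k_def z0)
    then show ?thesis ..
  qed
  ultimately have k: "hahn_holomorphic_with (Y \<inter> zdisc \<delta>) e UNIV k c"
    by (intro germ_hahn_holomorphic[OF \<delta>(1) refl]) (auto simp: k_def)
  have "is_hahn_inverse b b'"
    unfolding is_hahn_inverse_def
  proof
    have "hsupp b' \<subseteq> {- m}" by (auto simp: b'_def hsupp_def)
    then have "finite (hsupp b')" by (rule finite_subset) simp
    then show "hahn_series b'" unfolding hahn_series_def by (rule well_ordered_finite)
    show "hahn_mult b b' = hahn_one"
    proof
      fix \<gamma>
      have "\<gamma> + - m = - m \<longleftrightarrow> \<gamma> = 0" by (rule add_cancel_left_left)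
      then have *: "\<gamma> - m = - m \<longleftrightarrow> \<gamma> = 0" by (simp only: diff_conv_add_uminus)
      have "hahn_mult b b' \<gamma> = b' (\<gamma> - m)"
        unfolding hahn_mult_eq_conv b_def[abs_def] conv_single ..
      then show "hahn_mult b b' \<gamma> = hahn_one \<gamma>"
        unfolding b'_def hahn_one_def * .
    qed
  qed
  moreover have "a = hahn_mult b' c"
  proof
    fix \<gamma>
    have "hahn_mult b' c \<gamma> = c (\<gamma> - - m)"
      unfolding hahn_mult_eq_conv b'_def[abs_def] conv_single ..
    then show "a \<gamma> = hahn_mult b' c \<gamma>" by (simp add: c_def)
  qed
  moreover have "hsupp b \<noteq> {}"
  proof -
    have "m \<in> hsupp b" by (simp add: in_hsupp b_def)
    then show ?thesis by blast
  qed
  moreover have "\<forall>z\<in>Y \<inter> zdisc \<delta> - zpoles Y h. k z = g z *\<^sub>C h z"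
    using nonzero_Y by (auto simp: k_def g_def)
  ultimately have "\<exists>\<delta>>0. \<exists>g b k c b'.
        hahn_holomorphic_with (Y \<inter> zdisc \<delta>) e UNIV g b \<and> hsupp b \<noteq> {} \<and>
        hahn_holomorphic_with (Y \<inter> zdisc \<delta>) e UNIV k c \<and>
        (\<forall>z\<in>Y \<inter> zdisc \<delta> - zpoles Y h. k z = g z *\<^sub>C h z) \<and>
        is_hahn_inverse b b' \<and> a = hahn_mult b' c"
    using \<delta>(1) g k
    by (intro exI[of _ \<delta>] conjI exI[of _ g] exI[of _ b] exI[of _ k] exI[of _ c] exI[of _ b'])
  with mero show ?thesis unfolding hahn_meromorphic_with_def by simp
qed

lemma fredholm_alternative_local:
  fixes f :: "logcover0 \<Rightarrow> 'h::complex_hilbert_space bop"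
  assumes z: "z \<in> Y" and A: "has_laurent_expansion_at f z A"
    and H0: "fin_dim_csubspace H0" "\<And>k. k < 0 \<Longrightarrow> range (bop_apply (A k)) \<subseteq> H0"
    and cpt: "\<forall>\<^sub>F w in at z. f w \<in> compact_ops"
  shows "(\<forall>\<^sub>F w in at z. \<not> bop_invertible (1 - f w)) \<or>
    (\<exists>x b. has_laurent_expansion_at x z b \<and> (\<forall>k<0. finite_rank (b k)) \<and>
      (\<forall>\<^sub>F w in at z. x w * (1 - f w) = 1 \<and> (1 - f w) * x w = 1))"
proof -
  have z0: "z \<noteq> 0" by (rule nonzero_Y[OF z])
  interpret L: germs "at z" "at z" "laurent_exp z" by (rule germs_laurent[OF z0])
  have "(\<forall>\<^sub>F w in at z. \<not> bop_invertible (1 - f w)) \<or>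
    (\<exists>x b. L.germ x b \<and> (\<forall>k<0. finite_rank (b k)) \<and>
      (\<forall>\<^sub>F w in at z. x w * (1 - f w) = 1 \<and> (1 - f w) * x w = 1))"
    by (rule L.germ_fredholm[OF laurent_imp_germ[OF z0 A] H0(1) _ cpt]) (rule H0(2))
  then show ?thesis
    by (elim disj_forward ex_forward conj_forward) (simp_all add: germ_imp_laurent[OF z0])
qed

end

section \<open>Uniqueness of Laurent coefficients and removable singularities\<close>

lemma laurent_cong:
  assumes "has_laurent_expansion_at h z A" "\<forall>\<^sub>F w in at z. h w = k w"
  shows "has_laurent_expansion_at k z A"
  unfolding has_laurent_expansion_at_def
proof
  show "\<exists>m. \<forall>k<m. A k = 0" using assms(1) by (simp add: has_laurent_expansion_at_def)
  have "\<forall>\<^sub>F w in at z. ((\<lambda>k. ((zproj w - zproj z) powi k) *\<^sub>C A k) has_sum h w) UNIV"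
    using assms(1) by (simp add: has_laurent_expansion_at_def)
  with assms(2) show "\<forall>\<^sub>F w in at z. ((\<lambda>n. ((zproj w - zproj z) powi n) *\<^sub>C A n) has_sum k w) UNIV"
    by eventually_elim simp
qed

lemma laurent_unique:
  fixes h :: "logcover0 \<Rightarrow> 'a::{complex_normed_vector, banach}"
  assumes z: "z \<noteq> 0" and "has_laurent_expansion_at h z A" "has_laurent_expansion_at h z B"
  shows "A = B"
  using assms(2,3) by (intro germs.germ_unique[OF germs_laurent[OF z]] laurent_imp_germ[OF z])

text \<open>A finite limit bounds \<open>h\<close> near \<open>z\<close>, and bounded germs have no
  negative exponents.\<close>

lemma laurent_bounded_nonneg:
  fixes h :: "logcover0 \<Rightarrow> 'a::{complex_normed_vector, banach}"
  assumes z: "z \<noteq> 0" and A: "has_laurent_expansion_at h z A" and lim: "(h \<longlongrightarrow> l) (at z)"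
  shows "hsupp A \<subseteq> {0..}" "A 0 = l"
proof -
  interpret L: germs "at z" "at z" "laurent_exp z" by (rule germs_laurent[OF z])
  note g = laurent_imp_germ[OF z A]
  have "\<forall>\<^sub>F w in at z. dist (h w) l < 1" by (rule tendstoD[OF lim]) simp
  then have "\<forall>\<^sub>F w in at z. norm (h w) \<le> norm l + 1"
  proof eventually_elim
    case (elim w)
    have "norm (h w) \<le> norm l + norm (h w - l)" using norm_triangle_ineq[of l "h w - l"] by simp
    then show ?case using elim by (simp add: dist_norm)
  qed
  then show supp: "hsupp A \<subseteq> {0..}" by (rule L.germ_bounded_nonneg[OF g])
  show "A 0 = l" by (rule tendsto_unique[OF L.F_nontriv L.germ_tendsto[OF g supp] lim])
qed

section \<open>The global alternative\<close>

context hahn_exponents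
begin

text \<open>Collects what the holomorphic and the meromorphic case have in common:
  \<open>Dom\<close> contains a punctured neighbourhood of every point relative to the domain,
  \<open>f\<close> is continuous on it, and all local series have their negative part in one space
  \<open>H0\<close>. The local alternatives are joined by \<open>clopen_dichotomy\<close>.\<close>

theorem fredholm_global:
  fixes f :: "logcover0 \<Rightarrow> 'h::complex_hilbert_space bop"
  assumes conn: "connected (insert 0 Y)" and Dom: "Dom \<subseteq> insert 0 Y"
    and H0: "fin_dim_csubspace H0"
    and f0: "germ f a0" "\<And>\<gamma>. \<gamma> < 0 \<Longrightarrow> range (bop_apply (a0 \<gamma>)) \<subseteq> H0"
    and dom0: "\<forall>\<^sub>F z in at 0 within Y. z \<in> Dom \<and> f z \<in> compact_ops"
    and fz: "\<And>z. z \<in> Y \<Longrightarrow> \<exists>A. has_laurent_expansion_at f z A \<and> (\<forall>k<0. range (bop_apply (A k)) \<subseteq> H0)"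
    and domz: "\<And>z. z \<in> Y \<Longrightarrow> \<forall>\<^sub>F w in at z. w \<in> Dom \<and> f w \<in> compact_ops"
    and cont: "\<And>z. z \<in> Dom \<Longrightarrow> (f \<longlongrightarrow> f z) (at z within insert 0 Y)"
  shows "(\<forall>z\<in>Dom. \<not> bop_invertible (1 - f z)) \<or>
    (\<forall>z\<in>insert 0 Y. \<not> z islimpt (insert 0 Y - {w\<in>Dom. bop_invertible (1 - f w)})) \<and>
    (\<exists>F a.
       (\<forall>z\<in>Dom. bop_invertible (1 - f z) \<longrightarrow> F z * (1 - f z) = 1 \<and> (1 - f z) * F z = 1) \<and>
       hahn_meromorphic_with Y e UNIV F a \<and>
       (\<forall>\<gamma><0. finite_rank (a \<gamma>)) \<and>
       (\<forall>z\<in>Y. \<exists>A. has_laurent_expansion_at F z A \<and> (\<forall>k<0. finite_rank (A k))))"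
proof -
  let ?Y = "insert 0 Y"
  define P where "P w \<longleftrightarrow> w \<in> Dom \<and> bop_invertible (1 - f w)" for w
  define is_inv where "is_inv S w \<longleftrightarrow> S * (1 - f w) = 1 \<and> (1 - f w) * S = 1" for S w
  have is_inv_unique: "S = S'" if "is_inv S w" "is_inv S' w" for S S' w
    using that unfolding is_inv_def by (auto intro: bop_inverse_unique)
  have is_inv_P: "P w" if "is_inv S w" "w \<in> Dom" for S w
    using that unfolding is_inv_def P_def by (auto intro: bop_invertibleI)
  have dom: "\<forall>\<^sub>F w in at z within ?Y. w \<in> Dom" if "z \<in> ?Y" for z
  proof (cases "z = 0")
    case True
    show ?thesis unfolding True at_within_zero using dom0 by eventually_elim simp
  next
    case False
    then have z: "z \<in> Y" using that by simp
    show ?thesis unfolding at_within_Y0[OF z] using domz[OF z] by eventually_elim simp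
  qed
  have cpt0: "\<forall>\<^sub>F z in at 0 within Y. f z \<in> compact_ops" using dom0 by eventually_elim simp
  have "(\<forall>\<^sub>F z in at 0 within Y. \<not> bop_invertible (1 - f z)) \<or>
    (\<exists>x b. germ x b \<and> (\<forall>\<gamma><0. finite_rank (b \<gamma>)) \<and>
      (\<forall>\<^sub>F z in at 0 within Y. x z * (1 - f z) = 1 \<and> (1 - f z) * x z = 1))"
    by (rule germ_fredholm[OF f0(1) H0 _ cpt0]) (rule f0(2))
  then have alt0: "(\<forall>\<^sub>F z in at 0 within Y. \<not> bop_invertible (1 - f z)) \<or>
    (\<exists>x b. germ x b \<and> (\<forall>\<gamma><0. finite_rank (b \<gamma>)) \<and> (\<forall>\<^sub>F z in at 0 within Y. is_inv (x z) z))"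
    unfolding is_inv_def .
  have altz: "(\<forall>\<^sub>F w in at z. \<not> bop_invertible (1 - f w)) \<or>
    (\<exists>x b. has_laurent_expansion_at x z b \<and> (\<forall>k<0. finite_rank (b k)) \<and> (\<forall>\<^sub>F w in at z. is_inv (x w) w))"
    if z: "z \<in> Y" for z
  proof -
    obtain A where A: "has_laurent_expansion_at f z A" "\<forall>k<0. range (bop_apply (A k)) \<subseteq> H0"
      using fz[OF z] by auto
    have "\<forall>\<^sub>F w in at z. f w \<in> compact_ops" using domz[OF z] by eventually_elim simp
    then show ?thesis unfolding is_inv_def
      by (rule fredholm_alternative_local[OF z A(1) H0, rotated]) (use A(2) in simp)
  qed
  have dichotomy: "(\<forall>\<^sub>F w in at z within ?Y. P w) \<or> (\<forall>\<^sub>F w in at z within ?Y. \<not> P w)"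
    if zY: "z \<in> ?Y" for z
  proof (cases "z = 0")
    case True
    from alt0 show ?thesis
    proof
      assume "\<forall>\<^sub>F z in at 0 within Y. \<not> bop_invertible (1 - f z)"
      then have "\<forall>\<^sub>F w in at z within ?Y. \<not> P w"
        unfolding True at_within_zero by eventually_elim (simp add: P_def)
      then show ?thesis ..
    next
      assume "\<exists>x b. germ x b \<and> (\<forall>\<gamma><0. finite_rank (b \<gamma>)) \<and> (\<forall>\<^sub>F z in at 0 within Y. is_inv (x z) z)"
      then obtain x where "\<forall>\<^sub>F z in at 0 within Y. is_inv (x z) z" by auto
      with dom[OF zY] have "\<forall>\<^sub>F w in at z within ?Y. P w"
        unfolding True at_within_zero by eventually_elim (rule is_inv_P)
      then show ?thesis ..
    qed
  next
    case False
    then have z: "z \<in> Y" using zY by simp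
    from altz[OF z] show ?thesis
    proof
      assume "\<forall>\<^sub>F w in at z. \<not> bop_invertible (1 - f w)"
      then have "\<forall>\<^sub>F w in at z within ?Y. \<not> P w"
        unfolding at_within_Y0[OF z] by eventually_elim (simp add: P_def)
      then show ?thesis ..
    next
      assume "\<exists>x b. has_laurent_expansion_at x z b \<and> (\<forall>k<0. finite_rank (b k)) \<and> (\<forall>\<^sub>F w in at z. is_inv (x w) w)"
      then obtain x where "\<forall>\<^sub>F w in at z. is_inv (x w) w" by auto
      with dom[OF zY] have "\<forall>\<^sub>F w in at z within ?Y. P w"
        unfolding at_within_Y0[OF z] by eventually_elim (rule is_inv_P)
      then show ?thesis ..
    qed
  qed
  have T_cont: "((\<lambda>w. 1 - f w) \<longlongrightarrow> 1 - f z) (at z within ?Y)" if "z \<in> Dom" for z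
    by (intro tendsto_diff tendsto_const cont that)
  from clopen_dichotomy[OF conn dichotomy] show ?thesis
  proof
    assume bad: "\<forall>z\<in>?Y. \<forall>\<^sub>F w in at z within ?Y. \<not> P w"
    \<comment> \<open>Invertibility is stable and \<open>f\<close> is continuous on
      \<open>Dom\<close>, so one invertible value would spread to a punctured neighbourhood, against
      \<open>bad\<close>.\<close>
    have "\<not> bop_invertible (1 - f z)" if z: "z \<in> Dom" for z
    proof
      assume "bop_invertible (1 - f z)"
      then have 1: "\<forall>\<^sub>F w in at z within ?Y. bop_invertible (1 - f w)"
        by (rule eventually_bop_invertible[OF T_cont[OF z]])
      have zY: "z \<in> ?Y" using z Dom by auto
      have 2: "\<forall>\<^sub>F w in at z within ?Y. \<not> P w" using bad zY by (rule bspec)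
      have "\<forall>\<^sub>F w in at z within ?Y. False"
        using 1 2 dom[OF zY] by eventually_elim (simp add: P_def)
      then show False using at_Y0_nontriv[OF zY] by (simp add: eventually_False)
    qed
    then show ?thesis by simp
  next
    assume good: "\<forall>z\<in>?Y. \<forall>\<^sub>F w in at z within ?Y. P w"
    have goodz: "\<forall>\<^sub>F w in at z. P w" if "z \<in> Y" for z
      using good that at_within_Y0[OF that] by auto
    have good0: "\<forall>\<^sub>F w in at 0 within Y. P w"
      using good at_within_zero by auto
    \<comment> \<open>The coefficients of the inverse at each point are selected before the inverse
      itself is fixed as a function, because its values at exceptional points will be read off from
      them.\<close>
    define Q where "Q z b \<longleftrightarrow> (\<exists>x. has_laurent_expansion_at x z b \<and> (\<forall>k<0. finite_rank (b k)) \<and>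
      (\<forall>\<^sub>F w in at z. is_inv (x w) w))" for z b
    define b where "b z = (SOME b. Q z b)" for z
    have Q: "Q z (b z)" if z: "z \<in> Y" for z
    proof -
      have "\<not> (\<forall>\<^sub>F w in at z. \<not> bop_invertible (1 - f w))"
      proof
        assume "\<forall>\<^sub>F w in at z. \<not> bop_invertible (1 - f w)"
        with goodz[OF z] have "\<forall>\<^sub>F w in at z. False" by eventually_elim (simp add: P_def)
        then show False using at_nonzero_neq_bot[OF nonzero_Y[OF z]] by (simp add: eventually_False)
      qed
      with altz[OF z] have "\<exists>b. Q z b" unfolding Q_def by auto
      then show ?thesis unfolding b_def by (rule someI_ex)
    qed
    \<comment> \<open>At exceptional points the constant coefficient is assigned. If the Laurent
      series there has no negative terms, this fills a removable singularity; at a genuine pole the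
      value is immaterial.\<close>
    define F where "F z = (if P z then SOME S. is_inv S z else b z 0)" for z
    have F_inv: "is_inv (F z) z" if "P z" for z
    proof -
      have "\<exists>S. is_inv S z" using that unfolding P_def is_inv_def bop_invertible_def by blast
      then have "is_inv (SOME S. is_inv S z) z" by (rule someI_ex)
      then show ?thesis using that by (simp add: F_def)
    qed
    have F_laurent: "has_laurent_expansion_at F z (b z)" if z: "z \<in> Y" for z
    proof -
      obtain x where x: "has_laurent_expansion_at x z (b z)" "\<forall>\<^sub>F w in at z. is_inv (x w) w"
        using Q[OF z] unfolding Q_def by auto
      have "\<forall>\<^sub>F w in at z. x w = F w"
        using x(2) goodz[OF z] by eventually_elim (rule is_inv_unique, assumption, rule F_inv)
      with x(1) show ?thesis by (rule laurent_cong)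
    qed
    have b_finite: "finite_rank (b z k)" if "z \<in> Y" "k < 0" for z k
      using Q[OF that(1)] that(2) unfolding Q_def by auto
    have "\<not> (\<forall>\<^sub>F z in at 0 within Y. \<not> bop_invertible (1 - f z))"
    proof
      assume "\<forall>\<^sub>F z in at 0 within Y. \<not> bop_invertible (1 - f z)"
      with good0 have "\<forall>\<^sub>F z in at 0 within Y. False" by eventually_elim (simp add: P_def)
      then show False using F_nontriv by (simp add: eventually_False)
    qed
    with alt0 obtain x0 b0 where x0: "germ x0 b0" "\<forall>\<gamma><0. finite_rank (b0 \<gamma>)"
      "\<forall>\<^sub>F z in at 0 within Y. is_inv (x0 z) z" by auto
    have "\<forall>\<^sub>F z in at 0 within Y. x0 z = F z"
      using x0(3) good0 by eventually_elim (rule is_inv_unique, assumption, rule F_inv)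
    with x0(1) have F_germ: "germ F b0" by (rule germ_cong)
    \<comment> \<open>Where \<open>1 - f\<close> is invertible at \<open>z\<close> itself, inversion
      is continuous, so \<open>F\<close> has the limit \<open>F z\<close> and its series starts at
      exponent \<open>0\<close>.\<close>
    have F_pos: "hsupp (b z) \<subseteq> {0..}" "b z 0 = F z" if z: "z \<in> Y" "P z" for z
    proof -
      have "(F \<longlongrightarrow> F z) (at z)"
      proof (rule tendsto_bop_inverse)
        show "((\<lambda>w. 1 - f w) \<longlongrightarrow> 1 - f z) (at z)"
          using T_cont[of z] z(2) unfolding at_within_Y0[OF z(1)] P_def by simp
        show "F z * (1 - f z) = 1" "(1 - f z) * F z = 1" using F_inv[OF z(2)] by (simp_all add: is_inv_def)
        show "\<forall>\<^sub>F w in at z. F w * (1 - f w) = 1 \<and> (1 - f w) * F w = 1"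
          using goodz[OF z(1)] by eventually_elim (use F_inv in \<open>simp add: is_inv_def\<close>)
      qed
      from laurent_bounded_nonneg[OF nonzero_Y[OF z(1)] F_laurent[OF z(1)] this]
      show "hsupp (b z) \<subseteq> {0..}" "b z 0 = F z" by simp_all
    qed
    have F_deriv: "has_zderiv F (b z 1) z" if z: "z \<in> Y" "hsupp (b z) \<subseteq> {0..}" for z
    proof -
      have z0: "z \<noteq> 0" by (rule nonzero_Y[OF z(1)])
      have "F z = b z 0" using F_pos(2)[OF z(1)] by (cases "P z") (simp_all add: F_def)
      then show ?thesis by (rule laurent_has_zderiv[OF z0 laurent_imp_germ[OF z0 F_laurent[OF z(1)]] z(2)])
    qed
    \<comment> \<open>The poles of \<open>F\<close> lie in the exceptional set, and so inherit its
      discreteness.\<close>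
    have pole: "\<not> P z" if z: "z \<in> zpoles Y F" for z
    proof
      assume "P z"
      obtain A k where A: "z \<in> Y" "has_laurent_expansion_at F z A" "k < 0" "A k \<noteq> 0"
        using z unfolding zpoles_def by auto
      have "A = b z" by (rule laurent_unique[OF nonzero_Y[OF A(1)] A(2) F_laurent[OF A(1)]])
      then have "k \<in> hsupp (b z)" using A(4) by (simp add: in_hsupp)
      then show False using F_pos(1)[OF A(1) \<open>P z\<close>] A(3) by auto
    qed
    have nonpole: "hsupp (b z) \<subseteq> {0..}" if z: "z \<in> Y" "z \<notin> zpoles Y F" for z
    proof
      fix k assume "k \<in> hsupp (b z)"
      then have "\<not> k < 0" using z F_laurent[OF z(1)] unfolding zpoles_def in_hsupp by auto
      then show "k \<in> {0..}" by simp
    qed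
    have discrete: "\<not> z islimpt (?Y - {w\<in>Dom. bop_invertible (1 - f w)})" if z: "z \<in> ?Y" for z
    proof -
      have "\<forall>\<^sub>F w in at z within ?Y. P w" using good z by (rule bspec)
      then obtain V where "open V \<and> z \<in> V \<and> (\<forall>w\<in>V. w \<noteq> z \<longrightarrow> w \<in> ?Y \<longrightarrow> P w)"
        unfolding eventually_at_topological ..
      then have V: "open V" "z \<in> V" "\<forall>w\<in>V. w \<noteq> z \<longrightarrow> w \<in> ?Y \<longrightarrow> P w" by simp_all
      have "\<not> (\<exists>y\<in>?Y - {w\<in>Dom. bop_invertible (1 - f w)}. y \<in> V \<and> y \<noteq> z)"
        using V(3) unfolding P_def by auto
      then show ?thesis unfolding islimpt_def using V(1,2) by auto
    qed
    have "zmeromorphic_on F Y"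
      unfolding zmeromorphic_on_def zholomorphic_on_def
    proof (intro conjI ballI)
      fix z assume "z \<in> Y"
      then have lim: "\<not> z islimpt (?Y - {w\<in>Dom. bop_invertible (1 - f w)})"
        by (rule discrete[OF insertI2])
      have "zpoles Y F \<subseteq> ?Y - {w\<in>Dom. bop_invertible (1 - f w)}"
      proof
        fix w assume w: "w \<in> zpoles Y F"
        have "zpoles Y F \<subseteq> Y" unfolding zpoles_def by (rule Collect_subset)
        then have "w \<in> Y" using w by (rule subsetD)
        then show "w \<in> ?Y - {w\<in>Dom. bop_invertible (1 - f w)}" using pole[OF w] by (simp add: P_def)
      qed
      then show "\<not> z islimpt zpoles Y F" using lim islimpt_subset[of z "zpoles Y F"] by meson
    next
      fix z assume "z \<in> Y - zpoles Y F"
      then show "\<exists>D. has_zderiv F D z" using F_deriv[of z] nonpole[of z] by (intro exI) simp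
    qed
    moreover have "\<forall>\<^sub>F z in at 0 within Y. \<exists>D. has_zderiv F D z"
    proof -
      have "\<forall>\<^sub>F z in at 0 within Y. z \<in> Y" by (auto simp: eventually_at_filter)
      with good0 show ?thesis
        by eventually_elim (rule exI, rule F_deriv, assumption, rule F_pos(1))
    qed
    ultimately have "hahn_meromorphic_with Y e UNIV F b0" by (rule germ_hahn_meromorphic[OF F_germ])
    moreover have "F z * (1 - f z) = 1 \<and> (1 - f z) * F z = 1" if "z \<in> Dom" "bop_invertible (1 - f z)" for z
      using F_inv[of z] that by (simp add: P_def is_inv_def)
    moreover have "\<exists>A. has_laurent_expansion_at F z A \<and> (\<forall>k<0. finite_rank (A k))" if "z \<in> Y" for z
      using F_laurent[OF that] b_finite[OF that] by auto
    ultimately have "\<exists>F a.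
       (\<forall>z\<in>Dom. bop_invertible (1 - f z) \<longrightarrow> F z * (1 - f z) = 1 \<and> (1 - f z) * F z = 1) \<and>
       hahn_meromorphic_with Y e UNIV F a \<and>
       (\<forall>\<gamma><0. finite_rank (a \<gamma>)) \<and>
       (\<forall>z\<in>Y. \<exists>A. has_laurent_expansion_at F z A \<and> (\<forall>k<0. finite_rank (A k)))"
      using x0(2) by (intro exI[of _ F] exI[of _ b0]) simp
    then show ?thesis using discrete by simp
  qed
qed

section \<open>Hahn holomorphic and Hahn meromorphic functions as input\<close>

lemma laurent_of_holomorphic_on:
  fixes f :: "logcover0 \<Rightarrow> 'h::complex_hilbert_space bop"
  assumes "open U" "0 \<notin> U" "zholomorphic_on f U" "z \<in> U"
  shows "\<exists>A. has_laurent_expansion_at f z A \<and> (\<forall>k<0. A k = 0)"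
proof (rule bop_laurent_of_holomorphic)
  show "z \<noteq> 0" using assms by auto
  show "\<forall>\<^sub>F w in nhds z. \<exists>D. has_zderiv f D w"
    unfolding eventually_nhds using assms by (intro exI[of _ U]) (auto simp: zholomorphic_on_def)
qed

lemma fredholm_holomorphic_data:
  fixes f :: "logcover0 \<Rightarrow> 'h::complex_hilbert_space bop"
  assumes h: "hahn_holomorphic_with Y e compact_ops f a"
  shows "germ f a" "\<And>\<gamma>. \<gamma> < 0 \<Longrightarrow> a \<gamma> = 0"
    "\<forall>\<^sub>F z in at 0 within Y. z \<in> insert 0 Y \<and> f z \<in> compact_ops"
    "\<And>z. z \<in> Y \<Longrightarrow> \<exists>A. has_laurent_expansion_at f z A \<and> (\<forall>k<0. A k = 0)"
    "\<And>z. z \<in> Y \<Longrightarrow> \<forall>\<^sub>F w in at z. w \<in> insert 0 Y \<and> f w \<in> compact_ops"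
    "\<And>z. z \<in> insert 0 Y \<Longrightarrow> (f \<longlongrightarrow> f z) (at z within insert 0 Y)"
proof -
  have cpt: "f ` insert 0 Y \<subseteq> compact_ops" and cont: "continuous_on (insert 0 Y) f" and hol: "zholomorphic_on f Y"
    using h by (simp_all add: hahn_holomorphic_with_def)
  note g = hahn_holomorphic_germ[where \<delta> = 1 and Y' = Y, OF _ _ _ h]
  show "germ f a" by (rule g(1)) auto
  have supp: "hsupp a \<subseteq> {0..}" by (rule g(2)) auto
  show "a \<gamma> = 0" if "\<gamma> < 0" for \<gamma>
  proof (rule ccontr)
    assume "a \<gamma> \<noteq> 0"
    then have "\<gamma> \<in> {0..}" using supp by (auto simp: hsupp_def)
    then show False using that by simp
  qed
  show "\<forall>\<^sub>F z in at 0 within Y. z \<in> insert 0 Y \<and> f z \<in> compact_ops"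
    unfolding eventually_zero using cpt by (intro exI[of _ 1]) auto
  show "\<exists>A. has_laurent_expansion_at f z A \<and> (\<forall>k<0. A k = 0)" if "z \<in> Y" for z
    by (rule laurent_of_holomorphic_on[OF open_Y zero_notin_Y hol that])
  show "\<forall>\<^sub>F w in at z. w \<in> insert 0 Y \<and> f w \<in> compact_ops" if "z \<in> Y" for z
    using eventually_at_in_open'[OF open_Y that] by eventually_elim (use cpt in auto)
  show "(f \<longlongrightarrow> f z) (at z within insert 0 Y)" if "z \<in> insert 0 Y" for z
    using cont that unfolding continuous_on_def by blast
qed

text \<open>\<open>zmeromorphic_on\<close> forbids accumulation of poles only at points of
  \<open>Y\<close>, so \<open>0\<close> needs an argument: \<open>f\<close> has no pole where the
  denominator \<open>g\<close> is non-zero, and \<open>g\<close> is eventually non-zero as its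
  series is. The prescribed series is then the actual one, by uniqueness of the series of
  \<open>k\<close>.\<close>

lemma hahn_meromorphic_germ:
  fixes f :: "logcover0 \<Rightarrow> 'a::complex_banach_algebra"
  assumes h: "hahn_meromorphic_with Y e R f a"
  shows "germ f a" "\<forall>\<^sub>F z in at 0 within Y. z \<notin> zpoles Y f"
proof -
  have lim: "\<forall>z\<in>Y. \<not> z islimpt zpoles Y f"
    using h by (simp add: hahn_meromorphic_with_def zmeromorphic_on_def)
  obtain \<delta> g b k c b' where \<delta>: "0 < \<delta>" and g: "hahn_holomorphic_with (Y \<inter> zdisc \<delta>) e UNIV g b"
    and b: "hsupp b \<noteq> {}" and k: "hahn_holomorphic_with (Y \<inter> zdisc \<delta>) e R k c"
    and eq: "\<forall>z\<in>Y \<inter> zdisc \<delta> - zpoles Y f. k z = g z *\<^sub>C f z"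
    and inv: "is_hahn_inverse b b'" and a: "a = hahn_mult b' c"
    using h unfolding hahn_meromorphic_with_def by (elim conjE exE) (rule that)
  have sub: "Y \<inter> zdisc \<delta> \<subseteq> Y \<inter> zdisc \<delta>" "Y \<inter> zdisc \<delta> \<subseteq> Y" by auto
  have gb: "germ g b" and kc: "germ k c"
    using hahn_holomorphic_germ(1)[OF \<delta> sub g] hahn_holomorphic_germ(1)[OF \<delta> sub k] by simp_all
  have cont: "(g \<longlongrightarrow> g z) (at z)" "(k \<longlongrightarrow> k z) (at z)" if z: "z \<in> Y \<inter> zdisc \<delta>" for z
  proof -
    have z0: "z \<noteq> 0" using z nonzero_Y by auto
    have "zholomorphic_on g (Y \<inter> zdisc \<delta>)" "zholomorphic_on k (Y \<inter> zdisc \<delta>)"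
      using g k by (simp_all add: hahn_holomorphic_with_def)
    then have "\<exists>D. has_zderiv g D z" "\<exists>D. has_zderiv k D z"
      using z unfolding zholomorphic_on_def by simp_all
    then show "(g \<longlongrightarrow> g z) (at z)" "(k \<longlongrightarrow> k z) (at z)"
      by (auto dest: has_zderiv_continuous[OF z0])
  qed
  \<comment> \<open>Around such a point \<open>f\<close> agrees with the continuous quotient of
    \<open>k\<close> by \<open>g\<close>, so it has a finite limit and no principal part.\<close>
  have no_pole: "z \<notin> zpoles Y f" if z: "z \<in> Y \<inter> zdisc \<delta>" "g z \<noteq> 0" for z
  proof
    assume "z \<in> zpoles Y f"
    then obtain A n where A: "has_laurent_expansion_at f z A" "n < 0" "A n \<noteq> 0" unfolding zpoles_def by auto
    have z0: "z \<noteq> 0" using z nonzero_Y by auto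
    have "open (Y \<inter> zdisc \<delta>)" by (intro open_Int open_Y open_zdisc \<delta>)
    then have 1: "\<forall>\<^sub>F w in at z. w \<in> Y \<inter> zdisc \<delta>" using z(1) by (rule eventually_at_in_open')
    have "\<not> z islimpt zpoles Y f" using lim z(1) by simp
    then have 2: "\<forall>\<^sub>F w in at z. w \<notin> zpoles Y f" by (simp add: islimpt_iff_eventually)
    have 3: "\<forall>\<^sub>F w in at z. g w \<noteq> 0" by (rule tendsto_imp_eventually_ne[OF cont(1)[OF z(1)] z(2)])
    from 1 2 3 have "\<forall>\<^sub>F w in at z. inverse (g w) *\<^sub>C k w = f w"
    proof eventually_elim
      case (elim w)
      then have "k w = g w *\<^sub>C f w" using eq by simp
      then show ?case using elim(3) by (simp add: scaleC_scaleC scaleC_one)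
    qed
    moreover have "((\<lambda>w. inverse (g w) *\<^sub>C k w) \<longlongrightarrow> inverse (g z) *\<^sub>C k z) (at z)"
      using z by (intro tendsto_scaleC tendsto_inverse cont)
    ultimately have "(f \<longlongrightarrow> inverse (g z) *\<^sub>C k z) (at z)" by (rule Lim_transform_eventually[rotated])
    from laurent_bounded_nonneg(1)[OF z0 A(1) this] have "n \<in> {0..}" using A(3) by (auto simp: hsupp_def)
    then show False using A(2) by simp
  qed
  have in_disc: "\<forall>\<^sub>F z in at 0 within Y. z \<in> Y \<inter> zdisc \<delta>"
    unfolding eventually_zero using \<delta> by (intro exI[of _ \<delta>]) simp
  note g_nz = germ_eventually_nonzero[OF gb b]
  show no_poles: "\<forall>\<^sub>F z in at 0 within Y. z \<notin> zpoles Y f"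
    using in_disc g_nz by eventually_elim (rule no_pole)
  have kf: "\<forall>\<^sub>F z in at 0 within Y. k z = g z *\<^sub>C f z"
    using in_disc no_poles by eventually_elim (use eq in simp)
  obtain b'' where "germ (\<lambda>z. inverse (g z)) b''" using germ_inverse[OF gb b] by blast
  then have "germ (\<lambda>z. inverse (g z) *\<^sub>C k z) (conv (*\<^sub>C) b'' c)" using kc by (rule germ_scaleC)
  then have fp: "germ f (conv (*\<^sub>C) b'' c)"
  proof (rule germ_cong)
    show "\<forall>\<^sub>F z in at 0 within Y. inverse (g z) *\<^sub>C k z = f z"
      using kf g_nz by eventually_elim (simp add: scaleC_scaleC scaleC_one)
  qed
  \<comment> \<open>The series of the quotient function. Multiplied by \<open>b\<close> it
    represents \<open>k\<close>, hence equals \<open>c\<close>, and cancelling \<open>b\<close>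
    identifies it with \<open>a\<close>.\<close>
  define p where "p = conv (*\<^sub>C) b'' c"
  have "germ k (conv (*\<^sub>C) b p)"
    by (rule germ_cong[OF germ_scaleC[OF gb fp[folded p_def]]]) (use kf in \<open>eventually_elim, simp\<close>)
  then have "conv (*\<^sub>C) b p = c" using kc by (rule germ_unique)
  then have "a = p"
    unfolding a using hahn_inverse_mult[OF admD[OF germ_adm[OF gb]] admD[OF germ_adm[OF fp[folded p_def]]] inv]
    by simp
  then show "germ f a" using fp by (simp add: p_def)
qed

lemma fredholm_meromorphic_data:
  fixes f :: "logcover0 \<Rightarrow> 'h::complex_hilbert_space bop"
  assumes h: "hahn_meromorphic_with Y e compact_ops f a"
  shows "\<forall>\<^sub>F z in at 0 within Y. z \<in> Y - zpoles Y f \<and> f z \<in> compact_ops"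
    "\<And>z. z \<in> Y - zpoles Y f \<Longrightarrow> \<exists>A. has_laurent_expansion_at f z A \<and> (\<forall>k<0. A k = 0)"
    "\<And>z. z \<in> Y \<Longrightarrow> \<forall>\<^sub>F w in at z. w \<in> Y - zpoles Y f \<and> f w \<in> compact_ops"
    "\<And>z. z \<in> Y - zpoles Y f \<Longrightarrow> (f \<longlongrightarrow> f z) (at z within insert 0 Y)"
proof -
  have lim: "\<And>z. z \<in> Y \<Longrightarrow> \<not> z islimpt zpoles Y f" and hol: "zholomorphic_on f (Y - zpoles Y f)"
    and cpt: "f ` (Y - zpoles Y f) \<subseteq> compact_ops"
    using h by (simp_all add: hahn_meromorphic_with_def zmeromorphic_on_def)
  have "\<forall>\<^sub>F z in at 0 within Y. z \<in> Y" by (auto simp: eventually_at_filter)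
  with hahn_meromorphic_germ(2)[OF h]
  show "\<forall>\<^sub>F z in at 0 within Y. z \<in> Y - zpoles Y f \<and> f z \<in> compact_ops"
    by eventually_elim (use cpt in auto)
  have ev: "\<forall>\<^sub>F w in at z. w \<in> Y - zpoles Y f" if z: "z \<in> Y" for z
  proof -
    have "\<forall>\<^sub>F w in at z. w \<notin> zpoles Y f" using lim[OF z] by (simp add: islimpt_iff_eventually)
    with eventually_at_in_open'[OF open_Y z] show ?thesis by eventually_elim simp
  qed
  show "\<forall>\<^sub>F w in at z. w \<in> Y - zpoles Y f \<and> f w \<in> compact_ops" if "z \<in> Y" for z
    using ev[OF that] by eventually_elim (use cpt in auto)
  \<comment> \<open>Without accumulation of poles, each regular point has a whole neighbourhood of
    regular points.\<close>
  have "open (Y - zpoles Y f)"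
  proof (subst open_subopen, intro ballI)
    fix z assume z: "z \<in> Y - zpoles Y f"
    then have "\<forall>\<^sub>F w in at z. w \<in> Y - zpoles Y f" by (intro ev) simp
    then obtain V where "open V" "z \<in> V" "\<forall>w\<in>V. w \<noteq> z \<longrightarrow> w \<in> Y - zpoles Y f"
      unfolding eventually_at_topological by auto
    then show "\<exists>T. open T \<and> z \<in> T \<and> T \<subseteq> Y - zpoles Y f"
      using z by (intro exI[of _ V]) auto
  qed
  then show "\<exists>A. has_laurent_expansion_at f z A \<and> (\<forall>k<0. A k = 0)" if "z \<in> Y - zpoles Y f" for z
    by (rule laurent_of_holomorphic_on[OF _ _ hol that]) (use zero_notin_Y in simp)
  show "(f \<longlongrightarrow> f z) (at z within insert 0 Y)" if z: "z \<in> Y - zpoles Y f" for z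
  proof -
    obtain D where "has_zderiv f D z" using hol z unfolding zholomorphic_on_def by auto
    then have "(f \<longlongrightarrow> f z) (at z)" by (rule has_zderiv_continuous[rotated]) (use z nonzero_Y in auto)
    then show ?thesis by (rule tendsto_within_subset) simp
  qed
qed

end

theorem theorem4p1:
  fixes Y :: "logcover0 set"
    and e :: "'g::linordered_ab_group_add \<Rightarrow> logcover0 \<Rightarrow> complex"
    and f :: "logcover0 \<Rightarrow> 'h::complex_hilbert_space bop"
    and Dom :: "logcover0 set" \<comment> \<open>the points at which \<open>f\<close> is defined\<close>
  assumes "hahn_exponents Y e"
    and "connected (insert 0 Y)"
    and "hahn_holomorphic Y e compact_ops f \<and> Dom = insert 0 Y \<or>
      (\<exists>a H0. hahn_meromorphic_with Y e compact_ops f a \<and> Dom = Y - zpoles Y f \<and>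
         fin_dim_csubspace H0 \<and>
         (\<forall>\<gamma><0. range (bop_apply (a \<gamma>)) \<subseteq> H0) \<and>
         (\<forall>z\<in>zpoles Y f. \<exists>A. has_laurent_expansion_at f z A \<and>
            (\<forall>k<0. range (bop_apply (A k)) \<subseteq> H0)))"
  shows "(\<forall>z\<in>Dom. \<not> bop_invertible (1 - f z)) \<or>
    (\<forall>z\<in>insert 0 Y. \<not> z islimpt (insert 0 Y - {w\<in>Dom. bop_invertible (1 - f w)})) \<and>
    (\<exists>F a.
       (\<forall>z\<in>Dom. bop_invertible (1 - f z) \<longrightarrow> F z * (1 - f z) = 1 \<and> (1 - f z) * F z = 1) \<and>
       hahn_meromorphic_with Y e UNIV F a \<and>
       (\<forall>\<gamma><0. finite_rank (a \<gamma>)) \<and>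
       (\<forall>z\<in>Y. \<exists>A. has_laurent_expansion_at F z A \<and> (\<forall>k<0. finite_rank (A k))))"
proof -
  interpret hahn_exponents Y e by (rule assms(1))
  have zero_range: "range (bop_apply (0 :: 'h bop)) \<subseteq> H0" if "fin_dim_csubspace H0" for H0
    using that complex_vector.span_zero by (auto simp: fin_dim_csubspace_def)
  from assms(3) show ?thesis
  proof
    assume *: "hahn_holomorphic Y e compact_ops f \<and> Dom = insert 0 Y"
    then obtain a where a: "hahn_holomorphic_with Y e compact_ops f a" unfolding hahn_holomorphic_def by auto
    have Dom: "Dom = insert 0 Y" using * ..
    \<comment> \<open>A holomorphic \<open>f\<close> has no negative coefficients at all, so the
      zero space serves as \<open>H0\<close>.\<close>
    have H0: "fin_dim_csubspace (cspan {} :: 'h set)" unfolding fin_dim_csubspace_def by blast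
    note data = fredholm_holomorphic_data[OF a]
    show ?thesis
    proof (rule fredholm_global[OF assms(2) _ H0 data(1)])
      show "range (bop_apply (a \<gamma>)) \<subseteq> cspan {}" if "\<gamma> < 0" for \<gamma>
        unfolding data(2)[OF that] by (rule zero_range[OF H0])
      show "\<exists>A. has_laurent_expansion_at f z A \<and> (\<forall>k<0. range (bop_apply (A k)) \<subseteq> cspan {})" if "z \<in> Y" for z
        using data(4)[OF that] zero_range[OF H0] by auto
    qed (use data(3,5,6) in \<open>simp_all add: Dom\<close>)
  next
    assume "\<exists>a H0. hahn_meromorphic_with Y e compact_ops f a \<and> Dom = Y - zpoles Y f \<and>
         fin_dim_csubspace H0 \<and>
         (\<forall>\<gamma><0. range (bop_apply (a \<gamma>)) \<subseteq> H0) \<and>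
         (\<forall>z\<in>zpoles Y f. \<exists>A. has_laurent_expansion_at f z A \<and>
            (\<forall>k<0. range (bop_apply (A k)) \<subseteq> H0))"
    then obtain a H0 where a: "hahn_meromorphic_with Y e compact_ops f a" and Dom: "Dom = Y - zpoles Y f"
      and H0: "fin_dim_csubspace H0" and neg: "\<forall>\<gamma><0. range (bop_apply (a \<gamma>)) \<subseteq> H0"
      and poles: "\<forall>z\<in>zpoles Y f. \<exists>A. has_laurent_expansion_at f z A \<and>
            (\<forall>k<0. range (bop_apply (A k)) \<subseteq> H0)" by auto
    note data = fredholm_meromorphic_data[OF a]
    show ?thesis
    proof (rule fredholm_global[OF assms(2) _ H0 hahn_meromorphic_germ(1)[OF a]])
      show "Dom \<subseteq> insert 0 Y" using Dom by auto
      show "range (bop_apply (a \<gamma>)) \<subseteq> H0" if "\<gamma> < 0" for \<gamma> using neg that by simp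
      show "\<exists>A. has_laurent_expansion_at f z A \<and> (\<forall>k<0. range (bop_apply (A k)) \<subseteq> H0)" if "z \<in> Y" for z
      proof (cases "z \<in> zpoles Y f")
        case True
        then show ?thesis using poles by simp
      next
        case False
        then show ?thesis using data(2)[of z] that zero_range[OF H0] by auto
      qed
      show "\<forall>\<^sub>F z in at 0 within Y. z \<in> Dom \<and> f z \<in> compact_ops" using data(1) by (simp add: Dom)
      show "\<forall>\<^sub>F w in at z. w \<in> Dom \<and> f w \<in> compact_ops" if "z \<in> Y" for z using data(3)[OF that] by (simp add: Dom)
      show "(f \<longlongrightarrow> f z) (at z within insert 0 Y)" if "z \<in> Dom" for z using data(4)[of z] that by (simp add: Dom)
    qed
  qed
qed

end
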